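(* Let $K>0$ and let $\mu_0,\nu_0\in\mathcal M([0,2\pi)\times\mathbb R)$ be two initial probability measures with the same natural frequency density $g$ (i.e. both have $\Omega$-marginal $g(\Omega)\,d\Omega$), satisfying (i) $0<D_\theta(\nu_0)\le D_\theta(\mu_0)<\pi$ and $\displaystyle\int_{[0,2\pi]\times\mathbb R}\theta\,\mu_0(d\theta,d\Omega)=\int_{[0,2\pi]\times\mathbb R}\theta\,\nu_0(d\theta,d\Omega)=\pi$; (ii) $\displaystyle K>D_\Omega(\mu_0)\max\Big\{\frac1{\sin D_\theta(\mu_0)},\frac1{\sin D_\theta(\nu_0)}\Big\}$. Let $\mu_t$ and $\nu_t$ be the measure valued solutions to the kinetic Kuramoto equation with coupling strength $K$ and initial data $\mu_0$ and $\nu_0$, respectively. Then there exist $t_0>0$ and $D^\infty\in(0,\frac\pi2)$, with $D_\theta(\mu_t)\le D^\infty$ and $D_\theta(\nu_t)\le D^\infty$ for all $t\ge t_0$, such that $$\widetilde W_p(\mu_t,\nu_t)\le\exp\Big[-\frac{2K\cos D^\infty}{\pi}(t-t_0)\Big]\,\widetilde W_p(\mu_{t_0},\nu_{t_0}),\qquad t>t_0,\quad 1\le p\le\infty .$$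
   Context: The interval $[0,2\pi)$ is used to denote the circle $\mathbb T=\mathbb R/2\pi\mathbb Z$. $\mathcal M([0,2\pi)\times\mathbb R)$ is the set of nonnegative Radon measures on $[0,2\pi)\times\mathbb R$, and $\langle\nu,h\rangle:=\int_0^{2\pi}\int_{\mathbb R}h(\theta,\Omega)\,\nu(d\theta,d\Omega)$. Standing assumption on the natural frequency density: $g\ge0$ is integrable on $\mathbb R$, has bounded support, $g(-\Omega)=g(\Omega)$, $\int_{\mathbb R}\Omega g(\Omega)\,d\Omega=0$, $\int_{\mathbb R}g(\Omega)\,d\Omega=1$. The kinetic Kuramoto equation with coupling strength $K$ is $$\partial_t f+\partial_\theta(\omega[f]f)=0,\quad \omega[f](\theta,\Omega,t)=\Omega-K\int_{\mathbb T}\sin(\theta-\theta_* )\rho(\theta_*,t)\,d\theta_*,\quad \rho(\theta_*,t)=\int_{\mathbb R}f(\theta_*,\Omega_*,t)\,d\Omega_*,$$ with initial data satisfying $\int_{\mathbb T}f_0\,d\theta=g(\Omega)$. Measure valued solution: $\mu\in L^\infty([0,T);\mathcal M([0,2\pi)\times\mathbb R))$ is a measure valued solution on $[0,T)$ with initial datum $\mu_0$ if (1) $t\mapsto\langle\mu_t,h\rangle$ is continuous for all $h\in \mathcal C_0([0,2\pi)\times\mathbb R)$; (2) for all $h\in \mathcal C_0^1([0,2\pi)\times\mathbb R\times[0,T))$ (test functions on the circle times $\mathbb R$, i.e. $2\pi$-periodic in $\theta$) and all $t\in[0,T)$, $$\langle\mu_t,h(\cdot,\cdot,t)\rangle-\langle\mu_0,h(\cdot,\cdot,0)\rangle=\int_0^t\langle\mu_s,\partial_s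 h+\omega[\mu]\partial_\theta h\rangle\,ds,$$ where $\omega[\mu](\theta,\Omega,s)=\Omega-K\int_0^{2\pi}\int_{\mathbb R}\sin(\theta-\theta_* )\,\mu_s(d\theta_*,d\Omega_* )$. Solutions on $[0,\infty)$ are understood as solutions on $[0,T)$ for every $T>0$; the measure valued solution with a given initial datum is unique. $D_\theta(\mu_t)$ and $D_\Omega(\mu_t)$ are the diameters of the $\theta$-projection (as a subset of $[0,2\pi)\subset\mathbb R$) and of the $\Omega$-projection of $\mathrm{spt}(\mu_t)$. Pseudo-inverse and modified Wasserstein metric: if $\mu_t$ has density $f(\theta,\Omega,t)$, put $F(\theta,\Omega,t)=\int_0^\theta f(\theta_*,\Omega,t)\,d\theta_*$ and $\phi(\eta,\Omega,t)=\inf\{\theta: F(\theta,\Omega,t)>\eta\}$ for $\eta\in[0,g(\Omega)]$. For a general measure $\mu_t$ with $\Omega$-marginal $g(\Omega)\,d\Omega$, disintegrate $\mu_t(d\theta,d\Omega)=\mu_t^\Omega(d\theta)\,d\Omega$ with $\mu_t^\Omega$ of total mass $g(\Omega)$, and use $F(\theta,\Omega,t)=\mu_t^\Omega([0,\theta])$ in the same definition of $\phi$. For two such measures $\mu_1,\mu_2$ (at time $t$) with pseudo-inverses $\phi_1,\phi_2$, and $1\le p\le\infty$, $$W_p(\mu_1,\mu_2)(\Omega,t):=\|\phi_1(\cdot,\Omega,t)-\phi_2(\cdot,\Omega,t)\|_{L^p(0,g(\Omega))},\qquad \widetilde W_p(\mu_1,\mu_2)(t):=\|W_p(\mu_1,\mu_2)(\cdot,t)\|_{L^p(\mathbb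 R)},$$ and $\widetilde W_p(\mu_t,\nu_t)$ denotes this quantity for the pair $\mu_t,\nu_t$. *)

theory Defs
  imports "HOL-Probability.Probability"
begin

text \<open>Phases are represented by \<open>\<theta> \<in> [0, 2\<pi>)\<close>, carrying the topology of the circle; natural
  frequencies are real numbers. Functions on the circle are \<open>2\<pi>\<close>-periodic functions on the reals.\<close>

definition circle_borel :: "real measure" where
  "circle_borel = restrict_space borel {0..<2 * pi}"

definition phase_borel :: "(real \<times> real) measure" where
  "phase_borel = restrict_space borel ({0..<2 * pi} \<times> UNIV)"

text \<open>The circle being compact, local finiteness on circle times line amounts to finiteness on
  the strips below; Borel measures with this property are automatically regular.\<close>

definition radon_measure :: "(real \<times> real) measure \<Rightarrow> bool" where
  "radon_measure \<nu> \<longleftrightarrow> sets \<nu> = sets phase_borel \<and>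
     (\<forall>a. emeasure \<nu> ({0..<2 * pi} \<times> {-a..a}) < \<infinity>)"

definition pairing :: "(real \<times> real) measure \<Rightarrow> (real \<Rightarrow> real \<Rightarrow> real) \<Rightarrow> real" where
  "pairing \<nu> h = (LINT x|\<nu>. h (fst x) (snd x))"

definition frequency_density :: "(real \<Rightarrow> real) \<Rightarrow> bool" where
  "frequency_density g \<longleftrightarrow>
     (\<forall>\<Omega>. 0 \<le> g \<Omega>) \<and> integrable lborel g \<and> bounded {\<Omega>. g \<Omega> \<noteq> 0} \<and>
     (\<forall>\<Omega>. g (- \<Omega>) = g \<Omega>) \<and> (LINT \<Omega>|lborel. \<Omega> * g \<Omega>) = 0 \<and> (LINT \<Omega>|lborel. g \<Omega>) = 1"

definition has_frequency_density :: "(real \<times> real) measure \<Rightarrow> (real \<Rightarrow> real) \<Rightarrow> bool" where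
  "has_frequency_density \<nu> g \<longleftrightarrow> distr \<nu> borel snd = density lborel (\<lambda>\<Omega>. ennreal (g \<Omega>))"

definition omega :: "real \<Rightarrow> (real \<times> real) measure \<Rightarrow> real \<Rightarrow> real \<Rightarrow> real" where
  "omega K \<nu> \<theta> \<Omega> = \<Omega> - K * pairing \<nu> (\<lambda>\<theta>' \<Omega>'. sin (\<theta> - \<theta>'))"

text \<open>The subscript in \<open>C\<^sub>0\<close> and \<open>C\<^sub>0\<^sup>1\<close> is read as compact support.\<close>

definition C0_test :: "(real \<Rightarrow> real \<Rightarrow> real) \<Rightarrow> bool" where
  "C0_test h \<longleftrightarrow> continuous_on UNIV (\<lambda>x. h (fst x) (snd x)) \<and>
     (\<forall>\<theta> \<Omega>. h (\<theta> + 2 * pi) \<Omega> = h \<theta> \<Omega>) \<and> (\<exists>a. \<forall>\<theta> \<Omega>. \<bar>\<Omega>\<bar> > a \<longrightarrow> h \<theta> \<Omega> = 0)"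

text \<open>\<open>C1_test T h h'\<close>: the function \<open>h\<close> of \<open>(\<theta>, \<Omega>, t)\<close> is in \<open>C\<^sub>0\<^sup>1\<close> on circle times line times
  \<open>[0, T)\<close>, with gradient \<open>h' = (\<partial>\<^sub>\<theta> h, \<partial>\<^sub>\<Omega> h, \<partial>\<^sub>t h)\<close>; the time derivative is one-sided at \<open>t = 0\<close>,
  where \<open>h\<close> need not vanish.\<close>

definition C1_test ::
  "real \<Rightarrow> (real \<times> real \<times> real \<Rightarrow> real) \<Rightarrow> (real \<times> real \<times> real \<Rightarrow> real \<times> real \<times> real) \<Rightarrow> bool" where
  "C1_test T h h' \<longleftrightarrow>
     (\<forall>x \<in> UNIV \<times> UNIV \<times> {0..<T}.
        (h has_derivative (\<lambda>v. h' x \<bullet> v)) (at x within UNIV \<times> UNIV \<times> {0..<T})) \<and>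
     continuous_on (UNIV \<times> UNIV \<times> {0..<T}) h' \<and>
     (\<forall>\<theta> \<Omega>. \<forall>t\<in>{0..<T}. h (\<theta> + 2 * pi, \<Omega>, t) = h (\<theta>, \<Omega>, t)) \<and>
     (\<exists>a. \<exists>T'<T. \<forall>\<theta> \<Omega>. \<forall>t\<in>{0..<T}. \<bar>\<Omega>\<bar> > a \<or> t > T' \<longrightarrow> h (\<theta>, \<Omega>, t) = 0)"

definition mv_solution_on ::
  "real \<Rightarrow> real \<Rightarrow> (real \<times> real) measure \<Rightarrow> (real \<Rightarrow> (real \<times> real) measure) \<Rightarrow> bool" where
  "mv_solution_on T K \<mu>0 \<mu> \<longleftrightarrow>
     (\<forall>t\<in>{0..<T}. radon_measure (\<mu> t)) \<and>
     (\<exists>C. AE t in lborel. t \<in> {0..<T} \<longrightarrow> emeasure (\<mu> t) (space (\<mu> t)) \<le> ennreal C) \<and>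
     (\<forall>h. C0_test h \<longrightarrow> continuous_on {0..<T} (\<lambda>t. pairing (\<mu> t) h)) \<and>
     (\<forall>h h'. C1_test T h h' \<longrightarrow> (\<forall>t\<in>{0..<T}.
        ((\<lambda>s. pairing (\<mu> s) (\<lambda>\<theta> \<Omega>. snd (snd (h' (\<theta>, \<Omega>, s)))
                                 + omega K (\<mu> s) \<theta> \<Omega> * fst (h' (\<theta>, \<Omega>, s))))
         has_integral
           pairing (\<mu> t) (\<lambda>\<theta> \<Omega>. h (\<theta>, \<Omega>, t)) - pairing \<mu>0 (\<lambda>\<theta> \<Omega>. h (\<theta>, \<Omega>, 0))) {0..t}))"

definition mv_solution ::
  "real \<Rightarrow> (real \<times> real) measure \<Rightarrow> (real \<Rightarrow> (real \<times> real) measure) \<Rightarrow> bool" where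
  "mv_solution K \<mu>0 \<mu> \<longleftrightarrow> (\<forall>T>0. mv_solution_on T K \<mu>0 \<mu>)"

text \<open>The open sets of circle times line are the preimages of open sets under
  \<open>(\<theta>, \<Omega>) \<mapsto> (cis \<theta>, \<Omega>)\<close>.\<close>

definition spt :: "(real \<times> real) measure \<Rightarrow> (real \<times> real) set" where
  "spt \<nu> = {(\<theta>, \<Omega>). \<theta> \<in> {0..<2 * pi} \<and>
     (\<forall>U. open U \<and> (cis \<theta>, \<Omega>) \<in> U \<longrightarrow>
        emeasure \<nu> {(\<theta>', \<Omega>') \<in> {0..<2 * pi} \<times> UNIV. (cis \<theta>', \<Omega>') \<in> U} > 0)}"

definition D_theta :: "(real \<times> real) measure \<Rightarrow> real" where
  "D_theta \<nu> = diameter (fst ` spt \<nu>)"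

definition D_Omega :: "(real \<times> real) measure \<Rightarrow> real" where
  "D_Omega \<nu> = diameter (snd ` spt \<nu>)"

definition disintegrates ::
  "(real \<Rightarrow> real) \<Rightarrow> (real \<times> real) measure \<Rightarrow> (real \<Rightarrow> real measure) \<Rightarrow> bool" where
  "disintegrates g \<nu> \<kappa> \<longleftrightarrow>
     (\<forall>\<Omega>. sets (\<kappa> \<Omega>) = sets circle_borel \<and> emeasure (\<kappa> \<Omega>) {0..<2 * pi} = ennreal (g \<Omega>)) \<and>
     (\<forall>A \<in> sets circle_borel. (\<lambda>\<Omega>. emeasure (\<kappa> \<Omega>) A) \<in> borel_measurable borel) \<and>
     (\<forall>S \<in> sets phase_borel.
        emeasure \<nu> S = (\<integral>\<^sup>+\<Omega>. emeasure (\<kappa> \<Omega>) {\<theta> \<in> {0..<2 * pi}. (\<theta>, \<Omega>) \<in> S} \<partial>lborel))"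

text \<open>Disintegrations exist and are unique up to a Lebesgue null set of frequencies, which is not
  seen by the metric \<open>W_tilde\<close> below.\<close>

definition disintegration ::
  "(real \<Rightarrow> real) \<Rightarrow> (real \<times> real) measure \<Rightarrow> real \<Rightarrow> real measure" where
  "disintegration g \<nu> = (SOME \<kappa>. disintegrates g \<nu> \<kappa>)"

definition pseudo_inverse ::
  "(real \<Rightarrow> real) \<Rightarrow> (real \<times> real) measure \<Rightarrow> real \<Rightarrow> real \<Rightarrow> real" where
  "pseudo_inverse g \<nu> \<eta> \<Omega> =
     Inf {\<theta> \<in> {0..<2 * pi}. measure (disintegration g \<nu> \<Omega>) {0..\<theta>} > \<eta>}"

definition ennpowr :: "ennreal \<Rightarrow> real \<Rightarrow> ennreal" where
  "ennpowr x a = (if x = top then top else ennreal (enn2real x powr a))"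

definition Lp_norm :: "ennreal \<Rightarrow> 'a measure \<Rightarrow> ('a \<Rightarrow> ennreal) \<Rightarrow> ennreal" where
  "Lp_norm p M f =
     (if p = top then esssup M f
      else ennpowr (\<integral>\<^sup>+x. ennpowr (f x) (enn2real p) \<partial>M) (1 / enn2real p))"

definition W_dist ::
  "ennreal \<Rightarrow> (real \<Rightarrow> real) \<Rightarrow> (real \<times> real) measure \<Rightarrow> (real \<times> real) measure \<Rightarrow> real \<Rightarrow> ennreal" where
  "W_dist p g \<nu>1 \<nu>2 \<Omega> = Lp_norm p (restrict_space lborel {0<..<g \<Omega>})
     (\<lambda>\<eta>. ennreal \<bar>pseudo_inverse g \<nu>1 \<eta> \<Omega> - pseudo_inverse g \<nu>2 \<eta> \<Omega>\<bar>)"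

definition W_tilde ::
  "ennreal \<Rightarrow> (real \<Rightarrow> real) \<Rightarrow> (real \<times> real) measure \<Rightarrow> (real \<times> real) measure \<Rightarrow> ennreal" where
  "W_tilde p g \<nu>1 \<nu>2 = Lp_norm p lborel (W_dist p g \<nu>1 \<nu>2)"

end

theory Submission imports Defs begin

text \<open>A solution is pushed forward by its own characteristics, so its pseudo-inverses are moved by them as well, and
  the modified Wasserstein distance of two solutions is an \<open>L\<^sup>p\<close> norm of the difference of two families of phases
  that satisfy Kuramoto equations with the same frequencies. Once all phases of each family lie within distance
  \<open>D\<^sup>\<infinity> < \<pi>/2\<close> of each other, the difference of the two families is contracted.

  Conservation of frequencies. A solution is only a family of Radon measures that satisfies a weak equation. Testing
  with functions of \<open>\<Omega>\<close> alone shows that the frequency marginal is \<open>g\<close> for all times (\<open>marginal_eq\<close>); hence the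
  measures are probability measures, the frequencies stay in an interval \<open>[a, b]\<close> of length at most
  \<open>D\<^sub>\<Omega>(\<mu>\<^sub>0)\<close>, and test functions need not have compact support (\<open>weak_form\<close>). The drift is then a continuous
  function of time and a bounded Lipschitz function of the phase, so it has characteristics.

  Confinement. Let the end points of an arc that carries the initial phases follow the characteristics of the
  frequencies \<open>a\<close> and \<open>b\<close>. The product of the sines of half the angular distances to the end points is negative
  exactly inside the arc, and its squared positive part is a Lyapunov function, so the arc keeps carrying the
  measure (\<open>confinement_circle\<close>). Its length \<open>l\<close> satisfies \<open>l' \<le> b - a - K sin l\<close>. Starting from a length \<open>D\<close> with
  \<open>\<pi>/2 < D < \<pi>\<close> and \<open>b - a < K sin D\<close>, which the assumption on \<open>K\<close> permits, it falls below any number above \<open>\<pi> - D\<close>, in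
  particular below some \<open>D\<^sup>\<infinity> < \<pi>/2\<close> (\<open>width_decay\<close>). The phases are numbers in \<open>[0, 2\<pi>)\<close>, so the cut at \<open>0\<close> has
  to be avoided: while the arc avoids it the mean phase is conserved, therefore the arc contains \<open>\<pi>\<close>, and being
  shorter than \<open>\<pi>\<close> it stays at a positive distance from the cut. A first-exit argument completes the argument
  (\<open>arc_inside\<close>).

  Pseudo-inverses. Among particles with frequencies in \<open>(p, q)\<close>, the mass to the right of a characteristic of
  frequency \<open>p\<close> and the mass to the left of one of frequency \<open>q\<close> cannot decrease (\<open>transport\<close>). Letting the
  interval shrink gives, for almost every \<open>\<Omega>\<close>, inequalities between the conditional distribution functions, which
  say that the characteristics map the initial pseudo-inverse to the one at time \<open>t\<close> (\<open>quantile_transport\<close>). The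
  conditional measures that enter here are constructed from Radon-Nikodym densities (\<open>exists_disintegration\<close>).

  Contraction. On the region under the graph of \<open>g\<close>, with Lebesgue measure, the pseudo-inverses become random
  variables and their difference \<open>u\<close> has mean zero, both mean phases being \<open>\<pi>\<close>. The frequencies cancel in the
  equation of \<open>u\<close>, and Jordan's inequality bounds the difference of the sines below by \<open>2 cos D\<^sup>\<infinity> / \<pi>\<close> times the
  difference of the arguments. Symmetrization shows that the integral of \<open>\<Psi> (exp (2 K cos D\<^sup>\<infinity> (t - t\<^sub>0) / \<pi>) u)\<close> does
  not increase for convex \<open>\<Psi>\<close> (\<open>convex_integral_decreasing\<close>); the choices \<open>|x| ^ p\<close> and the squared excess over a
  level give the estimate for finite and infinite \<open>p\<close>.\<close>

section \<open>Continuously differentiable cut-off functions\<close>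

text \<open>The squared positive part is a particularly simple continuously differentiable function whose zero set is a half line.
  The weak form of the equation admits test functions that are only once differentiable, so all cut-offs and all
  approximations of indicator functions below are built from it by composition and rational operations.\<close>

definition pos2 :: "real \<Rightarrow> real" where
  "pos2 x = (max 0 x)\<^sup>2"

lemma pos2_nonneg [simp]: "0 \<le> pos2 x"
  by (simp add: pos2_def)

lemma pos2_eq_0 [simp]: "pos2 x = 0 \<longleftrightarrow> x \<le> 0"
  by (auto simp: pos2_def)

lemma pos2_pos: "0 < x \<Longrightarrow> pos2 x = x\<^sup>2"
  by (simp add: pos2_def)

lemma DERIV_pos2: "(pos2 has_real_derivative 2 * max 0 x) (at x)"
proof (cases "x = 0")
  case False
  show ?thesis
  proof (cases "x > 0")
    case True
    have "((\<lambda>x. x\<^sup>2) has_real_derivative 2 * max 0 x) (at x)"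
      using True by (auto intro!: derivative_eq_intros)
    then show ?thesis
      by (rule has_field_derivative_transform_within_open[where S="{0<..}"]) (use True in \<open>auto simp: pos2_def\<close>)
  next
    case F: False
    have "((\<lambda>x. 0) has_real_derivative 2 * max 0 x) (at x)"
      using F by (auto intro!: derivative_eq_intros)
    then show ?thesis
      by (rule has_field_derivative_transform_within_open[where S="{..<0}"])
        (use F \<open>x \<noteq> 0\<close> in \<open>auto simp: pos2_def\<close>)
  qed
next
  case True
  have "((\<lambda>h. (pos2 (0 + h) - pos2 0) / h) \<longlongrightarrow> 0) (at 0)"
  proof (rule tendsto_0_le[where K=1])
    show "((\<lambda>h::real. h) \<longlongrightarrow> 0) (at 0)" by (rule tendsto_ident_at)
    show "\<forall>\<^sub>F h in at 0. norm ((pos2 (0 + h) - pos2 0) / h) \<le> norm h * 1"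
      by (intro always_eventually allI) (auto simp: pos2_def max_def power2_eq_square)
  qed
  then show ?thesis using True by (simp add: DERIV_def)
qed

lemma DERIV_pos2_chain [derivative_intros]:
  assumes "(f has_real_derivative f') (at x within S)"
  shows "((\<lambda>x. pos2 (f x)) has_real_derivative (2 * max 0 (f x)) * f') (at x within S)"
  using DERIV_chain2[OF DERIV_pos2 assms] .

lemma continuous_on_pos2 [continuous_intros]:
  "continuous_on S f \<Longrightarrow> continuous_on S (\<lambda>x. pos2 (f x))"
  unfolding pos2_def by (intro continuous_intros)

lemma has_derivative_pos2 [derivative_intros]:
  assumes "(f has_derivative f') (at x within S)"
  shows "((\<lambda>x. pos2 (f x)) has_derivative (\<lambda>v. 2 * max 0 (f x) * f' v)) (at x within S)"
  using has_derivative_compose[OF assms DERIV_pos2[unfolded has_field_derivative_def]] .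

lemma measurable_pos2 [measurable]: "pos2 \<in> borel_measurable borel"
  unfolding pos2_def[abs_def] by measurable

definition cutoff :: "real \<Rightarrow> real \<Rightarrow> real" where
  "cutoff R x = pos2 (1 - pos2 (x - R) - pos2 (- x - R))"

definition cutoff' :: "real \<Rightarrow> real \<Rightarrow> real" where
  "cutoff' R x = 2 * max 0 (1 - pos2 (x - R) - pos2 (- x - R)) * (2 * max 0 (- x - R) - 2 * max 0 (x - R))"

lemma DERIV_cutoff: "(cutoff R has_real_derivative cutoff' R x) (at x)"
  unfolding cutoff_def[abs_def] cutoff'_def
  by (auto intro!: derivative_eq_intros)

lemma continuous_cutoff': "continuous_on S (cutoff' R)"
  unfolding cutoff'_def[abs_def] by (intro continuous_intros)

lemma cutoff_eq_1: "\<bar>x\<bar> \<le> R \<Longrightarrow> cutoff R x = 1"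
proof -
  assume a: "\<bar>x\<bar> \<le> R"
  then have "pos2 (x - R) = 0" "pos2 (- x - R) = 0" by auto
  then show ?thesis unfolding cutoff_def by (simp del: pos2_eq_0) (simp add: pos2_def)
qed

lemma cutoff'_eq_0: "\<bar>x\<bar> \<le> R \<Longrightarrow> cutoff' R x = 0"
  unfolding cutoff'_def by auto

lemma cutoff_eq_0: assumes "\<bar>x\<bar> > R + 1" "R \<ge> 0" shows "cutoff R x = 0"
proof -
  have "1 \<le> pos2 (\<bar>x\<bar> - R)" using assms power_mono[of 1 "\<bar>x\<bar> - R" 2] by (simp add: pos2_pos)
  moreover have "pos2 (\<bar>x\<bar> - R) \<le> pos2 (x - R) + pos2 (- x - R)"
    by (cases "x \<ge> 0") auto
  ultimately show ?thesis unfolding cutoff_def by simp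
qed

text \<open>As \<open>c \<rightarrow> \<infinity>\<close> these functions tend to the indicator of the open half line \<open>(0, \<infinity>)\<close>: statements about masses
  are obtained by testing with \<open>bump n\<close> and passing to the limit.\<close>

definition bump :: "real \<Rightarrow> real \<Rightarrow> real" where
  "bump c x = c * pos2 x / (1 + c * pos2 x)"

definition bump' :: "real \<Rightarrow> real \<Rightarrow> real" where
  "bump' c x = c * (2 * max 0 x) / (1 + c * pos2 x)\<^sup>2"

lemma bump_denom: "c \<ge> 0 \<Longrightarrow> 1 + c * pos2 x > 0"
  by (rule add_pos_nonneg) auto

lemma DERIV_bump:
  assumes "c \<ge> 0" shows "(bump c has_real_derivative bump' c x) (at x)"
proof -
  have "1 + c * pos2 x \<noteq> 0" using bump_denom[OF assms, of x] by simp
  then show ?thesis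
    unfolding bump_def bump'_def
    by (auto intro!: derivative_eq_intros DERIV_pos2 simp: field_simps power2_eq_square)
qed

lemma continuous_bump': "c \<ge> 0 \<Longrightarrow> continuous_on S (bump' c)"
  unfolding bump'_def[abs_def]
  by (intro continuous_intros) (use bump_denom[of c] in \<open>auto simp: less_imp_neq[symmetric]\<close>)

lemma bump_bounds: assumes "c \<ge> 0" shows "0 \<le> bump c x" "bump c x \<le> 1"
  using assms bump_denom[OF assms, of x] by (auto simp: bump_def divide_le_eq)

lemma bump_eq_0: "x \<le> 0 \<Longrightarrow> bump c x = 0"
  by (simp add: bump_def)

lemma bump'_nonneg: "c \<ge> 0 \<Longrightarrow> 0 \<le> bump' c x"
  by (simp add: bump'_def)

lemma bump'_eq_0: "x \<le> 0 \<Longrightarrow> bump' c x = 0"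
  by (simp add: bump'_def)

lemma bump_tendsto: "(\<lambda>n. bump (real n) x) \<longlonglongrightarrow> indicator {0<..} x"
proof (cases "x > 0")
  case True
  define p where "p = x\<^sup>2"
  have p: "p > 0" using True by (simp add: p_def)
  have "(\<lambda>n. real n * p / (1 + real n * p)) \<longlonglongrightarrow> 1"
  proof -
    have *: "real n * p / (1 + real n * p) = 1 - inverse (1 + real n * p)" for n
    proof -
      have "1 + real n * p > 0" using p by (simp add: add_pos_nonneg)
      then show ?thesis by (simp add: field_simps)
    qed
    have "filterlim (\<lambda>n. 1 + real n * p) at_top sequentially"
      by (intro filterlim_tendsto_add_at_top[OF tendsto_const]
          filterlim_at_top_mult_tendsto_pos[OF tendsto_const p] filterlim_real_sequentially)
    then have "(\<lambda>n. inverse (1 + real n * p)) \<longlonglongrightarrow> 0"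
      by (rule filterlim_compose[OF tendsto_inverse_0_at_top[OF filterlim_ident]])
    then have "(\<lambda>n. 1 - inverse (1 + real n * p)) \<longlonglongrightarrow> 1 - 0" by (intro tendsto_intros)
    then show ?thesis by (simp add: *)
  qed
  then show ?thesis using True by (simp add: bump_def pos2_pos p_def)
next
  case False
  then show ?thesis by (simp add: bump_eq_0)
qed

lemma measurable_bump [measurable]: "bump c \<in> borel_measurable borel"
  unfolding bump_def[abs_def] by measurable

lemma abs_bump_le: "c \<ge> 0 \<Longrightarrow> \<bar>bump c x\<bar> \<le> 1"
  using bump_bounds[of c x] by simp

section \<open>The characteristic curves\<close>

text \<open>An integral over an interval with reversed end points counts as zero, hence the second term. A primitive on
  both sides of \<open>0\<close> is differentiable at \<open>0\<close> without one-sided limits.\<close>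

definition primitive0 :: "(real \<Rightarrow> real) \<Rightarrow> real \<Rightarrow> real" where
  "primitive0 f s = integral {0..s} f - integral {s..0} f"

lemma primitive0_nonneg: "s \<ge> 0 \<Longrightarrow> primitive0 f s = integral {0..s} f"
  by (cases "s = 0") (auto simp: primitive0_def)

lemma DERIV_primitive0:
  assumes "continuous_on UNIV f"
  shows "(primitive0 f has_real_derivative f s) (at s)"
proof -
  define n where "n = \<bar>s\<bar> + 1"
  have c: "continuous_on X f" for X using assms continuous_on_subset by blast
  have i: "f integrable_on {u..v}" for u v by (rule integrable_continuous_real[OF c])
  have eq: "primitive0 f r = integral {-n..r} f - integral {-n..0} f" if "r \<in> {-n<..<n}" for r
  proof (cases "r \<ge> 0")
    case True
    then show ?thesis
      using integral_combine[where f=f and a="-n" and b=r and c=0] i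
      using Henstock_Kurzweil_Integration.integral_combine[where f=f and a="-n" and c=0 and b=r] that
      by (simp add: primitive0_nonneg)
  next
    case False
    then have "integral {-n..r} f + integral {r..0} f = integral {-n..0} f"
      using that by (intro Henstock_Kurzweil_Integration.integral_combine i) auto
    then show ?thesis using False by (simp add: primitive0_def)
  qed
  have "((\<lambda>r. integral {-n..r} f) has_real_derivative f s) (at s within {-n..n})"
    by (rule integral_has_real_derivative[OF c]) (auto simp: n_def)
  moreover have "at s within {-n..n} = at s"
    by (rule at_within_interior) (auto simp: n_def)
  ultimately have "((\<lambda>r. integral {-n..r} f - integral {-n..0} f) has_real_derivative f s) (at s)"
    by (auto intro!: derivative_eq_intros)
  then show ?thesis
    by (rule has_field_derivative_transform_within_open[where S="{-n<..<n}"])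
      (use eq in \<open>auto simp: n_def\<close>)
qed

text \<open>A differential form of Gronwall's lemma that asks nothing where \<open>w\<close> is negative: the function
  \<open>pos2 w\<close>, weighted by an exponential, cannot increase.\<close>

lemma gronwall_nonpos:
  fixes w :: "real \<Rightarrow> real"
  assumes d: "\<And>s. 0 \<le> s \<Longrightarrow> s \<le> t \<Longrightarrow> (w has_real_derivative w' s) (at s)"
    and le: "\<And>s. 0 \<le> s \<Longrightarrow> s \<le> t \<Longrightarrow> w s > 0 \<Longrightarrow> w' s \<le> L * w s"
    and "w 0 \<le> 0" "t \<ge> 0"
  shows "w t \<le> 0"
proof -
  define F where "F s = pos2 (w s) * exp (- 2 * L * s)" for s
  have "F t \<le> F 0"
  proof (rule DERIV_nonpos_imp_nonincreasing[OF \<open>t \<ge> 0\<close>])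
    fix s assume s: "0 \<le> s" "s \<le> t"
    have "(F has_real_derivative 2 * max 0 (w s) * (w' s - L * max 0 (w s)) * exp (- 2 * L * s)) (at s)"
      unfolding F_def
      by (rule derivative_eq_intros d s refl)+ (simp add: pos2_def power2_eq_square algebra_simps)
    moreover have "2 * max 0 (w s) * (w' s - L * max 0 (w s)) * exp (- 2 * L * s) \<le> 0"
      using le[OF s] by (cases "w s > 0") (auto simp: mult_nonneg_nonpos mult_nonpos_nonneg)
    ultimately show "\<exists>y. (F has_real_derivative y) (at s) \<and> y \<le> 0" by blast
  qed
  also have "F 0 = 0" using \<open>w 0 \<le> 0\<close> by (simp add: F_def)
  finally have "pos2 (w t) \<le> 0" by (simp add: F_def mult_le_0_iff)
  then show ?thesis by (simp add: order.antisym flip: pos2_eq_0)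
qed

text \<open>By the addition theorem the interaction term of a solution is a combination of sine and cosine whose
  coefficients \<open>A\<close> and \<open>B\<close> are \<open>K\<close> times the first Fourier moments of the solution. Along a given solution they
  are known functions of time, so the characteristics solve an ordinary differential equation with a bounded and
  Lipschitz right-hand side.\<close>

locale kuramoto_field =
  fixes A B :: "real \<Rightarrow> real" and K :: real
  assumes K_pos: "K > 0"
    and cont_A: "continuous_on UNIV A" and cont_B: "continuous_on UNIV B"
    and A_le: "\<And>s. \<bar>A s\<bar> \<le> K" and B_le: "\<And>s. \<bar>B s\<bar> \<le> K"
begin

definition drift :: "real \<Rightarrow> real \<Rightarrow> real" where
  "drift x s = - A s * sin x + B s * cos x"

lemma drift_lipschitz: "\<bar>drift x s - drift y s\<bar> \<le> 2 * K * \<bar>x - y\<bar>"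
proof -
  have s: "\<bar>sin x - sin y\<bar> \<le> \<bar>x - y\<bar>"
  proof -
    have "\<bar>sin x - sin y\<bar> = 2 * (\<bar>sin ((x - y)/2)\<bar> * \<bar>cos ((x + y)/2)\<bar>)"
      by (simp add: sin_diff_sin abs_mult)
    also have "\<dots> \<le> 2 * (\<bar>(x - y)/2\<bar> * 1)"
      by (intro mult_left_mono mult_mono abs_sin_x_le_abs_x) auto
    finally show ?thesis by simp
  qed
  have c: "\<bar>cos x - cos y\<bar> \<le> \<bar>x - y\<bar>"
  proof -
    have "\<bar>cos x - cos y\<bar> = 2 * (\<bar>sin ((x + y)/2)\<bar> * \<bar>sin ((y - x)/2)\<bar>)"
      by (simp add: cos_diff_cos abs_mult)
    also have "\<dots> \<le> 2 * (1 * \<bar>(y - x)/2\<bar>)"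
      by (intro mult_left_mono mult_mono abs_sin_x_le_abs_x) auto
    finally show ?thesis by simp
  qed
  have "\<bar>drift x s - drift y s\<bar> = \<bar>- A s * (sin x - sin y) + B s * (cos x - cos y)\<bar>"
    by (simp add: drift_def algebra_simps)
  also have "\<dots> \<le> \<bar>A s\<bar> * \<bar>sin x - sin y\<bar> + \<bar>B s\<bar> * \<bar>cos x - cos y\<bar>"
    by (rule order_trans[OF abs_triangle_ineq]) (simp add: abs_mult)
  also have "\<dots> \<le> K * \<bar>x - y\<bar> + K * \<bar>x - y\<bar>"
    using A_le[of s] B_le[of s] s c K_pos by (intro add_mono mult_mono) auto
  finally show ?thesis by simp
qed

lemma drift_bound: "\<bar>drift x s\<bar> \<le> 2 * K"
proof -
  have "\<bar>drift x s\<bar> \<le> \<bar>A s\<bar> * \<bar>sin x\<bar> + \<bar>B s\<bar> * \<bar>cos x\<bar>"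
    unfolding drift_def by (rule order_trans[OF abs_triangle_ineq]) (simp add: abs_mult)
  also have "\<dots> \<le> K * 1 + K * 1"
    using A_le[of s] B_le[of s] K_pos by (intro add_mono mult_mono) auto
  finally show ?thesis by simp
qed

lemma continuous_on_drift [continuous_intros]:
  fixes f g :: "'a::t2_space \<Rightarrow> real"
  assumes "continuous_on S f" "continuous_on S g"
  shows "continuous_on S (\<lambda>x. drift (f x) (g x))"
  unfolding drift_def
  by (intro continuous_on_add continuous_on_mult continuous_on_minus continuous_on_sin continuous_on_cos assms
      continuous_on_compose2[OF cont_A assms(2)] continuous_on_compose2[OF cont_B assms(2)]) auto

text \<open>Existence of the characteristics on the whole half line in one application of the Banach
  fixed point theorem: in the unknown \<open>u s = (x s - \<theta>) exp (- \<lambda> s)\<close> the integral operator is a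
  contraction of the bounded continuous functions as soon as \<open>\<lambda>\<close> exceeds the Lipschitz constant.\<close>

lemma characteristic_exists:
  "\<exists>x. continuous_on UNIV x \<and> (\<forall>s\<ge>0. x s = \<theta> + integral {0..s} (\<lambda>r. w + drift (x r) r))"
proof -
  define l where "l = 4 * K"
  have l: "l > 0" using K_pos by (simp add: l_def)
  define X where "X u s = \<theta> + exp (l * max 0 s) * apply_bcontfun u (max 0 s)" for u :: "real \<Rightarrow>\<^sub>C real" and s
  define V where "V u r = w + drift (X u r) r" for u r
  define G where "G u s = exp (- l * max 0 s) * integral {0..max 0 s} (V u)" for u s
  have cX: "continuous_on S (X u)" for S u
    unfolding X_def
    by (intro continuous_intros continuous_on_compose2[OF continuous_on_apply_bcontfun[of UNIV]]) auto
  have cV: "continuous_on S (V u)" for S u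
    unfolding V_def by (intro continuous_intros cX)
  have iV: "V u integrable_on {p..q}" for u p q
    by (rule integrable_continuous_real[OF cV])
  have Vb: "\<bar>V u r\<bar> \<le> \<bar>w\<bar> + 2 * K" for u r
    unfolding V_def using drift_bound[of "X u r" r] by linarith
  have cG: "continuous_on UNIV (G u)" for u
  proof -
    have "continuous_on UNIV (primitive0 (V u))"
      by (meson DERIV_isCont DERIV_primitive0 cV continuous_at_imp_continuous_on)
    then have "continuous_on UNIV (\<lambda>s. primitive0 (V u) (max 0 s))"
      by (rule continuous_on_compose2) (auto intro!: continuous_intros)
    then show ?thesis
      unfolding G_def by (intro continuous_intros) (simp add: primitive0_nonneg max_def)
  qed
  have Gb: "norm (G u s) \<le> (\<bar>w\<bar> + 2 * K) / l" for u s
  proof -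
    define m where "m = max 0 s"
    have m: "m \<ge> 0" by (simp add: m_def)
    have "norm (integral {0..m} (V u)) \<le> (\<bar>w\<bar> + 2 * K) * (m - 0)"
      by (rule integral_bound[OF m cV]) (use Vb in auto)
    moreover have "l * m \<le> exp (l * m)" using exp_ge_add_one_self[of "l*m"] by linarith
    then have "m * exp (- l * m) \<le> 1 / l"
      using l by (simp add: exp_minus field_simps)
    ultimately have "norm (G u s) \<le> exp (- l * m) * ((\<bar>w\<bar> + 2 * K) * m)"
      unfolding G_def m_def[symmetric] by (simp add: abs_mult)
    also have "\<dots> = (\<bar>w\<bar> + 2 * K) * (m * exp (- l * m))" by simp
    also have "\<dots> \<le> (\<bar>w\<bar> + 2 * K) * (1 / l)"
      using \<open>m * exp (- l * m) \<le> 1 / l\<close> K_pos by (intro mult_left_mono) auto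
    finally show ?thesis by simp
  qed
  define T where "T u = Bcontfun (G u)" for u
  have T: "apply_bcontfun (T u) = G u" for u
    unfolding T_def by (rule Bcontfun_inverse) (rule bcontfun_normI[OF cG Gb])
  have contr: "dist (T u) (T v) \<le> (1/2) * dist u v" for u v
  proof (rule dist_bound)
    fix s :: real
    define m where "m = max 0 s"
    define D where "D = dist u v"
    have m: "m \<ge> 0" by (simp add: m_def)
    have D: "D \<ge> 0" by (simp add: D_def)
    have ie: "((\<lambda>r. 2 * K * D * exp (l * r)) has_integral (2 * K * D * exp (l * m) / l - 2 * K * D * exp (l * 0) / l)) {0..m}"
      using l by (intro fundamental_theorem_of_calculus[OF m])
        (auto intro!: derivative_eq_intros simp flip: has_real_derivative_iff_has_vector_derivative)
    have "norm (integral {0..m} (\<lambda>r. V u r - V v r)) \<le> integral {0..m} (\<lambda>r. 2 * K * D * exp (l * r))"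
    proof (rule integral_norm_bound_integral)
      show "(\<lambda>r. V u r - V v r) integrable_on {0..m}" by (intro integrable_diff iV)
      show "(\<lambda>r. 2 * K * D * exp (l * r)) integrable_on {0..m}" using ie by blast
      fix r assume r: "r \<in> {0..m}"
      have "norm (V u r - V v r) \<le> 2 * K * \<bar>X u r - X v r\<bar>"
        unfolding V_def using drift_lipschitz[of "X u r" r "X v r"] by simp
      also have "\<bar>X u r - X v r\<bar> = exp (l * r) * dist (apply_bcontfun u r) (apply_bcontfun v r)"
        using r by (simp add: X_def max_absorb2 dist_real_def abs_mult flip: right_diff_distrib)
      also have "\<dots> \<le> exp (l * r) * D"
        unfolding D_def by (intro mult_left_mono dist_bounded) auto
      finally show "norm (V u r - V v r) \<le> 2 * K * D * exp (l * r)"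
        using K_pos by (simp add: algebra_simps)
    qed
    also have "\<dots> = 2 * K * D * exp (l * m) / l - 2 * K * D / l"
      using integral_unique[OF ie] by simp
    also have "\<dots> \<le> 2 * K * D * exp (l * m) / l" using K_pos D l by simp
    also have "\<dots> = D / 2 * exp (l * m)" using K_pos by (simp add: l_def field_simps)
    finally have b: "norm (integral {0..m} (\<lambda>r. V u r - V v r)) \<le> D / 2 * exp (l * m)" .
    have "dist (G u s) (G v s) = exp (- l * m) * norm (integral {0..m} (\<lambda>r. V u r - V v r))"
      unfolding G_def m_def[symmetric]
      by (simp add: dist_real_def integral_diff iV abs_mult flip: right_diff_distrib)
    also have "\<dots> \<le> exp (- l * m) * (D / 2 * exp (l * m))"
      by (intro mult_left_mono b) auto
    also have "\<dots> = D / 2" by (simp add: exp_minus)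
    finally show "dist (apply_bcontfun (T u) s) (apply_bcontfun (T v) s) \<le> 1 / 2 * dist u v"
      by (simp add: T D_def)
  qed
  obtain u where u: "T u = u"
    using banach_fix_type[of "1/2" T] contr by auto
  have "X u s = \<theta> + integral {0..s} (\<lambda>r. w + drift (X u r) r)" if "s \<ge> 0" for s
  proof -
    have "X u s = \<theta> + exp (l * s) * G u s"
      using that T[of u] u by (simp add: X_def max_absorb2)
    then have "X u s = \<theta> + (exp (l * s) * exp (- l * s)) * integral {0..s} (V u)"
      using that by (simp add: G_def max_absorb2)
    then show ?thesis by (simp add: V_def[abs_def] flip: exp_add)
  qed
  then show ?thesis using cX by blast
qed

definition curve0 :: "real \<Rightarrow> real \<Rightarrow> real \<Rightarrow> real" where
  "curve0 \<theta> w = (SOME x. continuous_on UNIV x \<and> (\<forall>s\<ge>0. x s = \<theta> + integral {0..s} (\<lambda>r. w + drift (x r) r)))"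

text \<open>Negative times carry no dynamics; extending the characteristics to them in a continuously
  differentiable way lets all test functions be differentiated on the whole space.\<close>

definition curve' :: "real \<Rightarrow> real \<Rightarrow> real \<Rightarrow> real" where
  "curve' \<theta> w s = w + drift (curve0 \<theta> w s) s"

definition curve :: "real \<Rightarrow> real \<Rightarrow> real \<Rightarrow> real" where
  "curve \<theta> w s = \<theta> + primitive0 (curve' \<theta> w) s"

lemma curve0: "continuous_on UNIV (curve0 \<theta> w)"
  "s \<ge> 0 \<Longrightarrow> curve0 \<theta> w s = \<theta> + integral {0..s} (\<lambda>r. w + drift (curve0 \<theta> w r) r)"
  using someI_ex[OF characteristic_exists[of \<theta> w]] unfolding curve0_def[symmetric] by auto

lemma continuous_curve': "continuous_on S (curve' \<theta> w)"
  unfolding curve'_def by (intro continuous_intros continuous_on_subset[OF curve0(1)]) auto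

lemma DERIV_curve: "(curve \<theta> w has_real_derivative curve' \<theta> w s) (at s)"
  unfolding curve_def
  by (auto intro!: derivative_eq_intros DERIV_primitive0 continuous_curve')

lemma continuous_curve: "continuous_on S (curve \<theta> w)"
  by (meson DERIV_isCont DERIV_curve continuous_at_imp_continuous_on)

lemma curve_0 [simp]: "curve \<theta> w 0 = \<theta>"
  by (simp add: curve_def primitive0_def)

lemma curve'_eq: "s \<ge> 0 \<Longrightarrow> curve' \<theta> w s = w + drift (curve \<theta> w s) s"
  using curve0(2)[of s \<theta> w] by (simp add: curve'_def[abs_def] curve_def primitive0_nonneg)

lemma curve_mono:
  assumes "\<theta>1 \<le> \<theta>2" "w1 \<le> w2" "t \<ge> 0"
  shows "curve \<theta>1 w1 t \<le> curve \<theta>2 w2 t"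
proof -
  have "curve \<theta>1 w1 t - curve \<theta>2 w2 t \<le> 0"
  proof (rule gronwall_nonpos[where L="2*K" and t=t])
    fix s :: real assume s: "0 \<le> s"
    show "((\<lambda>s. curve \<theta>1 w1 s - curve \<theta>2 w2 s) has_real_derivative curve' \<theta>1 w1 s - curve' \<theta>2 w2 s) (at s)"
      by (intro derivative_intros DERIV_curve)
    assume "curve \<theta>1 w1 s - curve \<theta>2 w2 s > 0"
    then show "curve' \<theta>1 w1 s - curve' \<theta>2 w2 s \<le> 2 * K * (curve \<theta>1 w1 s - curve \<theta>2 w2 s)"
      using drift_lipschitz[of "curve \<theta>1 w1 s" s "curve \<theta>2 w2 s"] assms s by (simp add: curve'_eq)
  qed (use assms in auto)
  then show ?thesis by simp
qed

text \<open>The gap between two characteristics shrinks at most at the rate \<open>2 K\<close>, so it never closes.\<close>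

lemma curve_strict_mono:
  assumes "\<theta>1 < \<theta>2" "w1 \<le> w2" "t \<ge> 0"
  shows "curve \<theta>1 w1 t < curve \<theta>2 w2 t"
proof -
  define z where "z s = curve \<theta>2 w2 s - curve \<theta>1 w1 s" for s
  have dz: "(z has_real_derivative curve' \<theta>2 w2 s - curve' \<theta>1 w1 s) (at s)" for s
    unfolding z_def by (intro derivative_intros DERIV_curve)
  have "(\<theta>2 - \<theta>1) * exp (- 2 * K * t) - z t \<le> 0"
  proof (rule gronwall_nonpos[where L="2*K" and t=t])
    fix s :: real assume s: "0 \<le> s"
    show "((\<lambda>s. (\<theta>2 - \<theta>1) * exp (- 2 * K * s) - z s) has_real_derivative
       (- 2 * K * (\<theta>2 - \<theta>1) * exp (- 2 * K * s) - (curve' \<theta>2 w2 s - curve' \<theta>1 w1 s))) (at s)"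
      by (rule derivative_eq_intros dz refl)+ simp
    have z: "z s \<ge> 0" using curve_mono[of \<theta>1 \<theta>2 w1 w2 s] assms s by (simp add: z_def)
    assume *: "(\<theta>2 - \<theta>1) * exp (- 2 * K * s) - z s > 0"
    have "curve' \<theta>2 w2 s - curve' \<theta>1 w1 s \<ge> - 2 * K * z s"
      using drift_lipschitz[of "curve \<theta>2 w2 s" s "curve \<theta>1 w1 s"] assms s z by (simp add: curve'_eq z_def)
    then have "- 2 * K * (\<theta>2 - \<theta>1) * exp (- 2 * K * s) - (curve' \<theta>2 w2 s - curve' \<theta>1 w1 s)
      \<le> - 2 * K * ((\<theta>2 - \<theta>1) * exp (- 2 * K * s) - z s)" by (simp add: algebra_simps)
    also have "\<dots> \<le> 2 * K * ((\<theta>2 - \<theta>1) * exp (- 2 * K * s) - z s)"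
      using * K_pos by (intro mult_right_mono) auto
    finally show "- 2 * K * (\<theta>2 - \<theta>1) * exp (- 2 * K * s) - (curve' \<theta>2 w2 s - curve' \<theta>1 w1 s)
      \<le> 2 * K * ((\<theta>2 - \<theta>1) * exp (- 2 * K * s) - z s)" .
  qed (use assms in \<open>auto simp: z_def\<close>)
  moreover have "(\<theta>2 - \<theta>1) * exp (- 2 * K * t) > 0" using assms by simp
  ultimately show ?thesis by (simp add: z_def)
qed

text \<open>In the exponent, \<open>2 K\<close> is the Lipschitz constant of the drift and the extra \<open>1\<close> absorbs the difference of
  the frequencies.\<close>

lemma curve_lipschitz_le:
  assumes "t \<ge> 0"
  shows "curve \<theta>1 w1 t - curve \<theta>2 w2 t \<le> (\<bar>\<theta>1 - \<theta>2\<bar> + \<bar>w1 - w2\<bar>) * exp ((2 * K + 1) * t)"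
proof -
  define C where "C = \<bar>\<theta>1 - \<theta>2\<bar> + \<bar>w1 - w2\<bar>"
  have C: "C \<ge> 0" by (simp add: C_def)
  define c where "c s = C * exp ((2 * K + 1) * s)" for s
  have "curve \<theta>1 w1 t - curve \<theta>2 w2 t - c t \<le> 0"
  proof (rule gronwall_nonpos[where L="2*K" and t=t])
    fix s :: real assume s: "0 \<le> s"
    show "((\<lambda>s. curve \<theta>1 w1 s - curve \<theta>2 w2 s - c s) has_real_derivative
      curve' \<theta>1 w1 s - curve' \<theta>2 w2 s - (2 * K + 1) * c s) (at s)"
      unfolding c_def by (rule derivative_eq_intros DERIV_curve refl)+ simp
    have c: "c s \<ge> C"
    proof -
      have "1 \<le> exp ((2 * K + 1) * s)" using s K_pos by simp
      then show ?thesis unfolding c_def using C mult_left_mono[of 1 "exp ((2 * K + 1) * s)" C] by simp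
    qed
    have w: "w1 - w2 \<le> C" by (simp add: C_def)
    assume "curve \<theta>1 w1 s - curve \<theta>2 w2 s - c s > 0"
    then have "drift (curve \<theta>1 w1 s) s - drift (curve \<theta>2 w2 s) s \<le> 2 * K * (curve \<theta>1 w1 s - curve \<theta>2 w2 s)"
      using drift_lipschitz[of "curve \<theta>1 w1 s" s "curve \<theta>2 w2 s"] c C by simp
    then show "curve' \<theta>1 w1 s - curve' \<theta>2 w2 s - (2 * K + 1) * c s
       \<le> 2 * K * (curve \<theta>1 w1 s - curve \<theta>2 w2 s - c s)"
      using s c w by (simp add: curve'_eq algebra_simps)
  qed (use assms in \<open>auto simp: c_def C_def\<close>)
  then show ?thesis by (simp add: c_def C_def)
qed

lemma curve_lipschitz:
  assumes "t \<ge> 0"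
  shows "\<bar>curve \<theta>1 w1 t - curve \<theta>2 w2 t\<bar> \<le> (\<bar>\<theta>1 - \<theta>2\<bar> + \<bar>w1 - w2\<bar>) * exp ((2 * K + 1) * t)"
  using curve_lipschitz_le[OF assms, of \<theta>1 w1 \<theta>2 w2] curve_lipschitz_le[OF assms, of \<theta>2 w2 \<theta>1 w1]
  by (simp add: abs_minus_commute abs_le_iff)

lemma continuous_curve_param:
  assumes "t \<ge> 0"
  shows "continuous_on UNIV (\<lambda>p. curve (fst p) (snd p) t)"
proof -
  have "((\<lambda>p. curve (fst p) (snd p) t) \<longlongrightarrow> curve (fst a) (snd a) t) (at a)" for a :: "real \<times> real"
  proof (rule LIM_zero_cancel, rule tendsto_0_le[where K=1])
    show "((\<lambda>p. (\<bar>fst p - fst a\<bar> + \<bar>snd p - snd a\<bar>) * exp ((2 * K + 1) * t)) \<longlongrightarrow> 0) (at a)"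
      by (auto intro!: tendsto_eq_intros)
    show "\<forall>\<^sub>F p in at a. norm (curve (fst p) (snd p) t - curve (fst a) (snd a) t)
       \<le> norm ((\<bar>fst p - fst a\<bar> + \<bar>snd p - snd a\<bar>) * exp ((2 * K + 1) * t)) * 1"
      using curve_lipschitz[OF assms] by (intro always_eventually allI) auto
  qed
  then show ?thesis by (simp add: continuous_on_def)
qed

lemma measurable_curve [measurable (raw)]:
  assumes "f \<in> borel_measurable M" "h \<in> borel_measurable M" "t \<ge> 0"
  shows "(\<lambda>x. curve (f x) (h x) t) \<in> borel_measurable M"
proof -
  have "(\<lambda>p. curve (fst p) (snd p) t) \<in> borel_measurable borel"
    by (rule borel_measurable_continuous_onI[OF continuous_curve_param[OF assms(3)]])
  then have "(\<lambda>p. curve (fst p) (snd p) t) \<circ> (\<lambda>x. (f x, h x)) \<in> borel_measurable M"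
    by (rule measurable_comp[rotated]) (use assms in simp)
  then show ?thesis by (simp add: comp_def)
qed

end

section \<open>Weak form of the equation\<close>

lemma borel_measurable_phase:
  assumes "sets M = sets phase_borel" "f \<in> measurable (borel \<Otimes>\<^sub>M borel) N"
  shows "f \<in> measurable M N"
proof -
  have "f \<in> measurable borel N" using assms(2) by (simp add: borel_prod)
  then have "f \<in> measurable phase_borel N"
    unfolding phase_borel_def by (rule measurable_restrict_space1)
  then show ?thesis using measurable_cong_sets[OF assms(1) refl, of N] by simp
qed

lemma space_phase: "sets M = sets phase_borel \<Longrightarrow> space M = {0..<2 * pi} \<times> UNIV"
  by (drule sets_eq_imp_space_eq) (simp add: phase_borel_def space_restrict_space)

lemma sets_phaseI:
  assumes "sets M = sets phase_borel" "Measurable.pred (borel \<Otimes>\<^sub>M borel) P"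
  shows "{x \<in> space M. P x} \<in> sets M"
  using borel_measurable_phase[OF assms] by (simp add: pred_def)

locale kuramoto_solution =
  fixes K :: real and g :: "real \<Rightarrow> real" and \<mu>0 :: "(real \<times> real) measure"
    and \<mu> :: "real \<Rightarrow> (real \<times> real) measure" and a b :: real
  assumes K_pos: "K > 0"
    and frequency_density: "frequency_density g"
    and radon0: "radon_measure \<mu>0"
    and prob0: "prob_space \<mu>0"
    and density0: "has_frequency_density \<mu>0 g"
    and solution: "mv_solution K \<mu>0 \<mu>"
    and range0: "AE x in \<mu>0. a \<le> snd x \<and> snd x \<le> b"
begin

lemma sets0: "sets \<mu>0 = sets phase_borel"
  using radon0 by (simp add: radon_measure_def)

lemma radon: "t \<ge> 0 \<Longrightarrow> radon_measure (\<mu> t)"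
proof -
  assume "t \<ge> 0"
  have "mv_solution_on (t + 1) K \<mu>0 \<mu>" using solution \<open>t \<ge> 0\<close> by (simp add: mv_solution_def)
  then show ?thesis using \<open>t \<ge> 0\<close> by (simp add: mv_solution_on_def)
qed

lemma sets: "t \<ge> 0 \<Longrightarrow> sets (\<mu> t) = sets phase_borel"
  using radon by (simp add: radon_measure_def)

text \<open>The weak form for test functions \<open>\<psi> \<Omega> H \<theta> s\<close>. Only the times up to \<open>t\<close> are seen,
  so an admissible test function is obtained by a cut-off in time that is \<open>1\<close> up to time \<open>t\<close> and
  vanishes after \<open>t + 1\<close>, and the equation is used on the time interval \<open>[0, t + 2)\<close>.\<close>

lemma weak_form_product:
  assumes chi: "\<And>w. (\<psi> has_real_derivative \<psi>' w) (at w)" "continuous_on UNIV \<psi>'"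
    and supp: "\<And>w. \<bar>w\<bar> > c \<Longrightarrow> \<psi> w = 0"
    and H: "\<And>\<theta> s. ((\<lambda>p. H (fst p) (snd p)) has_derivative
        (\<lambda>v. H\<theta> \<theta> s * fst v + Hs \<theta> s * snd v)) (at (\<theta>, s))"
    and cH\<theta>: "continuous_on UNIV (\<lambda>p. H\<theta> (fst p) (snd p))"
    and cHs: "continuous_on UNIV (\<lambda>p. Hs (fst p) (snd p))"
    and per: "\<And>\<theta> s. H (\<theta> + 2 * pi) s = H \<theta> s"
    and t: "t \<ge> 0"
  shows "((\<lambda>s. pairing (\<mu> s) (\<lambda>\<theta> w. \<psi> w * Hs \<theta> s + omega K (\<mu> s) \<theta> w * (\<psi> w * H\<theta> \<theta> s)))
    has_integral pairing (\<mu> t) (\<lambda>\<theta> w. \<psi> w * H \<theta> t) - pairing \<mu>0 (\<lambda>\<theta> w. \<psi> w * H \<theta> 0)) {0..t}"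
proof -
  define T where "T = t + 2"
  define h where "h = (\<lambda>y :: real \<times> real \<times> real. \<psi> (fst (snd y)) * H (fst y) (snd (snd y)) * cutoff t (snd (snd y)))"
  define h' where "h' = (\<lambda>y :: real \<times> real \<times> real.
     (\<psi> (fst (snd y)) * H\<theta> (fst y) (snd (snd y)) * cutoff t (snd (snd y)),
      \<psi>' (fst (snd y)) * H (fst y) (snd (snd y)) * cutoff t (snd (snd y)),
      \<psi> (fst (snd y)) * (Hs (fst y) (snd (snd y)) * cutoff t (snd (snd y))
        + H (fst y) (snd (snd y)) * cutoff' t (snd (snd y)))))"
  have cH: "continuous_on UNIV (\<lambda>p. H (fst p) (snd p))"
    by (rule continuous_at_imp_continuous_on) (use has_derivative_continuous[OF H] in auto)
  have c\<psi>: "continuous_on UNIV \<psi>" by (meson DERIV_isCont chi(1) continuous_at_imp_continuous_on)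
  have ccut: "continuous_on UNIV (cutoff t)" by (meson DERIV_isCont DERIV_cutoff continuous_at_imp_continuous_on)
  have test: "C1_test T h h'"
    unfolding C1_test_def
  proof (intro conjI ballI allI)
    fix x :: "real \<times> real \<times> real"
    obtain \<theta> w s where x: "x = (\<theta>, w, s)" by (cases x) auto
    have dH: "((\<lambda>y. H (fst y) (snd (snd y))) has_derivative
       (\<lambda>v. H\<theta> \<theta> s * fst v + Hs \<theta> s * snd (snd v))) (at x)"
    proof -
      have 1: "((\<lambda>y :: real \<times> real \<times> real. (fst y, snd (snd y))) has_derivative (\<lambda>v. (fst v, snd (snd v)))) (at x)"
        by (auto intro!: derivative_eq_intros)
      have 2: "((\<lambda>p. H (fst p) (snd p)) has_derivative (\<lambda>v. H\<theta> \<theta> s * fst v + Hs \<theta> s * snd v))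
         (at ((\<lambda>y. (fst y, snd (snd y))) x))"
        using H[of \<theta> s] by (simp add: x)
      from has_derivative_compose[OF 1 2] show ?thesis by simp
    qed
    have d\<psi>: "((\<lambda>y :: real \<times> real \<times> real. \<psi> (fst (snd y))) has_derivative (\<lambda>v. fst (snd v) * \<psi>' w)) (at x)"
      by (rule DERIV_compose_FDERIV) (auto simp: x chi(1) intro!: derivative_eq_intros)
    have dc: "((\<lambda>y :: real \<times> real \<times> real. cutoff t (snd (snd y))) has_derivative (\<lambda>v. snd (snd v) * cutoff' t s)) (at x)"
      by (rule DERIV_compose_FDERIV) (auto simp: x DERIV_cutoff intro!: derivative_eq_intros)
    have "((\<lambda>y. \<psi> (fst (snd y)) * H (fst y) (snd (snd y)) * cutoff t (snd (snd y))) has_derivative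
      (\<lambda>v. \<psi> (fst (snd x)) * H (fst x) (snd (snd x)) * (snd (snd v) * cutoff' t s)
        + (\<psi> (fst (snd x)) * (H\<theta> \<theta> s * fst v + Hs \<theta> s * snd (snd v)) + fst (snd v) * \<psi>' w * H (fst x) (snd (snd x)))
          * cutoff t (snd (snd x)))) (at x)"
      by (rule has_derivative_mult[OF has_derivative_mult[OF d\<psi> dH] dc])
    moreover have "(\<lambda>v. \<psi> (fst (snd x)) * H (fst x) (snd (snd x)) * (snd (snd v) * cutoff' t s)
        + (\<psi> (fst (snd x)) * (H\<theta> \<theta> s * fst v + Hs \<theta> s * snd (snd v)) + fst (snd v) * \<psi>' w * H (fst x) (snd (snd x)))
          * cutoff t (snd (snd x))) = (\<lambda>v. h' x \<bullet> v)"
      by (auto simp: x h'_def inner_prod_def algebra_simps)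
    ultimately have "(h has_derivative (\<lambda>v. h' x \<bullet> v)) (at x)"
      by (simp only: h_def)
    then show "(h has_derivative (\<lambda>v. h' x \<bullet> v)) (at x within UNIV \<times> UNIV \<times> {0..<T})"
      by (rule has_derivative_at_withinI)
  next
    have c1: "continuous_on UNIV (\<lambda>y :: real \<times> real \<times> real. F (fst y) (snd (snd y)))"
      if "continuous_on UNIV (\<lambda>p. F (fst p) (snd p))" for F :: "real \<Rightarrow> real \<Rightarrow> real"
      using continuous_on_compose2[OF that, of UNIV "\<lambda>y :: real \<times> real \<times> real. (fst y, snd (snd y))"]
      by (simp add: continuous_intros)
    have c2: "continuous_on UNIV (\<lambda>y :: real \<times> real \<times> real. F (fst (snd y)))"
      if "continuous_on UNIV F" for F :: "real \<Rightarrow> real"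
      using continuous_on_compose2[OF that, of UNIV "\<lambda>y :: real \<times> real \<times> real. fst (snd y)"]
      by (simp add: continuous_intros)
    have c3: "continuous_on UNIV (\<lambda>y :: real \<times> real \<times> real. F (snd (snd y)))"
      if "continuous_on UNIV F" for F :: "real \<Rightarrow> real"
      using continuous_on_compose2[OF that, of UNIV "\<lambda>y :: real \<times> real \<times> real. snd (snd y)"]
      by (simp add: continuous_intros)
    have "continuous_on UNIV h'"
      unfolding h'_def
      by (intro continuous_on_Pair continuous_on_mult continuous_on_add c1[OF cH] c1[OF cH\<theta>] c1[OF cHs]
          c2[OF c\<psi>] c2[OF chi(2)] c3[OF ccut] c3[OF continuous_cutoff'])
    then show "continuous_on (UNIV \<times> UNIV \<times> {0..<T}) h'" by (rule continuous_on_subset) auto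
  next
    fix \<theta> w s
    show "h (\<theta> + 2 * pi, w, s) = h (\<theta>, w, s)" by (simp add: h_def per)
  next
    have "\<forall>\<theta> w. \<forall>s\<in>{0..<T}. c < \<bar>w\<bar> \<or> t + 1 < s \<longrightarrow> h (\<theta>, w, s) = 0"
      using supp cutoff_eq_0[of t] t by (auto simp: h_def)
    then show "\<exists>a. \<exists>T'<T. \<forall>\<theta> \<Omega>. \<forall>t\<in>{0..<T}. \<bar>\<Omega>\<bar> > a \<or> t > T' \<longrightarrow> h (\<theta>, \<Omega>, t) = 0"
      by (intro exI[of _ c] exI[of _ "t + 1"]) (auto simp: T_def)
  qed
  have "mv_solution_on T K \<mu>0 \<mu>" using solution t by (simp add: mv_solution_def T_def)
  then have "((\<lambda>s. pairing (\<mu> s) (\<lambda>\<theta> \<Omega>. snd (snd (h' (\<theta>, \<Omega>, s))) + omega K (\<mu> s) \<theta> \<Omega> * fst (h' (\<theta>, \<Omega>, s))))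
     has_integral pairing (\<mu> t) (\<lambda>\<theta> \<Omega>. h (\<theta>, \<Omega>, t)) - pairing \<mu>0 (\<lambda>\<theta> \<Omega>. h (\<theta>, \<Omega>, 0))) {0..t}"
    using test t unfolding mv_solution_on_def by (simp add: T_def)
  moreover have "pairing (\<mu> t) (\<lambda>\<theta> \<Omega>. h (\<theta>, \<Omega>, t)) = pairing (\<mu> t) (\<lambda>\<theta> w. \<psi> w * H \<theta> t)"
    "pairing \<mu>0 (\<lambda>\<theta> \<Omega>. h (\<theta>, \<Omega>, 0)) = pairing \<mu>0 (\<lambda>\<theta> w. \<psi> w * H \<theta> 0)"
    using t by (simp_all add: h_def cutoff_eq_1)
  ultimately have "((\<lambda>s. pairing (\<mu> s) (\<lambda>\<theta> \<Omega>. snd (snd (h' (\<theta>, \<Omega>, s))) + omega K (\<mu> s) \<theta> \<Omega> * fst (h' (\<theta>, \<Omega>, s))))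
     has_integral pairing (\<mu> t) (\<lambda>\<theta> w. \<psi> w * H \<theta> t) - pairing \<mu>0 (\<lambda>\<theta> w. \<psi> w * H \<theta> 0)) {0..t}" by simp
  then show ?thesis
    by (rule has_integral_eq[rotated]) (auto simp: h'_def cutoff_eq_1 cutoff'_eq_0)
qed

subsection \<open>The frequency marginal is conserved\<close>

text \<open>A test function of the frequency alone has vanishing derivative along the flow. This one tends to the indicator
  of \<open>p < \<Omega> < q\<close>.\<close>

lemma marginal_bump:
  assumes t: "t \<ge> 0"
  shows "pairing (\<mu> t) (\<lambda>\<theta> w. bump (real n) ((w - p) * (q - w))) = pairing \<mu>0 (\<lambda>\<theta> w. bump (real n) ((w - p) * (q - w)))"
proof -
  have "((\<lambda>s. pairing (\<mu> s) (\<lambda>\<theta> w. bump (real n) ((w - p) * (q - w)) * 0 + omega K (\<mu> s) \<theta> w * (bump (real n) ((w - p) * (q - w)) * 0)))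
    has_integral pairing (\<mu> t) (\<lambda>\<theta> w. bump (real n) ((w - p) * (q - w)) * 1)
      - pairing \<mu>0 (\<lambda>\<theta> w. bump (real n) ((w - p) * (q - w)) * 1)) {0..t}"
  proof (rule weak_form_product[where \<psi>="\<lambda>w. bump (real n) ((w - p) * (q - w))"
        and \<psi>'="\<lambda>w. bump' (real n) ((w - p) * (q - w)) * (p + q - 2 * w)" and c="max \<bar>p\<bar> \<bar>q\<bar>"
        and H="\<lambda>_ _. 1" and H\<theta>="\<lambda>_ _. 0" and Hs="\<lambda>_ _. 0", OF _ _ _ _ _ _ _ t])
    fix w
    show "((\<lambda>w. bump (real n) ((w - p) * (q - w))) has_real_derivative bump' (real n) ((w - p) * (q - w)) * (p + q - 2 * w)) (at w)"
      by (rule DERIV_chain2[OF DERIV_bump]) (auto intro!: derivative_eq_intros)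
    show "bump (real n) ((w - p) * (q - w)) = 0" if "\<bar>w\<bar> > max \<bar>p\<bar> \<bar>q\<bar>"
      using that by (intro bump_eq_0) (auto simp: mult_le_0_iff)
    show "continuous_on UNIV (\<lambda>w. bump' (real n) ((w - p) * (q - w)) * (p + q - 2 * w))"
      by (intro continuous_on_mult continuous_on_compose2[OF continuous_bump'[of _ UNIV]] continuous_intros) auto
  qed auto
  then show ?thesis by (simp add: pairing_def has_integral_iff)
qed

lemma emeasure_frequency_interval:
  assumes M: "radon_measure M" and pq: "p < q"
  shows "(\<lambda>n. pairing M (\<lambda>\<theta> w. bump (real n) ((w - p) * (q - w)))) \<longlonglongrightarrow> measure M {x \<in> space M. p < snd x \<and> snd x < q}"
    and "emeasure M {x \<in> space M. p < snd x \<and> snd x < q} < \<infinity>"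
proof -
  have sM: "sets M = sets phase_borel" using M by (simp add: radon_measure_def)
  let ?S = "{x \<in> space M. p < snd x \<and> snd x < q}"
  have S: "?S \<in> sets M" by (rule sets_phaseI[OF sM]) measurable
  define c where "c = max \<bar>p\<bar> \<bar>q\<bar>"
  have strip: "{0..<2 * pi} \<times> {-c..c} = {x \<in> space M. -c \<le> snd x \<and> snd x \<le> c}"
    by (auto simp: space_phase[OF sM])
  have S': "{0..<2 * pi} \<times> {-c..c} \<in> sets M"
    unfolding strip by (rule sets_phaseI[OF sM]) measurable
  have "?S \<subseteq> {0..<2 * pi} \<times> {-c..c}"
  proof
    fix x assume "x \<in> ?S"
    then have "x \<in> {0..<2 * pi} \<times> UNIV" "p < snd x" "snd x < q" by (auto simp: space_phase[OF sM])
    then show "x \<in> {0..<2 * pi} \<times> {-c..c}" by (cases x) (auto simp: c_def max_def abs_if split: if_splits)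
  qed
  then have "emeasure M ?S \<le> emeasure M ({0..<2 * pi} \<times> {-c..c})"
    using S' by (rule emeasure_mono)
  also have "\<dots> < \<infinity>" using M by (simp add: radon_measure_def)
  finally show fin: "emeasure M ?S < \<infinity>" .
  have pos: "0 < (w - p) * (q - w) \<Longrightarrow> p < w \<and> w < q" if "p < q" for w
    using that by (auto simp: zero_less_mult_iff)
  have i: "integrable M (indicator ?S :: _ \<Rightarrow> real)" using S fin by simp
  show "(\<lambda>n. pairing M (\<lambda>\<theta> w. bump (real n) ((w - p) * (q - w)))) \<longlonglongrightarrow> measure M ?S"
  proof -
    have iff: "0 < (w - p) * (q - w) \<longleftrightarrow> p < w \<and> w < q" for w
      using pos[OF pq, of w] by auto
    have "(\<lambda>n. LINT x|M. bump (real n) ((snd x - p) * (q - snd x))) \<longlonglongrightarrow> (LINT x|M. indicator ?S x)"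
    proof (rule integral_dominated_convergence[where w="indicator ?S"])
      show "(\<lambda>x. indicator ?S x :: real) \<in> borel_measurable M" using i by auto
      show "(\<lambda>x. bump (real n) ((snd x - p) * (q - snd x))) \<in> borel_measurable M" for n
        by (rule borel_measurable_phase[OF sM]) measurable
      show "integrable M (indicator ?S :: _ \<Rightarrow> real)" by (rule i)
      show "AE x in M. (\<lambda>n. bump (real n) ((snd x - p) * (q - snd x))) \<longlonglongrightarrow> indicator ?S x"
      proof (rule AE_I2)
        fix x assume "x \<in> space M"
        then have "indicator ?S x = (indicator {0<..} ((snd x - p) * (q - snd x)) :: real)"
          using iff[of "snd x"] by (auto simp: indicator_def)
        then show "(\<lambda>n. bump (real n) ((snd x - p) * (q - snd x))) \<longlonglongrightarrow> indicator ?S x"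
          using bump_tendsto by simp
      qed
      show "AE x in M. norm (bump (real n) ((snd x - p) * (q - snd x))) \<le> indicator ?S x" for n
      proof (rule AE_I2)
        fix x assume "x \<in> space M"
        then show "norm (bump (real n) ((snd x - p) * (q - snd x))) \<le> indicator ?S x"
          using iff[of "snd x"] abs_bump_le[of "real n"] bump_eq_0[of "(snd x - p) * (q - snd x)" "real n"]
          by (auto simp: indicator_def not_less[symmetric])
      qed
    qed
    then show ?thesis using S by (simp add: pairing_def)
  qed
qed

lemma measurable_snd0: "snd \<in> measurable \<mu>0 borel"
  by (rule borel_measurable_phase[OF sets0]) measurable

lemma measurable_snd: "t \<ge> 0 \<Longrightarrow> snd \<in> measurable (\<mu> t) borel"
  by (rule borel_measurable_phase[OF sets]) measurable

text \<open>A solution is a priori only a family of Radon measures, which may have infinite mass. Conservation of the mass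
  of every bounded open frequency interval shows that it consists of probability measures with frequency
  density \<open>g\<close>, and that all frequencies stay in the initial range.\<close>

lemma marginal_eq:
  assumes t: "t \<ge> 0"
  shows "distr (\<mu> t) borel snd = distr \<mu>0 borel snd"
proof -
  interpret P0: prob_space \<mu>0 by (rule prob0)
  have Ioo: "emeasure (\<mu> t) {x \<in> space (\<mu> t). p < snd x \<and> snd x < q} = emeasure \<mu>0 {x \<in> space \<mu>0. p < snd x \<and> snd x < q}" for p q
  proof -
    show ?thesis
    proof (cases "p < q")
      case True
      note 1 = emeasure_frequency_interval[OF radon[OF t] True]
      note 2 = emeasure_frequency_interval[OF radon0 True]
      have "measure (\<mu> t) {x \<in> space (\<mu> t). p < snd x \<and> snd x < q} = measure \<mu>0 {x \<in> space \<mu>0. p < snd x \<and> snd x < q}"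
        using 1(1) 2(1) unfolding marginal_bump[OF t] by (rule LIMSEQ_unique)
      then show ?thesis using 1(2) 2(2) by (simp add: emeasure_eq_ennreal_measure less_top)
    next
      case False
      then have "{x \<in> space M. p < snd x \<and> snd x < q} = {}" for M :: "(real \<times> real) measure" by auto
      then show ?thesis by (simp only: emeasure_empty)
    qed
  qed
  have Ioi: "(SUP n. emeasure M {x \<in> space M. p < snd x \<and> snd x < real n}) = emeasure (distr M borel snd) {p<..}"
    if sM: "sets M = sets phase_borel" for M and p
  proof -
    have snd: "snd \<in> measurable M borel" by (rule borel_measurable_phase[OF sM]) measurable
    have "(SUP n. emeasure M {x \<in> space M. p < snd x \<and> snd x < real n}) = emeasure M (\<Union>n. {x \<in> space M. p < snd x \<and> snd x < real n})"
      by (rule SUP_emeasure_incseq) (auto simp: incseq_def intro!: sets_phaseI[OF sM])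
    also have "(\<Union>n. {x \<in> space M. p < snd x \<and> snd x < real n}) = snd -` {p<..} \<inter> space M"
      using reals_Archimedean2 by auto
    finally show ?thesis using snd by (simp add: emeasure_distr)
  qed
  show ?thesis
  proof (rule measure_eqI_lessThan[symmetric])
    fix x
    show "emeasure (distr \<mu>0 borel snd) {x<..} < \<infinity>"
      using measurable_snd0 by (simp add: emeasure_distr P0.emeasure_eq_measure)
    show "emeasure (distr \<mu>0 borel snd) {x<..} = emeasure (distr (\<mu> t) borel snd) {x<..}"
      unfolding Ioi[OF sets0, symmetric] Ioi[OF sets[OF t], symmetric] Ioo ..
  qed auto
qed

lemma marginal:
  assumes t: "t \<ge> 0" shows "distr (\<mu> t) borel snd = density lborel (\<lambda>w. ennreal (g w))"
  using marginal_eq[OF t] density0 by (simp add: has_frequency_density_def)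

lemma prob: assumes t: "t \<ge> 0" shows "prob_space (\<mu> t)"
proof -
  have "prob_space (distr \<mu>0 borel snd)" by (rule prob_space.prob_space_distr[OF prob0 measurable_snd0])
  then have "prob_space (distr (\<mu> t) borel snd)" by (simp add: marginal_eq[OF t])
  then show ?thesis by (rule prob_space_distrD[OF measurable_snd[OF t]])
qed

lemma AE_frequency:
  assumes t: "t \<ge> 0" and P: "Measurable.pred borel P"
  shows "(AE x in \<mu> t. P (snd x)) \<longleftrightarrow> (AE x in \<mu>0. P (snd x))"
proof -
  have S: "{x \<in> space borel. P x} \<in> sets borel" using P by (simp add: pred_def)
  have "(AE x in \<mu> t. P (snd x)) \<longleftrightarrow> (AE w in distr (\<mu> t) borel snd. P w)"
    by (rule AE_distr_iff[OF measurable_snd[OF t] S, symmetric])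
  also have "\<dots> \<longleftrightarrow> (AE x in \<mu>0. P (snd x))"
    unfolding marginal_eq[OF t] by (rule AE_distr_iff[OF measurable_snd0 S])
  finally show ?thesis .
qed

lemma range: "t \<ge> 0 \<Longrightarrow> AE x in \<mu> t. a \<le> snd x \<and> snd x \<le> b"
  using range0 AE_frequency[of t "\<lambda>w. a \<le> w \<and> w \<le> b"] by simp

lemma AE_phase:
  assumes "t \<ge> 0" shows "AE x in \<mu> t. 0 \<le> fst x \<and> fst x < 2 * pi"
  by (rule AE_I2) (auto simp: space_phase[OF sets[OF assms]])

subsection \<open>The drift and the characteristics of a solution\<close>

definition cos_moment :: "real \<Rightarrow> real" where
  "cos_moment s = K * (LINT x|\<mu> (max 0 s). cos (fst x))"

definition sin_moment :: "real \<Rightarrow> real" where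
  "sin_moment s = K * (LINT x|\<mu> (max 0 s). sin (fst x))"

lemma integrable_bounded:
  fixes f :: "real \<times> real \<Rightarrow> real"
  assumes "t \<ge> 0" "f \<in> borel_measurable (borel \<Otimes>\<^sub>M borel)" "AE x in \<mu> t. \<bar>f x\<bar> \<le> B"
  shows "integrable (\<mu> t) f"
proof -
  interpret prob_space "\<mu> t" by (rule prob[OF assms(1)])
  show ?thesis
    by (rule integrable_const_bound[of _ B])
      (use assms(3) borel_measurable_phase[OF sets[OF assms(1)] assms(2)] in auto)
qed

text \<open>Functions of \<open>\<theta>\<close> alone are not compactly supported in \<open>\<Omega>\<close>; a cut-off outside the frequency range makes them
  admissible without changing the integrals.\<close>

lemma continuous_moment:
  fixes f :: "real \<Rightarrow> real"
  assumes f: "continuous_on UNIV f" and per: "\<And>\<theta>. f (\<theta> + 2 * pi) = f \<theta>"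
  shows "continuous_on UNIV (\<lambda>s. LINT x|\<mu> (max 0 s). f (fst x))"
proof -
  define R where "R = max \<bar>a\<bar> \<bar>b\<bar>"
  define h where "h \<theta> w = f \<theta> * cutoff R w" for \<theta> w
  have eq: "(LINT x|\<mu> t. f (fst x)) = pairing (\<mu> t) h" if "t \<ge> 0" for t
    unfolding pairing_def h_def
  proof (rule integral_cong_AE)
    show "(\<lambda>x. f (fst x)) \<in> borel_measurable (\<mu> t)"
      by (rule borel_measurable_phase[OF sets[OF that]]) (use borel_measurable_continuous_onI[OF f] in measurable)
    show "(\<lambda>x. f (fst x) * cutoff R (snd x)) \<in> borel_measurable (\<mu> t)"
    proof (rule borel_measurable_phase[OF sets[OF that]])
      have [measurable]: "f \<in> borel_measurable borel" using f by (rule borel_measurable_continuous_onI)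
      show "(\<lambda>x. f (fst x) * cutoff R (snd x)) \<in> borel_measurable (borel \<Otimes>\<^sub>M borel)"
        unfolding cutoff_def by measurable
    qed
    have cut: "cutoff R w = 1" if "a \<le> w" "w \<le> b" for w
      using that by (intro cutoff_eq_1) (auto simp: R_def)
    show "AE x in \<mu> t. f (fst x) = f (fst x) * cutoff R (snd x)"
      using range[OF that] by eventually_elim (simp add: cut)
  qed
  have ccut: "continuous_on UNIV (cutoff R)" by (meson DERIV_isCont DERIV_cutoff continuous_at_imp_continuous_on)
  have test: "C0_test h"
    unfolding C0_test_def h_def
  proof (intro conjI allI exI impI)
    show "continuous_on UNIV (\<lambda>x. f (fst x) * cutoff R (snd x))"
      by (intro continuous_on_mult continuous_on_compose2[OF f] continuous_on_compose2[OF ccut] continuous_intros) auto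
    show "f (\<theta> + 2 * pi) * cutoff R w = f \<theta> * cutoff R w" for \<theta> w by (simp add: per)
    show "f \<theta> * cutoff R w = 0" if "\<bar>w\<bar> > R + 1" for \<theta> w
      using that by (simp add: cutoff_eq_0 R_def)
  qed
  have c: "continuous_on {0..<T} (\<lambda>t. pairing (\<mu> t) h)" if "T > 0" for T
    using solution test that by (simp add: mv_solution_def mv_solution_on_def)
  have "isCont (\<lambda>s. pairing (\<mu> (max 0 s)) h) s" for s
  proof -
    define T where "T = \<bar>s\<bar> + 1"
    have "continuous_on {..<T} (\<lambda>s. pairing (\<mu> (max 0 s)) h)"
      by (rule continuous_on_compose2[OF c[of T]]) (auto intro!: continuous_intros simp: T_def)
    then show ?thesis
      by (rule continuous_on_interior) (auto simp: T_def interior_open)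
  qed
  then have "continuous_on UNIV (\<lambda>s. pairing (\<mu> (max 0 s)) h)"
    by (simp add: continuous_at_imp_continuous_on)
  then show ?thesis by (simp add: eq)
qed

lemma moment_le:
  fixes f :: "real \<Rightarrow> real"
  assumes "\<And>\<theta>. \<bar>f \<theta>\<bar> \<le> 1" "f \<in> borel_measurable borel" "t \<ge> 0"
  shows "\<bar>K * (LINT x|\<mu> t. f (fst x))\<bar> \<le> K"
proof -
  interpret prob_space "\<mu> t" by (rule prob[OF assms(3)])
  note [measurable] = assms(2)
  have m: "(\<lambda>x. f (fst x)) \<in> borel_measurable (borel \<Otimes>\<^sub>M borel)" by measurable
  have i: "integrable (\<mu> t) (\<lambda>x. f (fst x))"
    by (rule integrable_bounded[OF assms(3) m, of 1]) (use assms in auto)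
  have "\<bar>LINT x|\<mu> t. f (fst x)\<bar> \<le> (LINT x|\<mu> t. \<bar>f (fst x)\<bar>)" by (rule integral_abs_bound)
  also have "\<dots> \<le> (LINT x|\<mu> t. 1)" using i assms(1) by (intro integral_mono) auto
  finally have "\<bar>LINT x|\<mu> t. f (fst x)\<bar> \<le> 1" by (simp add: prob_space)
  then show ?thesis using K_pos by (simp add: abs_mult)
qed

sublocale kuramoto_field cos_moment sin_moment K
proof
  show "continuous_on UNIV cos_moment" "continuous_on UNIV sin_moment"
    unfolding cos_moment_def sin_moment_def by (intro continuous_intros continuous_moment; simp)+
qed (auto simp: cos_moment_def sin_moment_def intro!: moment_le K_pos)

lemma integrable_sin_cos:
  assumes "t \<ge> 0"
  shows "integrable (\<mu> t) (\<lambda>x. sin (fst x))" "integrable (\<mu> t) (\<lambda>x. cos (fst x))"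
  by (rule integrable_bounded[OF assms, of _ 1]; simp)+

lemma drift_eq:
  assumes s: "s \<ge> 0" shows "drift \<theta> s = - K * (LINT x|\<mu> s. sin (\<theta> - fst x))"
  unfolding sin_diff using s integrable_sin_cos[OF s]
  by (simp add: drift_def cos_moment_def sin_moment_def max_absorb2 algebra_simps)

lemma omega_eq:
  assumes s: "s \<ge> 0" shows "omega K (\<mu> s) \<theta> w = w + drift \<theta> s"
  by (simp add: omega_def pairing_def drift_eq[OF s])

text \<open>As the frequencies lie in \<open>[a, b]\<close>, the factor \<open>\<psi>\<close> may be arbitrary outside this interval.\<close>

lemma weak_form:
  assumes chi: "\<And>w. (\<psi> has_real_derivative \<psi>' w) (at w)" "continuous_on UNIV \<psi>'"
    and H: "\<And>\<theta> s. ((\<lambda>p. H (fst p) (snd p)) has_derivative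
        (\<lambda>v. H\<theta> \<theta> s * fst v + Hs \<theta> s * snd v)) (at (\<theta>, s))"
    and cH\<theta>: "continuous_on UNIV (\<lambda>p. H\<theta> (fst p) (snd p))"
    and cHs: "continuous_on UNIV (\<lambda>p. Hs (fst p) (snd p))"
    and per: "\<And>\<theta> s. H (\<theta> + 2 * pi) s = H \<theta> s"
    and t: "t \<ge> 0"
  shows "((\<lambda>s. LINT x|\<mu> s. \<psi> (snd x) * (Hs (fst x) s + (snd x + drift (fst x) s) * H\<theta> (fst x) s))
    has_integral (LINT x|\<mu> t. \<psi> (snd x) * H (fst x) t) - (LINT x|\<mu>0. \<psi> (snd x) * H (fst x) 0)) {0..t}"
proof -
  define R where "R = max \<bar>a\<bar> \<bar>b\<bar>"
  have cut: "cutoff R w = 1" if "a \<le> w" "w \<le> b" for w using that by (intro cutoff_eq_1) (auto simp: R_def)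
  have cH: "continuous_on UNIV (\<lambda>p. H (fst p) (snd p))"
    by (rule continuous_at_imp_continuous_on) (use has_derivative_continuous[OF H] in auto)
  have c\<psi>: "continuous_on UNIV \<psi>" by (meson DERIV_isCont chi(1) continuous_at_imp_continuous_on)
  have ccut: "continuous_on UNIV (cutoff R)" by (meson DERIV_isCont DERIV_cutoff continuous_at_imp_continuous_on)
  have slice: "(\<lambda>\<theta>. F \<theta> s) \<in> borel_measurable borel" if "continuous_on UNIV (\<lambda>p. F (fst p) (snd p))"
    for F :: "real \<Rightarrow> real \<Rightarrow> real" and s
    using continuous_on_compose2[OF that, of UNIV "\<lambda>\<theta>. (\<theta>, s)"]
    by (intro borel_measurable_continuous_onI) (simp add: continuous_intros)
  note [measurable] = slice[OF cH] slice[OF cH\<theta>] slice[OF cHs]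
    borel_measurable_continuous_onI[OF c\<psi>] borel_measurable_continuous_onI[OF ccut]
  have [measurable]: "(\<lambda>\<theta>. drift \<theta> s) \<in> borel_measurable borel" for s
    by (intro borel_measurable_continuous_onI continuous_intros)
  have "((\<lambda>s. pairing (\<mu> s) (\<lambda>\<theta> w. (\<psi> w * cutoff R w) * Hs \<theta> s + omega K (\<mu> s) \<theta> w * ((\<psi> w * cutoff R w) * H\<theta> \<theta> s)))
    has_integral pairing (\<mu> t) (\<lambda>\<theta> w. (\<psi> w * cutoff R w) * H \<theta> t) - pairing \<mu>0 (\<lambda>\<theta> w. (\<psi> w * cutoff R w) * H \<theta> 0)) {0..t}"
  proof (rule weak_form_product[where c="R + 1", OF _ _ _ H cH\<theta> cHs per t])
    fix w
    show "((\<lambda>w. \<psi> w * cutoff R w) has_real_derivative (\<psi>' w * cutoff R w + cutoff' R w * \<psi> w)) (at w)"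
      by (rule DERIV_mult[OF chi(1) DERIV_cutoff])
    show "\<psi> w * cutoff R w = 0" if "\<bar>w\<bar> > R + 1" using that by (simp add: cutoff_eq_0 R_def)
  qed (intro continuous_intros chi(2) c\<psi> ccut continuous_cutoff')
  note weak = this
  have eq: "pairing (\<mu> s) (\<lambda>\<theta> w. (\<psi> w * cutoff R w) * Hs \<theta> s + omega K (\<mu> s) \<theta> w * ((\<psi> w * cutoff R w) * H\<theta> \<theta> s))
      = (LINT x|\<mu> s. \<psi> (snd x) * (Hs (fst x) s + (snd x + drift (fst x) s) * H\<theta> (fst x) s))" if s: "s \<in> {0..t}" for s
  proof -
    have s0: "s \<ge> 0" using s by simp
    show ?thesis
      unfolding pairing_def
      by (intro integral_cong_AE borel_measurable_phase[OF sets[OF s0]] eventually_mono[OF range[OF s0]])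
        (auto simp: omega_eq[OF s0] cut algebra_simps)
  qed
  have 1: "pairing (\<mu> t) (\<lambda>\<theta> w. (\<psi> w * cutoff R w) * H \<theta> t) = (LINT x|\<mu> t. \<psi> (snd x) * H (fst x) t)"
    unfolding pairing_def
    by (intro integral_cong_AE borel_measurable_phase[OF sets[OF t]] eventually_mono[OF range[OF t]])
      (auto simp: cut)
  have 2: "pairing \<mu>0 (\<lambda>\<theta> w. (\<psi> w * cutoff R w) * H \<theta> 0) = (LINT x|\<mu>0. \<psi> (snd x) * H (fst x) 0)"
    unfolding pairing_def
    by (intro integral_cong_AE borel_measurable_phase[OF sets0] eventually_mono[OF range0])
      (auto simp: cut)
  show ?thesis
    by (rule has_integral_eq[OF _ weak[unfolded 1 2]]) (rule eq)
qed

end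

section \<open>Confinement of the phases\<close>

lemma integral_nonpos_AE:
  fixes f :: "'a \<Rightarrow> real"
  assumes "AE x in M. f x \<le> 0" shows "(LINT x|M. f x) \<le> 0"
  using integral_nonneg_AE[where M=M and f="\<lambda>x. - f x"] assms by simp

lemma (in kuramoto_field) has_derivative_curve_snd:
  "((\<lambda>p :: real \<times> real. curve \<theta>0 w (snd p)) has_derivative (\<lambda>v. snd v * curve' \<theta>0 w s)) (at (\<theta>, s))"
  by (rule DERIV_compose_FDERIV[where g=snd, OF _ has_derivative_snd[OF has_derivative_ident], simplified]) (simp add: DERIV_curve)

lemma sin_half_diff: "sin ((v - u) / 2) = - sin ((u - v) / 2)" for u v :: real
  by (metis minus_diff_eq minus_divide_left sin_minus)

lemma (in kuramoto_field) has_derivative_half_sine: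
  "((\<lambda>p. sin ((fst p - curve \<theta>0 w (snd p)) / 2)) has_derivative
     (\<lambda>v. (fst v - snd v * curve' \<theta>0 w s) / 2 * cos ((\<theta> - curve \<theta>0 w s) / 2))) (at (\<theta>, s))"
proof -
  have "((\<lambda>p. (fst p - curve \<theta>0 w (snd p)) / 2) has_derivative (\<lambda>v. (fst v - snd v * curve' \<theta>0 w s) / 2)) (at (\<theta>, s))"
    by (rule derivative_eq_intros has_derivative_curve_snd refl)+ auto
  then show ?thesis by (rule has_derivative_eq_rhs[OF has_derivative_sin]) simp
qed

lemma (in kuramoto_field) drift_diff:
  "drift x s - drift y s = 2 * sin ((x - y) / 2) * (- A s * cos ((x + y) / 2) - B s * sin ((x + y) / 2))"
proof -
  have 1: "sin x - sin y = 2 * sin ((x - y) / 2) * cos ((x + y) / 2)" by (simp add: sin_diff_sin)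
  have "cos x - cos y = 2 * sin ((x + y) / 2) * sin ((y - x) / 2)" by (simp add: cos_diff_cos)
  also have "sin ((y - x) / 2) = - sin ((x - y) / 2)"
    by (metis minus_diff_eq minus_divide_left sin_minus)
  finally have 2: "cos x - cos y = - 2 * sin ((x - y) / 2) * sin ((x + y) / 2)" by simp
  have "drift x s - drift y s = - A s * (sin x - sin y) + B s * (cos x - cos y)"
    by (simp add: drift_def algebra_simps)
  then show ?thesis unfolding 1 2 by (simp add: algebra_simps)
qed

text \<open>The function \<open>sin ((\<theta> - x1)/2) sin ((\<theta> - x2)/2)\<close> is \<open>2\<pi>\<close>-periodic in \<open>\<theta>\<close>, negative inside the arc
  from \<open>x1\<close> to \<open>x2\<close> and positive outside. The next inequality is the reason why its positive part is a
  Lyapunov function when \<open>x1\<close> follows the slowest and \<open>x2\<close> the fastest frequency: with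
  \<open>p = (\<theta> - x1)/2\<close>, \<open>r = (\<theta> - x2)/2\<close> the terms that are not proportional to it are squares of definite sign.\<close>

lemma arc_frequency_term:
  fixes p r u v c :: real
  assumes "u \<ge> 0" "v \<ge> 0" "0 < sin (p - r)" "sin p * sin r \<ge> 0" "c * sin (p - r) \<ge> 1" "c \<ge> 0"
  shows "u * (cos p * sin r) - v * (sin p * cos r) \<le> (u + v) * c * (sin p * sin r)"
proof -
  have 1: "cos p * sin r * sin (p - r) = cos (p - r) * (sin p * sin r) - (sin r)\<^sup>2"
  proof -
    have "cos p * sin (p - r) - cos (p - r) * sin p = - sin r"
      using sin_diff[of "p - r" p] by (simp add: algebra_simps)
    then have "sin r * (cos p * sin (p - r) - cos (p - r) * sin p) = sin r * (- sin r)" by simp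
    then show ?thesis by (simp add: power2_eq_square algebra_simps)
  qed
  have 2: "- (sin p * cos r * sin (p - r)) = cos (p - r) * (sin p * sin r) - (sin p)\<^sup>2"
  proof -
    have "cos r * sin (p - r) + cos (p - r) * sin r = sin p"
      using sin_add[of "p - r" r] by (simp add: algebra_simps)
    then have "sin p * (cos r * sin (p - r) + cos (p - r) * sin r) = sin p * sin p" by simp
    then show ?thesis by (simp add: power2_eq_square algebra_simps)
  qed
  have "(u * (cos p * sin r) - v * (sin p * cos r)) * sin (p - r)
    = u * (cos p * sin r * sin (p - r)) + v * (- (sin p * cos r * sin (p - r)))"
    by (simp add: algebra_simps)
  also have "\<dots> = (u + v) * (cos (p - r) * (sin p * sin r)) - u * (sin r)\<^sup>2 - v * (sin p)\<^sup>2"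
    unfolding 1 2 by (simp add: algebra_simps)
  also have "\<dots> \<le> (u + v) * (cos (p - r) * (sin p * sin r))"
    using mult_nonneg_nonneg[OF assms(1) zero_le_power2[of "sin r"]]
      mult_nonneg_nonneg[OF assms(2) zero_le_power2[of "sin p"]] by linarith
  also have "\<dots> \<le> (u + v) * (1 * (sin p * sin r))"
    using assms by (intro mult_left_mono mult_right_mono) auto
  also have "\<dots> \<le> (u + v) * ((c * sin (p - r)) * (sin p * sin r))"
    using assms by (intro mult_left_mono mult_right_mono) auto
  also have "\<dots> = ((u + v) * c * (sin p * sin r)) * sin (p - r)" by (simp add: algebra_simps)
  finally show ?thesis using assms(3) by (simp add: mult_le_cancel_right)
qed

context kuramoto_solution
begin

text \<open>The Lyapunov function is \<open>H = S\<^sub>+\<^sup>2 exp (- L s)\<close> with the product \<open>S\<close> of the two half-angle sines. Along the flow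
  the derivative of \<open>S\<close> is at most \<open>L S / 2\<close> wherever \<open>S > 0\<close>, so \<open>\<integral> H\<close> cannot increase; it vanishes initially,
  hence always, and the measure stays on the arc between the two characteristics. The arc must not close up,
  because \<open>L\<close> involves the inverse of the sine of half its length.\<close>

lemma confinement_circle:
  assumes \<theta>: "\<theta>1 < \<theta>2"
    and init: "AE x in \<mu>0. \<theta>1 \<le> fst x \<and> fst x \<le> \<theta>2"
    and t: "t \<ge> 0"
    and short: "\<And>s. 0 \<le> s \<Longrightarrow> s \<le> t \<Longrightarrow> curve \<theta>2 b s - curve \<theta>1 a s < 2 * pi"
    and ab: "a \<le> b"
  shows "AE x in \<mu> t. sin ((fst x - curve \<theta>1 a t) / 2) * sin ((fst x - curve \<theta>2 b t) / 2) \<le> 0"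
proof -
  define x1 where "x1 = curve \<theta>1 a"
  define x2 where "x2 = curve \<theta>2 b"
  define x1' where "x1' = curve' \<theta>1 a"
  define x2' where "x2' = curve' \<theta>2 b"
  have x12: "x1 s < x2 s" if "s \<ge> 0" for s
    unfolding x1_def x2_def using curve_strict_mono[OF \<theta> ab that] .
  obtain m where m: "m \<in> {0..t}" "\<And>s. s \<in> {0..t} \<Longrightarrow> sin ((x2 m - x1 m) / 2) \<le> sin ((x2 s - x1 s) / 2)"
    using continuous_attains_inf[of "{0..t}" "\<lambda>s. sin ((x2 s - x1 s) / 2)"] t
    by (force simp: x1_def x2_def intro!: continuous_intros continuous_curve)
  have sinpos: "0 < sin ((x2 s - x1 s) / 2)" if "s \<in> {0..t}" for s
    using x12[of s] short[of s] that by (intro sin_gt_zero) (auto simp: x1_def x2_def)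
  \<comment> \<open>the inverse of the smallest value of the sine of half the arc length on \<open>[0, t]\<close>\<close>
  define c where "c = 1 / sin ((x2 m - x1 m) / 2)"
  have c: "c > 0" using sinpos[OF m(1)] by (simp add: c_def)
  have c1: "c * sin ((x2 s - x1 s) / 2) \<ge> 1" if "s \<in> {0..t}" for s
    using m(2)[OF that] sinpos[OF m(1)] by (simp add: c_def)
  \<comment> \<open>\<open>4 K\<close> bounds the contribution of the drift, \<open>(b - a) c\<close> that of the frequencies, which is controlled by
    \<open>arc_frequency_term\<close>\<close>
  define L where "L = 2 * (4 * K + (b - a) * c)"
  define S where "S \<theta> s = sin ((\<theta> - x1 s) / 2) * sin ((\<theta> - x2 s) / 2)" for \<theta> s
  define S\<theta> where "S\<theta> \<theta> s = (cos ((\<theta> - x1 s) / 2) * sin ((\<theta> - x2 s) / 2) + sin ((\<theta> - x1 s) / 2) * cos ((\<theta> - x2 s) / 2)) / 2" for \<theta> s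
  define Ss where "Ss \<theta> s = - (cos ((\<theta> - x1 s) / 2) * x1' s * sin ((\<theta> - x2 s) / 2) + sin ((\<theta> - x1 s) / 2) * cos ((\<theta> - x2 s) / 2) * x2' s) / 2" for \<theta> s
  define H where "H \<theta> s = pos2 (S \<theta> s) * exp (- L * s)" for \<theta> s
  define H\<theta> where "H\<theta> \<theta> s = 2 * max 0 (S \<theta> s) * S\<theta> \<theta> s * exp (- L * s)" for \<theta> s
  define Hs where "Hs \<theta> s = (2 * max 0 (S \<theta> s) * Ss \<theta> s - L * pos2 (S \<theta> s)) * exp (- L * s)" for \<theta> s
  have cx: "continuous_on UNIV x1" "continuous_on UNIV x2" "continuous_on UNIV x1'" "continuous_on UNIV x2'"
    by (auto simp: x1_def x2_def x1'_def x2'_def intro: continuous_curve continuous_curve')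
  have cx': "continuous_on UNIV (\<lambda>p :: real \<times> real. F (snd p))" if "continuous_on UNIV F" for F :: "real \<Rightarrow> real"
    by (rule continuous_on_compose2[OF that]) (auto intro!: continuous_intros)
  note cx'' = cx'[OF cx(1)] cx'[OF cx(2)] cx'[OF cx(3)] cx'[OF cx(4)]
  have cS: "continuous_on UNIV (\<lambda>p. S (fst p) (snd p))" "continuous_on UNIV (\<lambda>p. S\<theta> (fst p) (snd p))"
    "continuous_on UNIV (\<lambda>p. Ss (fst p) (snd p))"
    unfolding S_def S\<theta>_def Ss_def by (intro continuous_intros cx''; simp)+
  have dS: "((\<lambda>p. S (fst p) (snd p)) has_derivative (\<lambda>v. S\<theta> \<theta> s * fst v + Ss \<theta> s * snd v)) (at (\<theta>, s))" for \<theta> s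
    unfolding S_def x1_def x2_def
    by (rule has_derivative_eq_rhs[OF has_derivative_mult[OF has_derivative_half_sine has_derivative_half_sine]])
      (auto simp: S\<theta>_def Ss_def x1_def x2_def x1'_def x2'_def field_simps)
  have dH: "((\<lambda>p. H (fst p) (snd p)) has_derivative (\<lambda>v. H\<theta> \<theta> s * fst v + Hs \<theta> s * snd v)) (at (\<theta>, s))" for \<theta> s
    unfolding H_def
    by (rule derivative_eq_intros dS refl)+ (auto simp: H\<theta>_def Hs_def algebra_simps)
  have S2: "S (\<theta> + 2 * pi) s = S \<theta> s" for \<theta> s
  proof -
    have "sin ((\<theta> + 2 * pi - z) / 2) = - sin ((\<theta> - z) / 2)" for z
    proof -
      have "(\<theta> + 2 * pi - z) / 2 = (\<theta> - z) / 2 + pi" by (simp add: field_simps)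
      then show ?thesis by (simp only: sin_periodic_pi)
    qed
    then show ?thesis by (simp add: S_def)
  qed
  have key: "Hs \<theta> s + (w + drift \<theta> s) * H\<theta> \<theta> s \<le> 0" if s: "s \<in> {0..t}" and w: "a \<le> w" "w \<le> b" for \<theta> s w
  proof (cases "S \<theta> s > 0")
    case False
    then have "max 0 (S \<theta> s) = 0" "pos2 (S \<theta> s) = 0" by auto
    then show ?thesis by (simp add: Hs_def H\<theta>_def del: pos2_eq_0)
  next
    case True
    define p where "p = (\<theta> - x1 s) / 2"
    define r where "r = (\<theta> - x2 s) / 2"
    have pr: "p - r = (x2 s - x1 s) / 2" by (simp add: p_def r_def field_simps)
    have spr: "sin (p - r) = sin ((x2 s - x1 s) / 2)" by (simp only: pr)
    have Seq: "S \<theta> s = sin p * sin r" by (simp add: S_def p_def r_def)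
    have s0: "s \<ge> 0" using s by simp
    define e1 where "e1 = - cos_moment s * cos ((\<theta> + x1 s) / 2) - sin_moment s * sin ((\<theta> + x1 s) / 2)"
    define e2 where "e2 = - cos_moment s * cos ((\<theta> + x2 s) / 2) - sin_moment s * sin ((\<theta> + x2 s) / 2)"
    have e: "\<bar>- cos_moment s * cos z - sin_moment s * sin z\<bar> \<le> 2 * K" for z
    proof -
      have "\<bar>- cos_moment s * cos z - sin_moment s * sin z\<bar> \<le> \<bar>cos_moment s\<bar> * \<bar>cos z\<bar> + \<bar>sin_moment s\<bar> * \<bar>sin z\<bar>"
        by (rule order_trans[OF abs_triangle_ineq4]) (simp add: abs_mult)
      also have "\<dots> \<le> K * 1 + K * 1"
        using A_le[of s] B_le[of s] K_pos by (intro add_mono mult_mono) auto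
      finally show ?thesis by simp
    qed
    have d1: "drift \<theta> s = drift (x1 s) s + 2 * sin p * e1"
      using drift_diff[of \<theta> s "x1 s"] by (simp add: e1_def p_def)
    have d2: "drift \<theta> s = drift (x2 s) s + 2 * sin r * e2"
      using drift_diff[of \<theta> s "x2 s"] by (simp add: e2_def r_def)
    have v1: "w + drift \<theta> s - x1' s = (w - a) + 2 * sin p * e1"
      using curve'_eq[OF s0, of \<theta>1 a] d1 by (simp add: x1'_def x1_def)
    have v2: "w + drift \<theta> s - x2' s = - (b - w) + 2 * sin r * e2"
      using curve'_eq[OF s0, of \<theta>2 b] d2 by (simp add: x2'_def x2_def)
    have "Ss \<theta> s + (w + drift \<theta> s) * S\<theta> \<theta> s
       = (cos p * sin r * (w + drift \<theta> s - x1' s) + sin p * cos r * (w + drift \<theta> s - x2' s)) / 2"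
      by (simp add: Ss_def S\<theta>_def p_def[symmetric] r_def[symmetric] field_simps)
    also have "\<dots> = ((w - a) * (cos p * sin r) - (b - w) * (sin p * cos r)) / 2 + (e1 * cos p + e2 * cos r) * (sin p * sin r)"
      unfolding v1 v2 by (simp add: field_simps)
    also have "\<dots> \<le> ((w - a) + (b - w)) * c * (sin p * sin r) / 2 + (2 * K * 1 + 2 * K * 1) * (sin p * sin r)"
    proof (intro add_mono mult_right_mono divide_right_mono)
      show "(w - a) * (cos p * sin r) - (b - w) * (sin p * cos r) \<le> ((w - a) + (b - w)) * c * (sin p * sin r)"
        using w True Seq sinpos[OF s] c1[OF s] c
        by (intro arc_frequency_term) (simp_all only: spr less_imp_le diff_ge_0_iff_ge)
      have *: "e * cos z \<le> 2 * K * 1" if "\<bar>e\<bar> \<le> 2 * K" for e z :: real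
      proof -
        have "\<bar>e\<bar> * \<bar>cos z\<bar> \<le> 2 * K * 1" using that K_pos by (intro mult_mono) auto
        then show ?thesis by (simp add: abs_le_iff flip: abs_mult)
      qed
      show "e1 * cos p \<le> 2 * K * 1" "e2 * cos r \<le> 2 * K * 1"
        by (rule *, simp only: e1_def e2_def e)+
    qed (use True Seq in auto)
    also have "\<dots> = ((b - a) * c / 2 + 4 * K) * S \<theta> s" unfolding Seq by (simp add: algebra_simps)
    also have "\<dots> \<le> L / 2 * S \<theta> s"
      using True ab c by (intro mult_right_mono) (auto simp: L_def field_simps)
    finally have "S \<theta> s * (Ss \<theta> s + (w + drift \<theta> s) * S\<theta> \<theta> s) \<le> S \<theta> s * (L / 2 * S \<theta> s)"
      using True by (intro mult_left_mono) auto
    then have "2 * S \<theta> s * Ss \<theta> s - L * (S \<theta> s)\<^sup>2 + (w + drift \<theta> s) * (2 * S \<theta> s * S\<theta> \<theta> s) \<le> 0"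
      by (simp add: power2_eq_square algebra_simps)
    then have "(2 * S \<theta> s * Ss \<theta> s - L * (S \<theta> s)\<^sup>2 + (w + drift \<theta> s) * (2 * S \<theta> s * S\<theta> \<theta> s)) * exp (- L * s) \<le> 0"
      by (simp add: mult_nonpos_nonneg)
    moreover have "Hs \<theta> s + (w + drift \<theta> s) * H\<theta> \<theta> s
       = (2 * S \<theta> s * Ss \<theta> s - L * (S \<theta> s)\<^sup>2 + (w + drift \<theta> s) * (2 * S \<theta> s * S\<theta> \<theta> s)) * exp (- L * s)"
      using True by (simp add: Hs_def H\<theta>_def pos2_pos max_absorb2 distrib_right)
    ultimately show ?thesis by simp
  qed
  have int: "((\<lambda>s. LINT x|\<mu> s. 1 * (Hs (fst x) s + (snd x + drift (fst x) s) * H\<theta> (fst x) s))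
    has_integral (LINT x|\<mu> t. 1 * H (fst x) t) - (LINT x|\<mu>0. 1 * H (fst x) 0)) {0..t}"
  proof (rule weak_form[where \<psi>="\<lambda>_. 1" and \<psi>'="\<lambda>_. 0", OF _ _ dH _ _ _ t])
    show "continuous_on UNIV (\<lambda>p. H\<theta> (fst p) (snd p))" "continuous_on UNIV (\<lambda>p. Hs (fst p) (snd p))"
      unfolding H\<theta>_def Hs_def by (intro continuous_intros cS)+
    show "H (\<theta> + 2 * pi) s = H \<theta> s" for \<theta> s by (simp add: H_def S2)
  qed auto
  have "(LINT x|\<mu>0. 1 * H (fst x) 0) = (LINT x|\<mu>0. 0)"
  proof (rule integral_cong_AE)
    have "continuous_on UNIV (\<lambda>\<theta>. H \<theta> 0)"
      unfolding H_def S_def by (intro continuous_intros) auto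
    then have [measurable]: "(\<lambda>\<theta>. H \<theta> 0) \<in> borel_measurable borel" by (rule borel_measurable_continuous_onI)
    show "(\<lambda>x. 1 * H (fst x) 0) \<in> borel_measurable \<mu>0"
      by (rule borel_measurable_phase[OF sets0]) measurable
    have z: "H \<theta> 0 = 0" if "\<theta>1 \<le> \<theta>" "\<theta> \<le> \<theta>2" for \<theta>
    proof -
      have "\<theta>2 - \<theta>1 < 2 * pi" using short[of 0] t by simp
      then have "0 \<le> sin ((\<theta> - \<theta>1) / 2)" "sin ((\<theta>2 - \<theta>) / 2) \<ge> 0"
        using that by (auto intro!: sin_ge_zero)
      moreover have "sin ((\<theta> - \<theta>2) / 2) = - sin ((\<theta>2 - \<theta>) / 2)"
        by (rule sin_half_diff)
      ultimately have "S \<theta> 0 \<le> 0" by (simp add: S_def x1_def x2_def mult_nonneg_nonpos)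
      then have "pos2 (S \<theta> 0) = 0" by simp
      then show ?thesis by (simp add: H_def)
    qed
    show "AE x in \<mu>0. 1 * H (fst x) 0 = 0"
      using init by eventually_elim (simp add: z)
  qed simp
  then have "(LINT x|\<mu> t. H (fst x) t) \<le> 0"
  proof -
    have "(LINT x|\<mu> t. 1 * H (fst x) t) - (LINT x|\<mu>0. 1 * H (fst x) 0) \<le> 0"
    proof (rule has_integral_le[OF int has_integral_0])
      fix s assume s: "s \<in> {0..t}"
      show "(LINT x|\<mu> s. 1 * (Hs (fst x) s + (snd x + drift (fst x) s) * H\<theta> (fst x) s)) \<le> 0"
        using s by (intro integral_nonpos_AE eventually_mono[OF range[of s]]) (auto intro!: key)
    qed
    then show ?thesis using \<open>(LINT x|\<mu>0. 1 * H (fst x) 0) = (LINT x|\<mu>0. 0)\<close> by simp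
  qed
  moreover have Hn: "0 \<le> H \<theta> s" for \<theta> s by (simp add: H_def)
  moreover have i: "integrable (\<mu> t) (\<lambda>x. H (fst x) t)"
  proof (rule integrable_bounded[OF t])
    have "continuous_on UNIV (\<lambda>\<theta>. H \<theta> t)"
      unfolding H_def S_def by (intro continuous_intros) auto
    then have [measurable]: "(\<lambda>\<theta>. H \<theta> t) \<in> borel_measurable borel" by (rule borel_measurable_continuous_onI)
    show "(\<lambda>x. H (fst x) t) \<in> borel_measurable (borel \<Otimes>\<^sub>M borel)" by measurable
    have "\<bar>H \<theta> t\<bar> \<le> exp (- L * t)" for \<theta>
    proof -
      have "\<bar>S \<theta> t\<bar> \<le> 1 * 1" unfolding S_def abs_mult by (intro mult_mono) auto
      then have "(max 0 (S \<theta> t))\<^sup>2 \<le> 1\<^sup>2" by (intro power_mono) auto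
      then show ?thesis by (simp add: H_def pos2_def)
    qed
    then show "AE x in \<mu> t. \<bar>H (fst x) t\<bar> \<le> exp (- L * t)" by simp
  qed
  moreover have "0 \<le> (LINT x|\<mu> t. H (fst x) t)"
    by (rule Bochner_Integration.integral_nonneg) (simp add: Hn)
  ultimately have "AE x in \<mu> t. H (fst x) t = 0"
    using integral_nonneg_eq_0_iff_AE[OF i] by simp
  then show ?thesis by eventually_elim (simp add: H_def S_def x1_def x2_def)
qed

text \<open>On the circle cut open at \<open>0\<close>, an arc that does not meet the cut is an interval.\<close>

lemma confinement:
  assumes "\<theta>1 < \<theta>2" "AE x in \<mu>0. \<theta>1 \<le> fst x \<and> fst x \<le> \<theta>2" "t \<ge> 0" "a \<le> b"
    and "\<And>s. 0 \<le> s \<Longrightarrow> s \<le> t \<Longrightarrow> curve \<theta>2 b s - curve \<theta>1 a s < 2 * pi"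
    and "0 \<le> curve \<theta>1 a t" "curve \<theta>2 b t < 2 * pi"
  shows "AE x in \<mu> t. curve \<theta>1 a t \<le> fst x \<and> fst x \<le> curve \<theta>2 b t"
  using confinement_circle[OF assms(1-3) assms(5) assms(4), simplified] AE_phase[OF assms(3)]
proof eventually_elim
  case (elim x)
  have 12: "curve \<theta>1 a t < curve \<theta>2 b t" using curve_strict_mono assms by blast
  show ?case
  proof (rule ccontr)
    assume "\<not> (curve \<theta>1 a t \<le> fst x \<and> fst x \<le> curve \<theta>2 b t)"
    then consider "fst x < curve \<theta>1 a t" | "curve \<theta>2 b t < fst x" by linarith
    then show False
    proof cases
      case 1
      have "0 < sin ((curve \<theta>1 a t - fst x) / 2)" "0 < sin ((curve \<theta>2 b t - fst x) / 2)"
        using 1 12 elim assms(6,7) by (auto intro!: sin_gt_zero)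
      then have "0 < sin ((curve \<theta>1 a t - fst x) / 2) * sin ((curve \<theta>2 b t - fst x) / 2)" by simp
      also have "\<dots> = sin ((fst x - curve \<theta>1 a t) / 2) * sin ((fst x - curve \<theta>2 b t) / 2)"
        unfolding sin_half_diff[of "curve \<theta>1 a t"] sin_half_diff[of "curve \<theta>2 b t"] by simp
      finally show False using elim by simp
    next
      case 2
      have "0 < sin ((fst x - curve \<theta>1 a t) / 2)" "0 < sin ((fst x - curve \<theta>2 b t) / 2)"
        using 2 12 elim assms(6,7) by (auto intro!: sin_gt_zero)
      from mult_pos_pos[OF this] show False using elim by simp
    qed
  qed
qed

end

subsection \<open>A periodic function that is the identity away from the cut\<close>

definition wrap_denom :: "real \<Rightarrow> real \<Rightarrow> real" where
  "wrap_denom w0 w = w + pos2 (w0 - w) / (2 * w0)"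

lemma wrap_denom_pos: assumes "w0 > 0" shows "wrap_denom w0 w > 0"
proof (cases "w \<ge> w0")
  case True
  then have "pos2 (w0 - w) = 0" by simp
  then show ?thesis using assms True by (simp add: wrap_denom_def del: pos2_eq_0)
next
  case False
  then have "wrap_denom w0 w = (w0\<^sup>2 + w\<^sup>2) / (2 * w0)"
    using assms by (simp add: wrap_denom_def pos2_pos power2_eq_square field_simps)
  also have "\<dots> > 0" using assms by (intro divide_pos_pos add_pos_nonneg) auto
  finally show ?thesis .
qed

lemma wrap_denom_eq: "w0 \<le> w \<Longrightarrow> wrap_denom w0 w = w"
proof -
  assume "w0 \<le> w"
  then have "pos2 (w0 - w) = 0" by simp
  then show ?thesis by (simp add: wrap_denom_def del: pos2_eq_0)
qed

text \<open>Half-angle formula: \<open>2 arctan (sin y / (1 + cos y)) = y\<close> on \<open>(- \<pi>, \<pi>)\<close>. Replacing the denominator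
  by a positive function that agrees with it on \<open>[- r, r]\<close> makes the left-hand side continuously
  differentiable on the whole line; it stays \<open>2\<pi>\<close>-periodic.\<close>

definition wrap :: "real \<Rightarrow> real \<Rightarrow> real" where
  "wrap r \<theta> = pi + 2 * arctan (sin (\<theta> - pi) / wrap_denom (1 + cos r) (1 + cos (\<theta> - pi)))"

definition wrap' :: "real \<Rightarrow> real \<Rightarrow> real" where
  "wrap' r \<theta> = (let d = wrap_denom (1 + cos r) (1 + cos (\<theta> - pi));
      d' = - sin (\<theta> - pi) * (1 - max 0 (cos r - cos (\<theta> - pi)) / (1 + cos r))
    in 2 * ((cos (\<theta> - pi) * d - sin (\<theta> - pi) * d') / (d * d)) / (1 + (sin (\<theta> - pi) / d)\<^sup>2))"

context
  fixes r :: real assumes r: "0 < r" "r < pi"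
begin

lemma one_plus_cos_pos: "1 + cos r > 0"
  using cos_monotone_0_pi[of r pi] r by simp

lemma DERIV_wrap: "(wrap r has_real_derivative wrap' r \<theta>) (at \<theta>)"
proof -
  define d where "d \<theta> = wrap_denom (1 + cos r) (1 + cos (\<theta> - pi))" for \<theta>
  have d: "d \<theta> \<noteq> 0" using wrap_denom_pos[OF one_plus_cos_pos] by (simp add: d_def less_imp_neq[symmetric])
  have dd: "(d has_real_derivative - sin (\<theta> - pi) * (1 - max 0 (cos r - cos (\<theta> - pi)) / (1 + cos r))) (at \<theta>)"
  proof -
    define W where "W = 1 + cos r"
    have "((\<lambda>w. w + pos2 (W - w) / (2 * W)) has_real_derivative 1 + (2 * max 0 (W - w) * (0 - 1)) / (2 * W)) (at w)" for w
      by (intro DERIV_add DERIV_ident DERIV_cdivide DERIV_pos2_chain DERIV_diff DERIV_const)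
    then have 1: "(wrap_denom W has_real_derivative 1 - max 0 (W - w) / W) (at w)" for w
      by (simp add: wrap_denom_def[abs_def])
    have 2: "((\<lambda>\<theta>. 1 + cos (\<theta> - pi)) has_real_derivative - sin (\<theta> - pi)) (at \<theta>)"
      by (auto intro!: derivative_eq_intros)
    have "(d has_real_derivative (1 - max 0 (W - (1 + cos (\<theta> - pi))) / W) * (- sin (\<theta> - pi))) (at \<theta>)"
      unfolding d_def W_def[symmetric] by (rule DERIV_chain2[OF 1 2])
    then show ?thesis by (simp add: W_def mult.commute)
  qed
  have ds: "((\<lambda>\<theta>. sin (\<theta> - pi)) has_real_derivative cos (\<theta> - pi)) (at \<theta>)"
    by (auto intro!: derivative_eq_intros)
  have "((\<lambda>\<theta>. pi + 2 * arctan (sin (\<theta> - pi) / d \<theta>)) has_real_derivative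
     0 + 2 * (inverse (1 + (sin (\<theta> - pi) / d \<theta>)\<^sup>2) * ((cos (\<theta> - pi) * d \<theta> -
       sin (\<theta> - pi) * (- sin (\<theta> - pi) * (1 - max 0 (cos r - cos (\<theta> - pi)) / (1 + cos r)))) / (d \<theta> * d \<theta>)))) (at \<theta>)"
    by (intro DERIV_add DERIV_const DERIV_cmult DERIV_chain2[OF DERIV_arctan] DERIV_divide ds dd d)
  moreover have "(\<lambda>\<theta>. pi + 2 * arctan (sin (\<theta> - pi) / d \<theta>)) = wrap r"
    by (simp add: wrap_def[abs_def] d_def)
  ultimately show ?thesis
    by (simp only: wrap'_def Let_def d_def divide_inverse mult.assoc mult.commute mult.left_commute add_0)
qed

lemma continuous_wrap: "continuous_on S (wrap r)"
  by (meson DERIV_isCont DERIV_wrap continuous_at_imp_continuous_on)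

lemma continuous_wrap': "continuous_on S (wrap' r)"
proof -
  have d: "wrap_denom (1 + cos r) z \<noteq> 0" for z
    using wrap_denom_pos[OF one_plus_cos_pos, of z] by simp
  have e: "1 + x\<^sup>2 \<noteq> 0" for x :: real
    using add_pos_nonneg[of 1 "x\<^sup>2"] by simp
  have "continuous_on S (\<lambda>\<theta>. wrap_denom (1 + cos r) (1 + cos (\<theta> - pi)))"
    unfolding wrap_denom_def using one_plus_cos_pos by (intro continuous_intros) auto
  then show ?thesis
    unfolding wrap'_def[abs_def] Let_def using one_plus_cos_pos
    by (intro continuous_intros) (auto simp: d e)
qed

lemma wrap_periodic: "wrap r (\<theta> + 2 * pi) = wrap r \<theta>"
proof -
  have "\<theta> + 2 * pi - pi = (\<theta> - pi) + 2 * pi" by simp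
  then show ?thesis unfolding wrap_def by (simp only: sin_periodic cos_periodic)
qed

lemma wrap_eq: assumes "\<bar>\<theta> - pi\<bar> \<le> r" shows "wrap r \<theta> = \<theta>"
proof -
  define y where "y = \<theta> - pi"
  have "cos r \<le> cos \<bar>y\<bar>" using assms r by (intro cos_monotone_0_pi_le) (auto simp: y_def)
  then have "cos r \<le> cos y" by (simp add: abs_if split: if_splits)
  then have "wrap_denom (1 + cos r) (1 + cos y) = 1 + cos y" by (simp add: wrap_denom_eq)
  then have "wrap r \<theta> = pi + 2 * arctan (sin y / (1 + cos y))" by (simp add: wrap_def y_def)
  also have "sin y / (1 + cos y) = tan (y / 2)" using tan_half[of "y/2"] by (simp add: add.commute)
  also have "arctan (tan (y / 2)) = y / 2"
    using assms r by (intro arctan_tan) (auto simp: y_def abs_le_iff)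
  finally show ?thesis by (simp add: y_def field_simps)
qed

lemma wrap'_eq: assumes "\<bar>\<theta> - pi\<bar> < r" shows "wrap' r \<theta> = 1"
proof -
  have "((\<lambda>\<theta>. \<theta>) has_real_derivative wrap' r \<theta>) (at \<theta>)"
    by (rule has_field_derivative_transform_within_open[OF DERIV_wrap, where S="{pi - r<..<pi + r}"])
      (use assms in \<open>auto intro!: wrap_eq\<close>)
  then show ?thesis using DERIV_unique DERIV_ident by blast
qed

end

context kuramoto_solution
begin

lemma mean_frequency: assumes t: "t \<ge> 0" shows "(LINT x|\<mu> t. snd x) = 0"
proof -
  have "(LINT x|\<mu> t. snd x) = (LINT w|distr (\<mu> t) borel snd. w)"
    by (rule integral_distr[OF measurable_snd[OF t], symmetric]) simp
  also have "\<dots> = (LINT w|density lborel (\<lambda>w. ennreal (g w)). w)" by (simp add: marginal[OF t])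
  also have "\<dots> = (LINT w|lborel. g w *\<^sub>R w)"
    using frequency_density by (intro integral_density) (auto simp: frequency_density_def)
  also have "\<dots> = 0" using frequency_density by (simp add: frequency_density_def mult.commute)
  finally show ?thesis .
qed

lemma integrable_snd: assumes t: "t \<ge> 0" shows "integrable (\<mu> t) snd"
  by (rule integrable_bounded[OF t _ eventually_mono[OF range[OF t]], of _ "max \<bar>a\<bar> \<bar>b\<bar>"]) auto

text \<open>The interaction is odd, so its double integral vanishes, and the mean frequency is zero.\<close>

lemma mean_drift: assumes t: "t \<ge> 0" shows "(LINT x|\<mu> t. snd x + drift (fst x) t) = 0"
proof -
  have "(LINT x|\<mu> t. snd x + drift (fst x) t) = (LINT x|\<mu> t. snd x) +
     (- cos_moment t * (LINT x|\<mu> t. sin (fst x)) + sin_moment t * (LINT x|\<mu> t. cos (fst x)))"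
    unfolding drift_def using integrable_snd[OF t] integrable_sin_cos[OF t] by simp
  also have "\<dots> = 0" using t by (simp add: mean_frequency cos_moment_def sin_moment_def max_absorb2)
  finally show ?thesis .
qed

text \<open>The phase \<open>\<theta>\<close> is not a periodic function and hence no admissible test function. As long as the measure stays
  away from the cut, it may be replaced by \<open>wrap r\<close>, whose derivative is \<open>1\<close> on the support.\<close>

lemma mean_conserved:
  assumes t: "t \<ge> 0" and r: "0 < r" "r < pi"
    and init: "AE x in \<mu>0. \<bar>fst x - pi\<bar> < r"
    and conf: "\<And>s. 0 \<le> s \<Longrightarrow> s \<le> t \<Longrightarrow> AE x in \<mu> s. \<bar>fst x - pi\<bar> < r"
  shows "(LINT x|\<mu> t. fst x) = (LINT x|\<mu>0. fst x)"
proof -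
  have [measurable]: "wrap r \<in> borel_measurable borel" "wrap' r \<in> borel_measurable borel"
    using r by (auto intro: borel_measurable_continuous_onI continuous_wrap continuous_wrap')
  have [measurable]: "(\<lambda>\<theta>. drift \<theta> s) \<in> borel_measurable borel" for s
    by (intro borel_measurable_continuous_onI continuous_intros)
  have int: "((\<lambda>s. LINT x|\<mu> s. 1 * (0 + (snd x + drift (fst x) s) * wrap' r (fst x)))
    has_integral (LINT x|\<mu> t. 1 * wrap r (fst x)) - (LINT x|\<mu>0. 1 * wrap r (fst x))) {0..t}"
  proof (rule weak_form[where \<psi>="\<lambda>_. 1" and \<psi>'="\<lambda>_. 0" and H="\<lambda>\<theta> s. wrap r \<theta>"
        and H\<theta>="\<lambda>\<theta> s. wrap' r \<theta>" and Hs="\<lambda>_ _. 0", OF _ _ _ _ _ _ t])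
    show "((\<lambda>p. wrap r (fst p)) has_derivative (\<lambda>v. wrap' r \<theta> * fst v + 0 * snd v)) (at (\<theta>, s))" for \<theta> s :: real
      by (rule has_derivative_eq_rhs[OF DERIV_compose_FDERIV[where g=fst, OF _ has_derivative_fst[OF has_derivative_ident]]])
        (auto simp: DERIV_wrap[OF r])
    show "continuous_on UNIV (\<lambda>p :: real \<times> real. wrap' r (fst p))"
      by (rule continuous_on_compose2[OF continuous_wrap'[OF r, of UNIV]]) (auto intro!: continuous_intros)
  qed (auto simp: wrap_periodic[OF r])
  have "(LINT x|\<mu> s. 1 * (0 + (snd x + drift (fst x) s) * wrap' r (fst x))) = 0" if s: "s \<in> {0..t}" for s
  proof -
    have s0: "s \<ge> 0" using s by simp
    have "(LINT x|\<mu> s. 1 * (0 + (snd x + drift (fst x) s) * wrap' r (fst x))) = (LINT x|\<mu> s. snd x + drift (fst x) s)"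
      by (intro integral_cong_AE borel_measurable_phase[OF sets[OF s0]] eventually_mono[OF conf[of s]])
        (use s in \<open>auto simp: wrap'_eq[OF r]\<close>)
    then show ?thesis using mean_drift[OF s0] by simp
  qed
  then have "((\<lambda>s. LINT x|\<mu> s. 1 * (0 + (snd x + drift (fst x) s) * wrap' r (fst x))) has_integral 0) {0..t}"
    by (intro has_integral_is_0) auto
  from has_integral_unique[OF int this]
  have "(LINT x|\<mu> t. wrap r (fst x)) = (LINT x|\<mu>0. wrap r (fst x))" by simp
  moreover have "(LINT x|\<mu> t. wrap r (fst x)) = (LINT x|\<mu> t. fst x)"
    by (intro integral_cong_AE borel_measurable_phase[OF sets[OF t]] eventually_mono[OF conf[of t]])
      (use t in \<open>auto simp: wrap_eq[OF r]\<close>)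
  moreover have "(LINT x|\<mu>0. wrap r (fst x)) = (LINT x|\<mu>0. fst x)"
    by (intro integral_cong_AE borel_measurable_phase[OF sets0] eventually_mono[OF init])
      (auto simp: wrap_eq[OF r])
  ultimately show ?thesis by simp
qed

lemma mean_bounds:
  assumes t: "t \<ge> 0" and "AE x in \<mu> t. l \<le> fst x \<and> fst x \<le> u"
  shows "l \<le> (LINT x|\<mu> t. fst x)" "(LINT x|\<mu> t. fst x) \<le> u"
proof -
  interpret prob_space "\<mu> t" by (rule prob[OF t])
  have i: "integrable (\<mu> t) fst"
    by (rule integrable_bounded[OF t _ eventually_mono[OF assms(2)], of _ "max \<bar>l\<bar> \<bar>u\<bar>"]) auto
  show "l \<le> (LINT x|\<mu> t. fst x)"
    by (rule integral_ge_const[OF i eventually_mono[OF assms(2)]]) auto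
  show "(LINT x|\<mu> t. fst x) \<le> u"
    by (rule integral_le_const[OF i eventually_mono[OF assms(2)]]) auto
qed

end

section \<open>Contraction of the arc that carries the phases\<close>

lemma sin_add_ge:
  fixes u v :: real assumes "0 \<le> u" "0 \<le> v" "u + v \<le> pi"
  shows "sin (u + v) \<le> sin u + sin v"
proof -
  have "0 \<le> sin u" "0 \<le> sin v" using assms by (auto intro!: sin_ge_zero)
  then have "sin u * cos v \<le> sin u * 1" using mult_left_mono[OF cos_le_one] by blast
  moreover have "cos u * sin v \<le> 1 * sin v" using \<open>0 \<le> sin v\<close> mult_right_mono[OF cos_le_one] by blast
  ultimately show ?thesis by (simp add: sin_add)
qed

text \<open>The initial phases lie in an arc of length \<open>D\<close>, whose end points are moved along the characteristics of the
  extremal frequencies. It is enlarged beforehand so that \<open>D > \<pi>/2\<close>: then \<open>sin \<ge> sin D\<close> on \<open>[\<pi> - D, D]\<close>, an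
  interval that contains \<open>\<pi>/2\<close> in its interior. The bounds on \<open>\<theta>1\<close> say that \<open>\<pi>\<close> is inside the arc; they keep it
  off the cut at time \<open>0\<close>.\<close>

locale kuramoto_arc = kuramoto_solution +
  fixes \<theta>1 D :: real
  assumes D: "pi / 2 < D" "D < pi"
    and coupling: "b - a < K * sin D"
    and arc0: "AE x in \<mu>0. \<theta>1 \<le> fst x \<and> fst x \<le> \<theta>1 + D"
    and arc_bounds: "pi - D < \<theta>1" "\<theta>1 < pi"
    and mean0: "(LINT x|\<mu>0. fst x) = pi"
begin

lemma ab: "a \<le> b"
proof -
  interpret prob_space \<mu>0 by (rule prob0)
  have "AE x in \<mu>0. a \<le> b" using range0 by eventually_elim auto
  then show ?thesis by simp
qed

definition lower :: "real \<Rightarrow> real" where "lower = curve \<theta>1 a"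
definition upper :: "real \<Rightarrow> real" where "upper = curve (\<theta>1 + D) b"
definition width :: "real \<Rightarrow> real" where "width s = upper s - lower s"

lemma DERIV_width: "(width has_real_derivative curve' (\<theta>1 + D) b s - curve' \<theta>1 a s) (at s)"
  unfolding width_def upper_def lower_def by (intro derivative_intros DERIV_curve)

lemma continuous_arc: "continuous_on S lower" "continuous_on S upper" "continuous_on S width"
  by (auto simp: lower_def upper_def width_def intro!: continuous_intros continuous_curve)

lemma width_pos: "s \<ge> 0 \<Longrightarrow> 0 < width s"
  using curve_strict_mono[of \<theta>1 "\<theta>1 + D" a b s] D ab pi_gt_zero by (simp add: width_def lower_def upper_def)

lemma width_0: "width 0 = D" by (simp add: width_def lower_def upper_def)

text \<open>A particle inside the arc pulls both ends towards itself. By subadditivity of the sine on \<open>[0, \<pi>]\<close> the two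
  pulls add up to at least \<open>sin (width s)\<close>, wherever the particle sits.\<close>

lemma width_derivative_le:
  assumes s: "s \<ge> 0" and in_arc: "AE x in \<mu> s. lower s \<le> fst x \<and> fst x \<le> upper s" and "width s \<le> pi"
  shows "curve' (\<theta>1 + D) b s - curve' \<theta>1 a s \<le> (b - a) - K * sin (width s)"
proof -
  interpret prob_space "\<mu> s" by (rule prob[OF s])
  have i: "integrable (\<mu> s) (\<lambda>x. sin (\<theta> - fst x))" for \<theta>
    by (rule integrable_bounded[OF s, of _ 1]) auto
  have "sin (width s) \<le> (LINT x|\<mu> s. sin (upper s - fst x) - sin (lower s - fst x))"
  proof (rule integral_ge_const)
    show "integrable (\<mu> s) (\<lambda>x. sin (upper s - fst x) - sin (lower s - fst x))" using i by auto
    show "AE x in \<mu> s. sin (width s) \<le> sin (upper s - fst x) - sin (lower s - fst x)"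
      using in_arc
    proof eventually_elim
      case (elim x)
      have "sin (lower s - fst x) = - sin (fst x - lower s)" by (metis minus_diff_eq sin_minus)
      then show ?case
        using sin_add_ge[of "upper s - fst x" "fst x - lower s"] elim assms(3) by (simp add: width_def)
    qed
  qed
  then have "sin (width s) \<le> (LINT x|\<mu> s. sin (upper s - fst x)) - (LINT x|\<mu> s. sin (lower s - fst x))"
    using i by simp
  then have "K * sin (width s) \<le> K * ((LINT x|\<mu> s. sin (upper s - fst x)) - (LINT x|\<mu> s. sin (lower s - fst x)))"
    using K_pos by (intro mult_left_mono) auto
  moreover have "curve' (\<theta>1 + D) b s = b - K * (LINT x|\<mu> s. sin (upper s - fst x))"
    "curve' \<theta>1 a s = a - K * (LINT x|\<mu> s. sin (lower s - fst x))"
    by (simp_all only: curve'_eq[OF s] upper_def lower_def drift_eq[OF s])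
  ultimately show ?thesis by (simp add: algebra_simps)
qed

text \<open>At width \<open>D\<close> the coupling dominates the spread of the frequencies; above \<open>D\<close> the sine can drop by no more than
  the excess width, which Gronwall's lemma tolerates.\<close>

lemma width_le_if_confined:
  assumes t: "t \<ge> 0" and in_arc: "\<And>s. 0 \<le> s \<Longrightarrow> s \<le> t \<Longrightarrow> AE x in \<mu> s. lower s \<le> fst x \<and> fst x \<le> upper s"
    and "\<And>s. 0 \<le> s \<Longrightarrow> s \<le> t \<Longrightarrow> width s \<le> pi"
  shows "width t \<le> D"
proof -
  have "width t - D \<le> 0"
  proof (rule gronwall_nonpos[where L=K and t=t])
    fix s assume s: "0 \<le> s" "s \<le> t"
    show "((\<lambda>s. width s - D) has_real_derivative curve' (\<theta>1 + D) b s - curve' \<theta>1 a s) (at s)"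
      by (auto intro!: derivative_eq_intros DERIV_width)
    assume pos: "0 < width s - D"
    have "sin D - sin (width s) \<le> width s - D"
    proof -
      have "sin D - sin (width s) = 2 * sin ((D - width s) / 2) * cos ((D + width s) / 2)" by (simp add: sin_diff_sin)
      also have "\<dots> \<le> \<bar>2 * sin ((D - width s) / 2) * cos ((D + width s) / 2)\<bar>" by simp
      also have "\<dots> = 2 * (\<bar>sin ((D - width s) / 2)\<bar> * \<bar>cos ((D + width s) / 2)\<bar>)" by (simp add: abs_mult)
      also have "\<dots> \<le> 2 * (\<bar>(D - width s) / 2\<bar> * 1)"
        by (intro mult_left_mono mult_mono abs_sin_x_le_abs_x) auto
      finally show ?thesis using pos by simp
    qed
    then have "K * sin D - K * sin (width s) \<le> K * (width s - D)"
      using K_pos by (simp flip: right_diff_distrib)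
    then show "curve' (\<theta>1 + D) b s - curve' \<theta>1 a s \<le> K * (width s - D)"
      using width_derivative_le[OF s(1) in_arc assms(3)] s coupling by fastforce
  qed (use t in \<open>auto simp: width_0\<close>)
  then show ?thesis by simp
qed

text \<open>A first-exit argument. As long as the moving arc stays inside \<open>(0, 2\<pi>)\<close> and is shorter than \<open>\<pi>\<close>,
  it carries the whole measure, so its width cannot grow beyond \<open>D\<close>; since the mean stays at \<open>\<pi>\<close>, the arc
  contains \<open>\<pi>\<close> and stays at a positive distance from the cut.\<close>

lemma arc_strict:
  assumes t: "t \<ge> 0"
    and "\<And>s. 0 \<le> s \<Longrightarrow> s \<le> t \<Longrightarrow> width s < pi \<and> 0 < lower s \<and> upper s < 2 * pi"
  shows "AE x in \<mu> t. lower t \<le> fst x \<and> fst x \<le> upper t" "width t \<le> D" "pi - D \<le> lower t" "upper t \<le> pi + D"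
proof -
  have in_arc: "AE x in \<mu> s. lower s \<le> fst x \<and> fst x \<le> upper s" if s: "0 \<le> s" "s \<le> t" for s
    unfolding lower_def upper_def
  proof (rule confinement)
    show "\<theta>1 < \<theta>1 + D" using D pi_gt_zero by simp
    show "curve (\<theta>1 + D) b s' - curve \<theta>1 a s' < 2 * pi" if "0 \<le> s'" "s' \<le> s" for s'
      using assms(2)[of s'] that s pi_gt_zero by (auto simp: width_def lower_def upper_def)
    show "0 \<le> curve \<theta>1 a s" "curve (\<theta>1 + D) b s < 2 * pi"
      using assms(2)[OF s] by (auto simp: lower_def upper_def)
  qed (use s ab arc0 in auto)
  show at: "AE x in \<mu> t. lower t \<le> fst x \<and> fst x \<le> upper t" using in_arc t by simp
  show w: "width t \<le> D" by (rule width_le_if_confined[OF t in_arc]) (use assms(2) less_imp_le in auto)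
  obtain m where m: "m \<in> {0..t}" "\<And>s. s \<in> {0..t} \<Longrightarrow> lower m \<le> lower s"
    using continuous_attains_inf[of "{0..t}" lower] t continuous_arc by force
  obtain m' where m': "m' \<in> {0..t}" "\<And>s. s \<in> {0..t} \<Longrightarrow> upper s \<le> upper m'"
    using continuous_attains_sup[of "{0..t}" upper] t continuous_arc by force
  define r where "r = max (pi - lower m) (max (upper m' - pi) 0) / 2 + pi / 2"
  have r: "0 < r" "r < pi" "pi - lower m < r" "upper m' - pi < r"
    using assms(2)[of m] assms(2)[of m'] m m' pi_gt_zero by (auto simp: r_def max_def field_simps)
  have close: "\<bar>x - pi\<bar> < r" if "lower s \<le> x" "x \<le> upper s" "s \<in> {0..t}" for x s
    using that m(2)[of s] m'(2)[of s] r by (auto simp: abs_if)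
  have "(LINT x|\<mu> t. fst x) = (LINT x|\<mu>0. fst x)"
  proof (rule mean_conserved[OF t r(1,2)])
    show "AE x in \<mu>0. \<bar>fst x - pi\<bar> < r"
      using arc0 by eventually_elim (rule close[of 0], auto simp: lower_def upper_def t)
    show "AE x in \<mu> s. \<bar>fst x - pi\<bar> < r" if s: "0 \<le> s" "s \<le> t" for s
      using in_arc[OF s] by eventually_elim (rule close[of s], use s in auto)
  qed
  then have mean: "(LINT x|\<mu> t. fst x) = pi" by (simp add: mean0)
  have "lower t \<le> pi" "pi \<le> upper t" using mean_bounds[OF t at] by (auto simp: mean)
  then show "pi - D \<le> lower t" "upper t \<le> pi + D" using w by (auto simp: width_def)
qed

lemma arc_inside:
  assumes "t \<ge> 0"
  shows "width t < pi \<and> 0 < lower t \<and> upper t < 2 * pi"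
proof (rule ccontr)
  assume neg: "\<not> ?thesis"
  \<comment> \<open>Strictly between \<open>D\<close> and \<open>\<pi>\<close>: up to and including the first exit time the arc satisfies the weak
    inequalities with \<open>E\<close>, hence the hypotheses of \<open>arc_strict\<close>, whose conclusion contradicts the exit.\<close>
  define E where "E = (D + pi) / 2"
  have E: "D < E" "E < pi" using D by (auto simp: E_def)
  define Good where "Good s \<longleftrightarrow> width s < E \<and> pi - E < lower s \<and> upper s < pi + E" for s
  define Bad where "Bad = {0..} \<inter> ({s. E \<le> width s} \<union> {s. lower s \<le> pi - E} \<union> {s. pi + E \<le> upper s})"
  have Bad: "s \<in> Bad \<longleftrightarrow> 0 \<le> s \<and> \<not> Good s" for s by (auto simp: Bad_def Good_def)
  have "\<not> Good t" using neg E by (auto simp: Good_def)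
  then have ne: "t \<in> Bad" using Bad assms by simp
  have cl: "closed Bad"
    unfolding Bad_def
    by (intro closed_Int closed_Un closed_Collect_le closed_atLeast continuous_on_const continuous_arc)
  define m where "m = Inf Bad"
  have bdd: "bdd_below Bad" by (rule bdd_belowI[of _ 0]) (simp add: Bad)
  have mB: "m \<in> Bad" unfolding m_def using ne closed_contains_Inf[OF _ bdd cl] by auto
  then have m0: "0 \<le> m" by (simp add: Bad)
  have good: "Good s" if "0 \<le> s" "s < m" for s
    using cInf_lower[OF _ bdd, of s] that unfolding m_def[symmetric] Bad by fastforce
  have "Good 0" using E D arc_bounds by (auto simp: Good_def width_0 lower_def upper_def)
  then have "m > 0" using mB m0 Bad by (metis less_eq_real_def)
  then have clos: "closure {0..<m} = {0..m}" by simp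
  have cle: "F s \<le> G" if "continuous_on UNIV F" "\<And>s. s \<in> {0..<m} \<Longrightarrow> F s \<le> G" "s \<in> {0..m}" for F :: "real \<Rightarrow> real" and G s
  proof (rule continuous_le_on_closure[of "{0..<m}" F s G])
    show "continuous_on (closure {0..<m}) F" by (rule continuous_on_subset[OF that(1) subset_UNIV])
    show "s \<in> closure {0..<m}" using that(3) by (simp only: clos)
  qed (rule that(2))
  have w: "width s \<le> E" if "s \<in> {0..m}" for s
    by (rule cle[OF continuous_arc(3) _ that]) (use good in \<open>simp add: Good_def less_imp_le\<close>)
  have u: "upper s \<le> pi + E" if "s \<in> {0..m}" for s
    by (rule cle[OF continuous_arc(2) _ that]) (use good in \<open>simp add: Good_def less_imp_le\<close>)
  have l: "pi - E \<le> lower s" if "s \<in> {0..m}" for s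
  proof -
    have "- lower s \<le> - (pi - E)"
      by (rule cle[OF continuous_on_minus[OF continuous_arc(1)] _ that])
        (use good in \<open>force simp: Good_def\<close>)
    then show ?thesis by simp
  qed
  have "width s < pi \<and> 0 < lower s \<and> upper s < 2 * pi" if "0 \<le> s" "s \<le> m" for s
    using w[of s] u[of s] l[of s] E that by simp
  from arc_strict[OF m0 this] have "Good m" using E by (auto simp: Good_def)
  then show False using mB by (simp add: Bad)
qed

lemma
  assumes t: "t \<ge> 0"
  shows in_arc: "AE x in \<mu> t. lower t \<le> fst x \<and> fst x \<le> upper t"
    and width_le: "width t \<le> D" and lower_ge: "pi - D \<le> lower t" and upper_le: "upper t \<le> pi + D"
proof -
  have inside: "width s < pi \<and> 0 < lower s \<and> upper s < 2 * pi" if "0 \<le> s" "s \<le> t" for s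
    using arc_inside that by simp
  show "AE x in \<mu> t. lower t \<le> fst x \<and> fst x \<le> upper t" "width t \<le> D" "pi - D \<le> lower t" "upper t \<le> pi + D"
    by (rule arc_strict(1)[OF t] arc_strict(2)[OF t] arc_strict(3)[OF t] arc_strict(4)[OF t], rule inside; assumption)+
qed

lemma mean: assumes t: "t \<ge> 0" shows "(LINT x|\<mu> t. fst x) = pi"
proof -
  have r: "0 < (D + pi) / 2" "(D + pi) / 2 < pi" using D pi_gt_zero by auto
  have close: "\<bar>x - pi\<bar> < (D + pi) / 2" if "lower s \<le> x" "x \<le> upper s" "s \<ge> 0" for x s
    using that lower_ge[of s] upper_le[of s] D by (auto simp: abs_if)
  have "(LINT x|\<mu> t. fst x) = (LINT x|\<mu>0. fst x)"
  proof (rule mean_conserved[OF t r])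
    show "AE x in \<mu>0. \<bar>fst x - pi\<bar> < (D + pi) / 2"
      using arc0 by eventually_elim (rule close[of 0], auto simp: lower_def upper_def)
    show "AE x in \<mu> s. \<bar>fst x - pi\<bar> < (D + pi) / 2" if s: "0 \<le> s" "s \<le> t" for s
      using in_arc[OF s(1)] by eventually_elim (rule close[of s], use s in auto)
  qed
  then show ?thesis by (simp add: mean0)
qed

text \<open>While the width lies in \<open>[\<pi> - D, D]\<close> its sine is at least \<open>sin D\<close>, so it decreases at a definite
  rate; the bound below is a convenient consequence.\<close>

lemma width_decay:
  assumes t: "t \<ge> 0"
  shows "width t \<le> (pi - D) + D * exp (- ((K * sin D - (b - a)) / D) * t)"
proof -
  define c where "c = K * sin D - (b - a)"
  have c: "c > 0" using coupling by (simp add: c_def)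
  have D0: "D > 0" using D pi_gt_zero by simp
  have "width t - (pi - D) - D * exp (- (c / D) * t) \<le> 0"
  proof (rule gronwall_nonpos[where L=0 and t=t])
    fix s assume s: "0 \<le> s" "s \<le> t"
    show "((\<lambda>s. width s - (pi - D) - D * exp (- (c / D) * s)) has_real_derivative
      (curve' (\<theta>1 + D) b s - curve' \<theta>1 a s) + c * exp (- (c / D) * s)) (at s)"
      using D0 by (auto intro!: derivative_eq_intros DERIV_width)
    assume "0 < width s - (pi - D) - D * exp (- (c / D) * s)"
    then have "pi - D \<le> width s" using D0 by (smt (verit) exp_gt_zero mult_pos_pos)
    moreover have wD: "width s \<le> D" by (rule width_le[OF s(1)])
    ultimately have "sin D \<le> sin (width s)"
    proof (cases "width s \<le> pi / 2")
      case True
      then have "sin (pi - D) \<le> sin (width s)"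
        using \<open>pi - D \<le> width s\<close> D by (intro sin_monotone_2pi_le) auto
      then show ?thesis by simp
    next
      case False
      then have "sin (pi - D) \<le> sin (pi - width s)"
        using wD D by (intro sin_monotone_2pi_le) auto
      then show ?thesis by simp
    qed
    then have "K * sin D \<le> K * sin (width s)" using K_pos by simp
    moreover have "c * exp (- (c / D) * s) \<le> c * 1" using c D0 s by (intro mult_left_mono) auto
    ultimately show "curve' (\<theta>1 + D) b s - curve' \<theta>1 a s + c * exp (- (c / D) * s)
      \<le> 0 * (width s - (pi - D) - D * exp (- (c / D) * s))"
      using width_derivative_le[OF s(1) in_arc[OF s(1)]] arc_inside[OF s(1)] by (simp add: c_def)
  qed (use t D in \<open>auto simp: width_0\<close>)
  then show ?thesis by (simp add: c_def)
qed

end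

section \<open>Transport of mass along the characteristics\<close>

context kuramoto_arc
begin

lemma near_pi:
  assumes "t \<ge> 0" shows "AE x in \<mu> t. \<bar>fst x - pi\<bar> < (D + pi) / 2"
  using in_arc[OF assms]
proof eventually_elim
  case (elim x)
  then show ?case using lower_ge[OF assms] upper_le[OF assms] D by (auto simp: abs_if)
qed

lemma near_pi0: "AE x in \<mu>0. \<bar>fst x - pi\<bar> < (D + pi) / 2"
  using arc0
proof eventually_elim
  case (elim x)
  then show ?case using lower_ge[of 0] upper_le[of 0] D by (auto simp: abs_if lower_def upper_def)
qed

text \<open>The mass on one side of a characteristic cannot decrease, provided its frequency is extremal for the
  frequencies considered. Take \<open>\<sigma> = 1\<close>: the test function is an increasing function of
  \<open>exp (2 K s) (\<theta> - x s)\<close>, and by the Lipschitz bound of the drift the distance of a faster particle to the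
  characteristic shrinks at most at the rate \<open>2 K\<close>. The case \<open>\<sigma> = -1\<close> is its mirror image.\<close>

lemma transport_smooth:
  assumes t: "t \<ge> 0" and \<sigma>: "\<sigma> = 1 \<or> \<sigma> = (-1 :: real)" and n: "n \<ge> 0"
    and freq: "\<And>w. p < w \<Longrightarrow> w < q \<Longrightarrow> 0 \<le> \<sigma> * (w - f)" and pq: "p < q"
  defines "r \<equiv> (D + pi) / 2"
  shows "(LINT x|\<mu>0. bump n ((snd x - p) * (q - snd x)) * bump n (\<sigma> * (wrap r (fst x) - \<theta>0)))
     \<le> (LINT x|\<mu> t. bump n ((snd x - p) * (q - snd x)) * bump n (\<sigma> * exp (2 * K * t) * (wrap r (fst x) - curve \<theta>0 f t)))"
proof -
  have r: "0 < r" "r < pi" using D pi_gt_zero by (auto simp: r_def)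
  define X where "X = curve \<theta>0 f"
  define X' where "X' = curve' \<theta>0 f"
  define \<psi> where "\<psi> w = bump n ((w - p) * (q - w))" for w
  define Y where "Y \<theta> s = \<sigma> * exp (2 * K * s) * (wrap r \<theta> - X s)" for \<theta> s
  define Y\<theta> where "Y\<theta> \<theta> s = \<sigma> * exp (2 * K * s) * wrap' r \<theta>" for \<theta> s
  define Ys where "Ys \<theta> s = \<sigma> * exp (2 * K * s) * (2 * K * (wrap r \<theta> - X s) - X' s)" for \<theta> s
  define H where "H \<theta> s = bump n (Y \<theta> s)" for \<theta> s
  define H\<theta> where "H\<theta> \<theta> s = bump' n (Y \<theta> s) * Y\<theta> \<theta> s" for \<theta> s
  define Hs where "Hs \<theta> s = bump' n (Y \<theta> s) * Ys \<theta> s" for \<theta> s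
  have cX: "continuous_on UNIV (\<lambda>p :: real \<times> real. X (snd p))" "continuous_on UNIV (\<lambda>p :: real \<times> real. X' (snd p))"
    unfolding X_def X'_def
    by (rule continuous_on_compose2[OF continuous_curve[of UNIV]] continuous_on_compose2[OF continuous_curve'[of UNIV]];
        auto intro!: continuous_intros)+
  have cW: "continuous_on UNIV (\<lambda>p :: real \<times> real. wrap r (fst p))" "continuous_on UNIV (\<lambda>p :: real \<times> real. wrap' r (fst p))"
    by (rule continuous_on_compose2[OF continuous_wrap[OF r, of UNIV]] continuous_on_compose2[OF continuous_wrap'[OF r, of UNIV]];
        auto intro!: continuous_intros)+
  have cY: "continuous_on UNIV (\<lambda>p. Y (fst p) (snd p))" "continuous_on UNIV (\<lambda>p. Y\<theta> (fst p) (snd p))"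
    "continuous_on UNIV (\<lambda>p. Ys (fst p) (snd p))"
    unfolding Y_def Y\<theta>_def Ys_def by (intro continuous_intros cX cW)+
  have cB: "continuous_on UNIV (\<lambda>p. bump' n (Y (fst p) (snd p)))"
    by (rule continuous_on_compose2[OF continuous_bump'[OF n, of UNIV] cY(1)]) auto
  have dY: "((\<lambda>p. Y (fst p) (snd p)) has_derivative (\<lambda>v. Y\<theta> \<theta> s * fst v + Ys \<theta> s * snd v)) (at (\<theta>, s))" for \<theta> s
  proof -
    have dX: "((\<lambda>p :: real \<times> real. X (snd p)) has_derivative (\<lambda>v. snd v * X' s)) (at (\<theta>, s))"
      unfolding X_def X'_def by (rule has_derivative_curve_snd)
    have dW: "((\<lambda>p :: real \<times> real. wrap r (fst p)) has_derivative (\<lambda>v. fst v * wrap' r \<theta>)) (at (\<theta>, s))"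
      by (rule DERIV_compose_FDERIV[where g=fst, OF _ has_derivative_fst[OF has_derivative_ident], simplified])
        (simp add: DERIV_wrap[OF r])
    have dE: "((\<lambda>p :: real \<times> real. \<sigma> * exp (2 * K * snd p)) has_derivative (\<lambda>v. snd v * (\<sigma> * (exp (2 * K * s) * (2 * K))))) (at (\<theta>, s))"
      by (rule DERIV_compose_FDERIV[where g=snd, OF _ has_derivative_snd[OF has_derivative_ident], simplified])
        (auto intro!: derivative_eq_intros)
    show ?thesis
      unfolding Y_def
      by (rule has_derivative_eq_rhs[OF has_derivative_mult[OF dE has_derivative_diff[OF dW dX]]])
        (simp add: Y\<theta>_def Ys_def algebra_simps)
  qed
  have dH: "((\<lambda>p. H (fst p) (snd p)) has_derivative (\<lambda>v. H\<theta> \<theta> s * fst v + Hs \<theta> s * snd v)) (at (\<theta>, s))" for \<theta> s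
    unfolding H_def
    by (rule has_derivative_eq_rhs[OF DERIV_compose_FDERIV[OF DERIV_bump[OF n] dY]])
      (simp add: H\<theta>_def Hs_def algebra_simps)
  have int: "((\<lambda>s. LINT x|\<mu> s. \<psi> (snd x) * (Hs (fst x) s + (snd x + drift (fst x) s) * H\<theta> (fst x) s))
    has_integral (LINT x|\<mu> t. \<psi> (snd x) * H (fst x) t) - (LINT x|\<mu>0. \<psi> (snd x) * H (fst x) 0)) {0..t}"
  proof (rule weak_form[where \<psi>'="\<lambda>w. bump' n ((w - p) * (q - w)) * (p + q - 2 * w)", OF _ _ dH _ _ _ t])
    show "(\<psi> has_real_derivative bump' n ((w - p) * (q - w)) * (p + q - 2 * w)) (at w)" for w
      unfolding \<psi>_def by (rule DERIV_chain2[OF DERIV_bump[OF n]]) (auto intro!: derivative_eq_intros)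
    show "continuous_on UNIV (\<lambda>w. bump' n ((w - p) * (q - w)) * (p + q - 2 * w))"
      by (intro continuous_on_mult continuous_on_compose2[OF continuous_bump'[OF n, of UNIV]] continuous_intros) auto
    show "continuous_on UNIV (\<lambda>p. H\<theta> (fst p) (snd p))" "continuous_on UNIV (\<lambda>p. Hs (fst p) (snd p))"
      unfolding H\<theta>_def Hs_def by (intro continuous_on_mult cB cY)+
    show "H (\<theta> + 2 * pi) s = H \<theta> s" for \<theta> s by (simp add: H_def Y_def wrap_periodic[OF r])
  qed
  have key: "0 \<le> \<psi> w * (Hs \<theta> s + (w + drift \<theta> s) * H\<theta> \<theta> s)" if s: "s \<ge> 0" and \<theta>: "\<bar>\<theta> - pi\<bar> < r" for s \<theta> w
  proof (cases "p < w \<and> w < q \<and> 0 < \<sigma> * (\<theta> - X s)")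
    case True
    have "\<bar>drift \<theta> s - drift (X s) s\<bar> \<le> 2 * K * \<bar>\<theta> - X s\<bar>" by (rule drift_lipschitz)
    also have "\<bar>\<theta> - X s\<bar> = \<sigma> * (\<theta> - X s)" using True \<sigma> by auto
    finally have "- (2 * K * (\<sigma> * (\<theta> - X s))) \<le> \<sigma> * (drift \<theta> s - drift (X s) s)"
      using \<sigma> by auto
    moreover have "0 \<le> \<sigma> * (w - f)" using freq True by simp
    ultimately have "0 \<le> \<sigma> * (2 * K * (\<theta> - X s) - (f + drift (X s) s) + (w + drift \<theta> s))"
      by (simp add: algebra_simps)
    moreover have "X' s = f + drift (X s) s" unfolding X'_def X_def by (rule curve'_eq[OF s])
    moreover have "Ys \<theta> s + (w + drift \<theta> s) * Y\<theta> \<theta> s = exp (2 * K * s) * (\<sigma> * (2 * K * (\<theta> - X s) - X' s + (w + drift \<theta> s)))"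
      using \<theta> by (simp add: Ys_def Y\<theta>_def wrap_eq[OF r] wrap'_eq[OF r] algebra_simps)
    ultimately have "0 \<le> Ys \<theta> s + (w + drift \<theta> s) * Y\<theta> \<theta> s" by simp
    then have "0 \<le> bump' n (Y \<theta> s) * (Ys \<theta> s + (w + drift \<theta> s) * Y\<theta> \<theta> s)"
      using bump'_nonneg[OF n] by (intro mult_nonneg_nonneg)
    then have "0 \<le> Hs \<theta> s + (w + drift \<theta> s) * H\<theta> \<theta> s" by (simp add: Hs_def H\<theta>_def algebra_simps)
    then show ?thesis using bump_bounds(1)[OF n] by (simp add: \<psi>_def)
  next
    case False
    then consider "w \<le> p" | "q \<le> w" | "\<sigma> * (\<theta> - X s) \<le> 0" by linarith
    then show ?thesis
    proof cases
      case 3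
      then have "Y \<theta> s \<le> 0" using \<theta> by (simp add: Y_def wrap_eq[OF r] mult_le_0_iff zero_le_mult_iff)
      then have "bump' n (Y \<theta> s) = 0" by (rule bump'_eq_0)
      then show ?thesis by (simp add: Hs_def H\<theta>_def)
    qed (use pq in \<open>simp_all add: \<psi>_def bump_eq_0 mult_le_0_iff\<close>)
  qed
  have "0 \<le> (LINT x|\<mu> t. \<psi> (snd x) * H (fst x) t) - (LINT x|\<mu>0. \<psi> (snd x) * H (fst x) 0)"
  proof (rule has_integral_le[OF has_integral_0 int])
    fix s assume s: "s \<in> {0..t}"
    then show "0 \<le> (LINT x|\<mu> s. \<psi> (snd x) * (Hs (fst x) s + (snd x + drift (fst x) s) * H\<theta> (fst x) s))"
      by (intro Bochner_Integration.integral_nonneg_AE eventually_mono[OF near_pi[of s]] key) (auto simp: r_def)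
  qed
  then show ?thesis by (simp add: \<psi>_def H_def Y_def X_def)
qed

text \<open>The limit of the smooth statement: the factor \<open>exp (2 K s)\<close> disappears, as only the sign of its argument
  matters for the indicator.\<close>

lemma transport:
  assumes t: "t \<ge> 0" and \<sigma>: "\<sigma> = 1 \<or> \<sigma> = (-1 :: real)"
    and freq: "\<And>w. p < w \<Longrightarrow> w < q \<Longrightarrow> 0 \<le> \<sigma> * (w - f)" and pq: "p < q"
  shows "measure \<mu>0 {x \<in> space \<mu>0. p < snd x \<and> snd x < q \<and> 0 < \<sigma> * (fst x - \<theta>0)}
     \<le> measure (\<mu> t) {x \<in> space (\<mu> t). p < snd x \<and> snd x < q \<and> 0 < \<sigma> * (fst x - curve \<theta>0 f t)}"
proof -
  define r where "r = (D + pi) / 2"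
  have r: "0 < r" "r < pi" using D pi_gt_zero by (auto simp: r_def)
  have [measurable]: "wrap r \<in> borel_measurable borel"
    using r by (auto intro: borel_measurable_continuous_onI continuous_wrap)
  have lim: "(\<lambda>n. LINT x|M. bump (real n) ((snd x - p) * (q - snd x)) * bump (real n) (\<sigma> * e * (wrap r (fst x) - c)))
     \<longlonglongrightarrow> measure M {x \<in> space M. p < snd x \<and> snd x < q \<and> 0 < \<sigma> * (fst x - c)}"
    if M: "prob_space M" "sets M = sets phase_borel" "AE x in M. \<bar>fst x - pi\<bar> < r" and e: "e > 0" for M e c
  proof -
    interpret prob_space M by fact
    let ?S = "{x \<in> space M. p < snd x \<and> snd x < q \<and> 0 < \<sigma> * (fst x - c)}"
    have S: "?S \<in> sets M" by (rule sets_phaseI[OF M(2)]) measurable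
    have "(\<lambda>n. LINT x|M. bump (real n) ((snd x - p) * (q - snd x)) * bump (real n) (\<sigma> * e * (wrap r (fst x) - c)))
       \<longlonglongrightarrow> (LINT x|M. indicator ?S x)"
    proof (rule integral_dominated_convergence[where w="\<lambda>_. 1"])
      show "(\<lambda>x. indicator ?S x :: real) \<in> borel_measurable M" using S by simp
      show "(\<lambda>x. bump (real n) ((snd x - p) * (q - snd x)) * bump (real n) (\<sigma> * e * (wrap r (fst x) - c))) \<in> borel_measurable M" for n
        by (rule borel_measurable_phase[OF M(2)]) measurable
      show "AE x in M. (\<lambda>n. bump (real n) ((snd x - p) * (q - snd x)) * bump (real n) (\<sigma> * e * (wrap r (fst x) - c))) \<longlonglongrightarrow> indicator ?S x"
        using M(3) AE_space
      proof eventually_elim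
        case (elim x)
        have "(0 < \<sigma> * e * (wrap r (fst x) - c)) \<longleftrightarrow> 0 < \<sigma> * (fst x - c)"
          using e elim wrap_eq[OF r, of "fst x"] \<sigma> by (auto simp: zero_less_mult_iff mult_less_0_iff)
        moreover have "0 < (snd x - p) * (q - snd x) \<longleftrightarrow> p < snd x \<and> snd x < q"
          using pq by (auto simp: zero_less_mult_iff)
        ultimately have "indicator ?S x = indicator {0<..} ((snd x - p) * (q - snd x)) * (indicator {0<..} (\<sigma> * e * (wrap r (fst x) - c)) :: real)"
          using elim by (auto simp: indicator_def)
        then show ?case by (simp only:) (intro tendsto_mult bump_tendsto)
      qed
      show "AE x in M. norm (bump (real n) ((snd x - p) * (q - snd x)) * bump (real n) (\<sigma> * e * (wrap r (fst x) - c))) \<le> 1" for n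
      proof (rule AE_I2)
        fix x
        have "\<bar>bump (real n) u\<bar> * \<bar>bump (real n) v\<bar> \<le> 1 * 1" for u v by (intro mult_mono abs_bump_le) auto
        then show "norm (bump (real n) ((snd x - p) * (q - snd x)) * bump (real n) (\<sigma> * e * (wrap r (fst x) - c))) \<le> 1"
          by (simp add: abs_mult)
      qed
    qed simp
    then show ?thesis using S by simp
  qed
  have "(\<lambda>n. LINT x|\<mu>0. bump (real n) ((snd x - p) * (q - snd x)) * bump (real n) (\<sigma> * 1 * (wrap r (fst x) - \<theta>0)))
     \<longlonglongrightarrow> measure \<mu>0 {x \<in> space \<mu>0. p < snd x \<and> snd x < q \<and> 0 < \<sigma> * (fst x - \<theta>0)}"
    by (rule lim[OF prob0 sets0]) (use near_pi0 in \<open>simp_all add: r_def\<close>)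
  moreover have "(\<lambda>n. LINT x|\<mu> t. bump (real n) ((snd x - p) * (q - snd x)) * bump (real n) (\<sigma> * exp (2 * K * t) * (wrap r (fst x) - curve \<theta>0 f t)))
     \<longlonglongrightarrow> measure (\<mu> t) {x \<in> space (\<mu> t). p < snd x \<and> snd x < q \<and> 0 < \<sigma> * (fst x - curve \<theta>0 f t)}"
    by (rule lim[OF prob[OF t] sets[OF t]]) (use near_pi[OF t] in \<open>simp_all add: r_def\<close>)
  ultimately show ?thesis
    by (rule LIMSEQ_le) (use transport_smooth[OF t \<sigma> _ freq pq, of _ \<theta>0] in \<open>auto simp: r_def intro!: exI[of _ 0]\<close>)
qed

end

section \<open>Disintegration and quantiles\<close>

text \<open>Finiteness of the smaller integral suffices: on the set where \<open>h < f\<close> the larger one is finite as well, and the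
  difference of the integrals is the integral of the difference.\<close>

lemma AE_le_of_nn_integrals:
  fixes f h :: "'a \<Rightarrow> ennreal"
  assumes f: "f \<in> borel_measurable M" and h: "h \<in> borel_measurable M"
    and fin: "(\<integral>\<^sup>+x. f x \<partial>M) < \<infinity>"
    and le: "\<And>A. A \<in> sets M \<Longrightarrow> (\<integral>\<^sup>+x. f x * indicator A x \<partial>M) \<le> (\<integral>\<^sup>+x. h x * indicator A x \<partial>M)"
  shows "AE x in M. f x \<le> h x"
proof -
  note [measurable] = f h
  define A where "A = {x \<in> space M. h x < f x}"
  have A[measurable]: "A \<in> sets M" unfolding A_def by measurable
  have hf: "h x * indicator A x \<le> f x * indicator A x" if "x \<in> space M" for x
    using that by (auto simp: A_def indicator_def intro: less_imp_le)
  have fA: "(\<integral>\<^sup>+x. f x * indicator A x \<partial>M) \<le> (\<integral>\<^sup>+x. f x \<partial>M)"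
    by (intro nn_integral_mono) (auto simp: indicator_def)
  have hA: "(\<integral>\<^sup>+x. h x * indicator A x \<partial>M) \<le> (\<integral>\<^sup>+x. f x * indicator A x \<partial>M)"
    by (intro nn_integral_mono hf)
  have "(\<integral>\<^sup>+x. f x * indicator A x - h x * indicator A x \<partial>M)
     = (\<integral>\<^sup>+x. f x * indicator A x \<partial>M) - (\<integral>\<^sup>+x. h x * indicator A x \<partial>M)"
    using fA hA fin by (intro nn_integral_diff) (auto intro: hf simp: less_top[symmetric] top_unique)
  also have "\<dots> = 0"
    by (rule diff_eq_0_ennreal[OF _ le[OF A]]) (use fA fin in \<open>auto simp: less_top[symmetric] top_unique\<close>)
  finally have "AE x in M. f x * indicator A x - h x * indicator A x = 0"
    by (subst (asm) nn_integral_0_iff_AE) auto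
  then show ?thesis
    using AE_space
  proof eventually_elim
    case (elim x)
    show ?case
    proof (rule ccontr)
      assume "\<not> f x \<le> h x"
      then have "x \<in> A" using elim by (simp add: A_def)
      then have "f x - h x = 0" using elim by simp
      then show False using \<open>\<not> f x \<le> h x\<close> by (simp add: diff_eq_0_iff_ennreal)
    qed
  qed
qed

lemma phase_setsI: "S \<in> sets phase_borel \<Longrightarrow> S \<in> sets (borel \<Otimes>\<^sub>M borel)"
  unfolding phase_borel_def borel_prod
  by (subst (asm) sets_restrict_space_iff) (auto simp: borel_prod[symmetric])

lemma circle_borel_iff: "A \<in> sets circle_borel \<longleftrightarrow> A \<subseteq> {0..<2 * pi} \<and> A \<in> sets borel"
  unfolding circle_borel_def by (subst sets_restrict_space_iff) auto

lemma space_circle: "sets M = sets circle_borel \<Longrightarrow> space M = {0..<2 * pi}"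
  by (drule sets_eq_imp_space_eq) (simp add: circle_borel_def space_restrict_space)

lemma phase_section:
  assumes "S \<in> sets phase_borel" shows "{\<theta> \<in> {0..<2 * pi}. (\<theta>, w) \<in> S} \<in> sets circle_borel"
proof -
  have [measurable]: "S \<in> sets (borel \<Otimes>\<^sub>M borel)" using assms by (rule phase_setsI)
  have "{\<theta> \<in> space borel. 0 \<le> \<theta> \<and> \<theta> < 2 * pi \<and> (\<theta>, w) \<in> S} \<in> sets borel" by measurable
  then show ?thesis by (simp add: circle_borel_iff) (auto elim: back_subst[where P="\<lambda>A. A \<in> _"])
qed

text \<open>The sets \<open>[0, c] \<times> B\<close> with \<open>c < 2\<pi>\<close> are exactly those on which conditional distribution functions give the
  mass directly. The whole strip over \<open>B\<close> is their limit \<open>c \<rightarrow> 2\<pi>\<close>, and complements then yield a generating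
  family that is stable under intersections.\<close>

lemma phase_measure_eqI:
  assumes M: "sets M = sets phase_borel" "prob_space M" and N: "sets N = sets phase_borel"
    and eq: "\<And>c B. 0 \<le> c \<Longrightarrow> c < 2 * pi \<Longrightarrow> B \<in> sets borel \<Longrightarrow>
      emeasure M {x \<in> space M. fst x \<le> c \<and> snd x \<in> B} = emeasure N {x \<in> space N. fst x \<le> c \<and> snd x \<in> B}"
  shows "M = N"
proof -
  interpret M: prob_space M by fact
  have S: "{x \<in> space L. fst x \<in> A \<and> snd x \<in> B} \<in> sets L"
    if "sets L = sets phase_borel" "A \<in> sets borel" "B \<in> sets borel" for A B and L :: "(real \<times> real) measure"
    by (rule sets_phaseI[OF that(1)]) (use that(2,3) in measurable)
  have eqB: "emeasure M {x \<in> space M. snd x \<in> B} = emeasure N {x \<in> space N. snd x \<in> B}" if B: "B \<in> sets borel" for B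
  proof -
    define c where "c n = 2 * pi - 2 * pi / real (Suc n)" for n
    have c: "0 \<le> c n" "c n < 2 * pi" for n by (auto simp: c_def field_simps)
    have c_mono: "c m \<le> c n" if "m \<le> n" for m n using that by (auto simp: c_def intro!: divide_left_mono)
    have c_ex: "\<exists>n. y \<le> c n" if "y < 2 * pi" for y
    proof -
      have "c \<longlonglongrightarrow> 2 * pi - 0" unfolding c_def by (intro tendsto_intros LIMSEQ_Suc lim_const_over_n)
      then have "\<forall>\<^sub>F n in sequentially. y < c n" using that by (intro order_tendstoD(1)) auto
      then show ?thesis by (meson eventually_happens less_imp_le sequentially_bot)
    qed
    have "(SUP n. emeasure L {x \<in> space L. fst x \<le> c n \<and> snd x \<in> B}) = emeasure L {x \<in> space L. snd x \<in> B}"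
      if L: "sets L = sets phase_borel" for L
    proof -
      have "(SUP n. emeasure L {x \<in> space L. fst x \<le> c n \<and> snd x \<in> B}) = emeasure L (\<Union>n. {x \<in> space L. fst x \<le> c n \<and> snd x \<in> B})"
        using S[OF L _ B, of "{..c _}"] c_mono order_trans
        by (intro SUP_emeasure_incseq) (fastforce simp: incseq_def)+
      also have "(\<Union>n. {x \<in> space L. fst x \<le> c n \<and> snd x \<in> B}) = {x \<in> space L. snd x \<in> B}"
        using c_ex by (auto simp: space_phase[OF L])
      finally show ?thesis .
    qed
    from this[OF M(1)] this[OF N] show ?thesis using eq[OF c B] by simp
  qed
  have eq': "emeasure M {x \<in> space M. c < fst x \<and> snd x \<in> B} = emeasure N {x \<in> space N. c < fst x \<and> snd x \<in> B}"
    if B: "B \<in> sets borel" for B c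
  proof -
    consider "c < 0" | "0 \<le> c" "c < 2 * pi" | "c \<ge> 2 * pi" by linarith
    then show ?thesis
    proof cases
      case 1
      then have "{x \<in> space L. c < fst x \<and> snd x \<in> B} = {x \<in> space L. snd x \<in> B}" if "sets L = sets phase_borel" for L
        by (auto simp: space_phase[OF that])
      then show ?thesis using eqB[OF B] M(1) N by simp
    next
      case 2
      have split: "emeasure L {x \<in> space L. c < fst x \<and> snd x \<in> B}
         = emeasure L {x \<in> space L. snd x \<in> B} - emeasure L {x \<in> space L. fst x \<le> c \<and> snd x \<in> B}"
        if L: "sets L = sets phase_borel" and fin: "emeasure L {x \<in> space L. fst x \<le> c \<and> snd x \<in> B} \<noteq> \<infinity>" for L
      proof -
        have "emeasure L ({x \<in> space L. snd x \<in> B} - {x \<in> space L. fst x \<le> c \<and> snd x \<in> B})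
          = emeasure L {x \<in> space L. snd x \<in> B} - emeasure L {x \<in> space L. fst x \<le> c \<and> snd x \<in> B}"
          by (rule emeasure_Diff) (use fin S[OF L _ B, of "{..c}"] S[OF L _ B, of UNIV] in auto)
        moreover have "{x \<in> space L. snd x \<in> B} - {x \<in> space L. fst x \<le> c \<and> snd x \<in> B} = {x \<in> space L. c < fst x \<and> snd x \<in> B}"
          by auto
        ultimately show ?thesis by simp
      qed
      have fM: "emeasure M {x \<in> space M. fst x \<le> c \<and> snd x \<in> B} \<noteq> \<infinity>" by (simp add: M.emeasure_eq_measure)
      show ?thesis using split[OF M(1) fM] split[OF N] fM eq[OF 2 B] eqB[OF B] by simp
    next
      case 3
      then have e: "{x \<in> space L. c < fst x \<and> snd x \<in> B} = {}" if "sets L = sets phase_borel" for L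
        by (auto simp: space_phase[OF that])
      show ?thesis by (simp only: e[OF M(1)] e[OF N] emeasure_empty)
    qed
  qed
  have rect: "emeasure M {x \<in> space M. fst x \<in> A \<and> snd x \<in> B} = emeasure N {x \<in> space N. fst x \<in> A \<and> snd x \<in> B}"
    if A: "A \<in> sets borel" and B: "B \<in> sets borel" for A B
  proof -
    have m: "fst \<in> measurable (restrict_space L {x \<in> space L. snd x \<in> B}) borel" if "sets L = sets phase_borel" for L
      by (intro measurable_restrict_space1 borel_measurable_phase[OF that]) measurable
    have e: "emeasure (distr (restrict_space L {x \<in> space L. snd x \<in> B}) borel fst) A = emeasure L {x \<in> space L. fst x \<in> A \<and> snd x \<in> B}"
      if L: "sets L = sets phase_borel" and A: "A \<in> sets borel" for L A
    proof -
      have B': "{x \<in> space L. snd x \<in> B} \<in> sets L" using S[OF L _ B, of UNIV] by simp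
      have "emeasure (distr (restrict_space L {x \<in> space L. snd x \<in> B}) borel fst) A
        = emeasure (restrict_space L {x \<in> space L. snd x \<in> B}) {x \<in> space L. fst x \<in> A \<and> snd x \<in> B}"
        using A B' by (subst emeasure_distr[OF m[OF L]]) (auto simp: space_restrict_space intro!: arg_cong2[where f=emeasure])
      also have "\<dots> = emeasure L {x \<in> space L. fst x \<in> A \<and> snd x \<in> B}"
        using B' by (intro emeasure_restrict_space) auto
      finally show ?thesis .
    qed
    have "distr (restrict_space M {x \<in> space M. snd x \<in> B}) borel fst = distr (restrict_space N {x \<in> space N. snd x \<in> B}) borel fst"
    proof (rule measure_eqI_lessThan)
      fix c
      show "emeasure (distr (restrict_space M {x \<in> space M. snd x \<in> B}) borel fst) {c<..} < \<infinity>"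
        by (subst e[OF M(1)]) (auto simp: M.emeasure_eq_measure)
      show "emeasure (distr (restrict_space M {x \<in> space M. snd x \<in> B}) borel fst) {c<..}
         = emeasure (distr (restrict_space N {x \<in> space N. snd x \<in> B}) borel fst) {c<..}"
        using e[OF M(1), of "{c<..}"] e[OF N, of "{c<..}"] eq'[OF B, of c] by simp
    qed auto
    then show ?thesis using e[OF M(1) A] e[OF N A] by simp
  qed
  have id: "(\<lambda>x. x) \<in> measurable L (borel \<Otimes>\<^sub>M borel)" if "sets L = sets phase_borel" for L
    by (rule borel_measurable_phase[OF that]) measurable
  have pre: "(\<lambda>x. x) -` (A \<times> B) \<inter> space L = {x \<in> space L. fst x \<in> A \<and> snd x \<in> B}" for A B and L :: "(real \<times> real) measure"
    by auto
  have "distr M (borel \<Otimes>\<^sub>M borel) (\<lambda>x. x) = distr N (borel \<Otimes>\<^sub>M borel) (\<lambda>x. x)"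
  proof (rule measure_eqI_generator_eq[where \<Omega>=UNIV and E="{A \<times> B |A B. A \<in> sets borel \<and> B \<in> sets borel}" and A="\<lambda>_. UNIV"])
    show "Int_stable {A \<times> B |A B. A \<in> sets (borel :: real measure) \<and> B \<in> sets (borel :: real measure)}"
      by (rule Int_stable_pair_measure_generator)
    show "sets (distr L (borel \<Otimes>\<^sub>M borel) (\<lambda>x. x)) = sigma_sets UNIV {A \<times> B |A B. A \<in> sets (borel :: real measure) \<and> B \<in> sets (borel :: real measure)}"
      for L :: "(real \<times> real) measure"
      by (simp add: sets_pair_measure)
    then show "sets (distr N (borel \<Otimes>\<^sub>M borel) (\<lambda>x. x)) = sigma_sets UNIV {A \<times> B |A B. A \<in> sets (borel :: real measure) \<and> B \<in> sets (borel :: real measure)}" .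
    fix X :: "(real \<times> real) set" assume "X \<in> {A \<times> B |A B. A \<in> sets borel \<and> B \<in> sets borel}"
    then obtain A B where X: "X = A \<times> B" and AB: "A \<in> sets borel" "B \<in> sets borel" by auto
    then have Xs: "X \<in> sets (borel \<Otimes>\<^sub>M borel)" by simp
    show "emeasure (distr M (borel \<Otimes>\<^sub>M borel) (\<lambda>x. x)) X = emeasure (distr N (borel \<Otimes>\<^sub>M borel) (\<lambda>x. x)) X"
      unfolding emeasure_distr[OF id[OF M(1)] Xs] emeasure_distr[OF id[OF N] Xs]
      unfolding X pre by (rule rect[OF AB])
  next
    show "range (\<lambda>_. UNIV) \<subseteq> {A \<times> B |A B. A \<in> sets (borel :: real measure) \<and> B \<in> sets (borel :: real measure)}"
      by (auto intro!: exI[of _ UNIV])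
    show "emeasure (distr M (borel \<Otimes>\<^sub>M borel) (\<lambda>x. x)) UNIV \<noteq> \<infinity>"
    proof -
      have "UNIV \<in> sets (borel \<Otimes>\<^sub>M borel :: (real \<times> real) measure)"
        using sets.top[of "borel \<Otimes>\<^sub>M borel :: (real \<times> real) measure"] by (simp add: space_pair_measure)
      from emeasure_distr[OF id[OF M(1)] this] show ?thesis by (simp add: M.emeasure_eq_measure)
    qed
  qed auto
  then have *: "emeasure (distr M (borel \<Otimes>\<^sub>M borel) (\<lambda>x. x)) X = emeasure (distr N (borel \<Otimes>\<^sub>M borel) (\<lambda>x. x)) X" for X by simp
  show ?thesis
  proof (rule measure_eqI)
    show "sets M = sets N" using M N by simp
    fix X assume X: "X \<in> sets M"
    then have Xs: "X \<in> sets (borel \<Otimes>\<^sub>M borel)" using phase_setsI M(1) by simp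
    have "X \<subseteq> space M" by (rule sets.sets_into_space[OF X])
    moreover from this have "X \<subseteq> space N" by (simp add: space_phase[OF M(1)] space_phase[OF N])
    ultimately have "(\<lambda>x. x) -` X \<inter> space M = X" "(\<lambda>x. x) -` X \<inter> space N = X" by auto
    then show "emeasure M X = emeasure N X"
      using *[of X] emeasure_distr[OF id[OF M(1)] Xs] emeasure_distr[OF id[OF N] Xs] by simp
  qed
qed

subsection \<open>The region under the graph of the frequency density\<close>

text \<open>The space of pairs \<open>(\<Omega>, \<eta>)\<close> with \<open>0 < \<eta> < g \<Omega>\<close> carries the pseudo-inverses of all measures with
  frequency density \<open>g\<close>.\<close>

definition mass_space :: "(real \<Rightarrow> real) \<Rightarrow> (real \<times> real) measure" where
  "mass_space g = density (lborel \<Otimes>\<^sub>M lborel) (\<lambda>z. indicator {0<..<g (fst z)} (snd z))"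

lemma sets_mass_space [simp, measurable_cong]: "sets (mass_space g) = sets (borel \<Otimes>\<^sub>M borel)"
  by (simp add: mass_space_def cong: sets_pair_measure_cong)

lemma space_mass_space [simp]: "space (mass_space g) = UNIV"
  by (simp add: mass_space_def space_pair_measure)

lemma lborel_pair_measurable: "f \<in> measurable (borel \<Otimes>\<^sub>M borel) N \<Longrightarrow> f \<in> measurable (lborel \<Otimes>\<^sub>M lborel) N"
  by (simp cong: measurable_cong_sets sets_pair_measure_cong)

context
  fixes g :: "real \<Rightarrow> real" assumes g [measurable]: "g \<in> borel_measurable borel"
begin

lemma mass_indicator_measurable [measurable]:
  "(\<lambda>z. indicator {0<..<g (fst z)} (snd z) :: ennreal) \<in> borel_measurable (borel \<Otimes>\<^sub>M borel)"
  unfolding greaterThanLessThan_iff indicator_def by measurable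

lemma nn_integral_mass_space:
  fixes f :: "real \<times> real \<Rightarrow> ennreal"
  assumes [measurable]: "f \<in> borel_measurable (borel \<Otimes>\<^sub>M borel)"
  shows "(\<integral>\<^sup>+z. f z \<partial>mass_space g) = (\<integral>\<^sup>+w. (\<integral>\<^sup>+\<eta>. f (w, \<eta>) * indicator {0<..<g w} \<eta> \<partial>lborel) \<partial>lborel)"
proof -
  have "(\<integral>\<^sup>+z. f z \<partial>mass_space g) = (\<integral>\<^sup>+z. indicator {0<..<g (fst z)} (snd z) * f z \<partial>(lborel \<Otimes>\<^sub>M lborel))"
    unfolding mass_space_def by (rule nn_integral_density) (intro lborel_pair_measurable, measurable)+
  also have "\<dots> = (\<integral>\<^sup>+w. (\<integral>\<^sup>+\<eta>. indicator {0<..<g (fst (w, \<eta>))} (snd (w, \<eta>)) * f (w, \<eta>) \<partial>lborel) \<partial>lborel)"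
    by (rule lborel.nn_integral_fst[symmetric]) (intro lborel_pair_measurable, measurable)
  finally show ?thesis by (simp add: mult.commute)
qed

lemma AE_mass_space:
  assumes P [measurable]: "Measurable.pred (borel \<Otimes>\<^sub>M borel) P"
  shows "(AE z in mass_space g. P z) \<longleftrightarrow> (AE w in lborel. AE \<eta> in lborel. 0 < \<eta> \<and> \<eta> < g w \<longrightarrow> P (w, \<eta>))"
proof -
  have "(AE z in mass_space g. P z) \<longleftrightarrow> (AE z in lborel \<Otimes>\<^sub>M lborel. 0 < (indicator {0<..<g (fst z)} (snd z) :: ennreal) \<longrightarrow> P z)"
    unfolding mass_space_def by (rule AE_density) (intro lborel_pair_measurable, measurable)
  also have "\<dots> \<longleftrightarrow> (AE z in lborel \<Otimes>\<^sub>M lborel. (\<lambda>w \<eta>. 0 < \<eta> \<and> \<eta> < g w \<longrightarrow> P (w, \<eta>)) (fst z) (snd z))"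
    by (intro AE_cong) (auto simp: indicator_def)
  also have "\<dots> \<longleftrightarrow> (AE w in lborel. AE \<eta> in lborel. 0 < \<eta> \<and> \<eta> < g w \<longrightarrow> P (w, \<eta>))"
  proof (rule lborel_pair.AE_pair_iff[symmetric])
    have "(\<lambda>z. 0 < snd z \<and> snd z < g (fst z) \<longrightarrow> P (fst z, snd z)) \<in> measurable (borel \<Otimes>\<^sub>M borel) (count_space UNIV)"
      by measurable
    then have "Measurable.pred (lborel \<Otimes>\<^sub>M lborel) (\<lambda>z. 0 < snd z \<and> snd z < g (fst z) \<longrightarrow> P (fst z, snd z))"
      by (rule lborel_pair_measurable)
    then show "{z \<in> space (lborel \<Otimes>\<^sub>M lborel). 0 < snd z \<and> snd z < g (fst z) \<longrightarrow> P (fst z, snd z)} \<in> sets (lborel \<Otimes>\<^sub>M lborel)"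
      by (simp add: pred_def)
  qed
  finally show ?thesis .
qed

end

lemma phase_rect_sets:
  assumes "sets L = sets phase_borel" and [measurable]: "B \<in> sets borel"
  shows "{x \<in> space L. fst x \<le> c \<and> snd x \<in> B} \<in> sets L"
  by (rule sets_phaseI[OF assms(1)]) measurable

text \<open>Almost-everywhere statements are first proved for rational parameters, which share one null set, and then
  extended by limits along such sequences.\<close>

lemma rational_sequence:
  assumes "c < (d :: real)"
  obtains q where "\<And>n. q n \<in> \<rat>" "\<And>n. c < q n" "\<And>n. q n < d" "\<And>n. q (Suc n) < q n" "q \<longlonglongrightarrow> c"
proof -
  define e where "e n = c + (d - c) / real (Suc n)" for n
  have e: "e (Suc n) < e n" for n
    unfolding e_def using assms by (intro add_strict_left_mono divide_strict_left_mono) auto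
  obtain q where q: "\<And>n. q n \<in> \<rat>" "\<And>n. e (Suc n) < q n" "\<And>n. q n < e n"
  proof -
    have "\<exists>r. r \<in> \<rat> \<and> e (Suc n) < r \<and> r < e n" for n using Rats_dense_in_real[OF e[of n]] by blast
    then show thesis using that by metis
  qed
  have ec: "c < e n" "e n \<le> d" for n
  proof -
    have "(d - c) / real (Suc n) \<le> (d - c) / 1" using assms by (intro divide_left_mono) auto
    then show "e n \<le> d" by (simp add: e_def)
    show "c < e n" using assms by (simp add: e_def)
  qed
  have el: "e \<longlonglongrightarrow> c + 0" unfolding e_def by (intro tendsto_intros LIMSEQ_Suc lim_const_over_n)
  show thesis
  proof (rule that)
    show "q n \<in> \<rat>" "c < q n" "q n < d" "q (Suc n) < q n" for n
      using q[of n] q(3)[of "Suc n"] ec(1)[of "Suc n"] ec(2)[of n] by auto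
    show "q \<longlonglongrightarrow> c"
    proof (rule tendsto_sandwich[of "\<lambda>_. c" q sequentially e c])
      have "c \<le> q n" for n using ec(1)[of "Suc n"] q(2)[of n] by linarith
      then show "\<forall>\<^sub>F n in sequentially. c \<le> q n" by simp
      show "\<forall>\<^sub>F n in sequentially. q n \<le> e n" using q(3) by (simp add: less_imp_le)
    qed (use el in simp_all)
  qed
qed

locale frequency_measure =
  fixes g :: "real \<Rightarrow> real" and \<nu> :: "(real \<times> real) measure"
  assumes freq: "frequency_density g" and sets_nu: "sets \<nu> = sets phase_borel"
    and prob_nu: "prob_space \<nu>" and density_nu: "has_frequency_density \<nu> g"
begin

sublocale prob_space \<nu> by (rule prob_nu)

lemma g_nonneg: "0 \<le> g w"
  using freq by (simp add: frequency_density_def)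

lemma g_measurable [measurable]: "g \<in> borel_measurable borel"
  using freq by (auto simp: frequency_density_def dest: borel_measurable_integrable)

lemma snd_measurable: "snd \<in> measurable \<nu> borel"
  by (rule borel_measurable_phase[OF sets_nu]) measurable

lemma nu_sets:
  assumes [measurable]: "B \<in> sets borel"
  shows "{x \<in> space \<nu>. fst x \<le> c \<and> snd x \<in> B} \<in> sets \<nu>" "{x \<in> space \<nu>. snd x \<in> B} \<in> sets \<nu>"
proof -
  show "{x \<in> space \<nu>. fst x \<le> c \<and> snd x \<in> B} \<in> sets \<nu>" by (rule sets_phaseI[OF sets_nu]) measurable
  have "snd -` B \<inter> space \<nu> \<in> sets \<nu>" by (rule measurable_sets[OF snd_measurable assms])
  then show "{x \<in> space \<nu>. snd x \<in> B} \<in> sets \<nu>" by (simp add: vimage_def Int_def conj_commute)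
qed

lemma emeasure_frequency:
  assumes B: "B \<in> sets borel"
  shows "emeasure \<nu> {x \<in> space \<nu>. snd x \<in> B} = (\<integral>\<^sup>+w. ennreal (g w) * indicator B w \<partial>lborel)"
proof -
  have "emeasure \<nu> {x \<in> space \<nu>. snd x \<in> B} = emeasure (distr \<nu> borel snd) B"
    using snd_measurable B by (subst emeasure_distr) (auto intro!: arg_cong2[where f=emeasure])
  also have "\<dots> = (\<integral>\<^sup>+w. ennreal (g w) * indicator B w \<partial>lborel)"
    using density_nu B by (simp add: has_frequency_density_def emeasure_density)
  finally show ?thesis .
qed

lemma total_mass: "(\<integral>\<^sup>+w. ennreal (g w) \<partial>lborel) = 1"
  using emeasure_frequency[of UNIV] emeasure_space_1 by simp

lemma prob_mass_space: "prob_space (mass_space g)"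
proof (rule prob_spaceI)
  have "emeasure (mass_space g) (space (mass_space g)) = (\<integral>\<^sup>+z. 1 \<partial>mass_space g)" by simp
  also have "\<dots> = (\<integral>\<^sup>+w. (\<integral>\<^sup>+\<eta>. 1 * indicator {0<..<g w} \<eta> \<partial>lborel) \<partial>lborel)"
    by (rule nn_integral_mass_space) measurable
  also have "\<dots> = 1" by (simp add: g_nonneg total_mass)
  finally show "emeasure (mass_space g) (space (mass_space g)) = 1" .
qed

subsection \<open>Existence of disintegrations\<close>

text \<open>By the Radon-Nikodym theorem the mass of \<open>[0, r] \<times> B\<close> has a density in the frequency for every
  rational \<open>r\<close>; these are, up to a null set, the values at rational points of the distribution functions of
  the conditional measures. The conditional measures are obtained as images of Lebesgue measure on
  \<open>(0, g \<Omega>)\<close> under the corresponding quantile functions, which gives them the right mass for every \<open>\<Omega>\<close>.\<close>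

lemma radon_nikodym_phase:
  "\<exists>f \<in> borel_measurable borel. \<forall>B \<in> sets borel.
     emeasure \<nu> {x \<in> space \<nu>. fst x \<le> r \<and> snd x \<in> B} = (\<integral>\<^sup>+w. f w * indicator B w \<partial>lborel)"
proof -
  define R where "R = {x \<in> space \<nu>. fst x \<le> r}"
  have R: "R \<in> sets \<nu>" unfolding R_def using nu_sets(1)[of UNIV r] by simp
  define N where "N = distr (restrict_space \<nu> R) borel snd"
  have m: "snd \<in> measurable (restrict_space \<nu> R) borel"
    by (rule measurable_restrict_space1[OF snd_measurable])
  have N: "emeasure N B = emeasure \<nu> {x \<in> space \<nu>. fst x \<le> r \<and> snd x \<in> B}" if B: "B \<in> sets borel" for B
  proof -
    have "emeasure N B = emeasure (restrict_space \<nu> R) {x \<in> space \<nu>. fst x \<le> r \<and> snd x \<in> B}"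
      unfolding N_def using R B
      by (subst emeasure_distr[OF m]) (auto simp: space_restrict_space R_def intro!: arg_cong2[where f=emeasure])
    also have "\<dots> = emeasure \<nu> {x \<in> space \<nu>. fst x \<le> r \<and> snd x \<in> B}"
      using R by (intro emeasure_restrict_space) (auto simp: R_def)
    finally show ?thesis .
  qed
  have "absolutely_continuous lborel N"
    unfolding absolutely_continuous_def
  proof
    fix B :: "real set" assume B: "B \<in> null_sets lborel"
    then have Bs: "B \<in> sets borel" by auto
    have "emeasure N B \<le> emeasure \<nu> {x \<in> space \<nu>. snd x \<in> B}"
      unfolding N[OF Bs] by (intro emeasure_mono nu_sets[OF Bs]) auto
    also have "\<dots> = (\<integral>\<^sup>+w. ennreal (g w) * indicator B w \<partial>lborel)" by (rule emeasure_frequency[OF Bs])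
    also have "\<dots> = 0"
    proof (subst nn_integral_0_iff_AE)
      show "(\<lambda>w. ennreal (g w) * indicator B w) \<in> borel_measurable lborel" using Bs by simp
      show "AE w in lborel. ennreal (g w) * indicator B w = 0"
        using AE_not_in[OF B] by eventually_elim simp
    qed
    finally show "B \<in> null_sets N" using Bs by (auto simp: null_sets_def N_def)
  qed
  then obtain f where f: "f \<in> borel_measurable lborel" "density lborel f = N"
    using sigma_finite_measure.Radon_Nikodym[OF sigma_finite_lborel, of N] by (auto simp: N_def)
  show ?thesis
  proof (intro bexI[of _ f] ballI)
    fix B :: "real set" assume B: "B \<in> sets borel"
    show "emeasure \<nu> {x \<in> space \<nu>. fst x \<le> r \<and> snd x \<in> B} = (\<integral>\<^sup>+w. f w * indicator B w \<partial>lborel)"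
      unfolding N[OF B, symmetric] f(2)[symmetric] using f(1) B by (simp add: emeasure_density)
  qed (use f in simp)
qed

lemma exists_disintegration: "\<exists>\<kappa>. disintegrates g \<nu> \<kappa>"
proof -
  have "\<forall>r. \<exists>f. f \<in> borel_measurable borel \<and> (\<forall>B \<in> sets borel.
     emeasure \<nu> {x \<in> space \<nu>. fst x \<le> r \<and> snd x \<in> B} = (\<integral>\<^sup>+w. f w * indicator B w \<partial>lborel))"
    using radon_nikodym_phase by blast
  from choice[OF this] obtain f where f [measurable]: "\<And>r. f r \<in> borel_measurable borel"
    and fB: "\<And>r B. B \<in> sets borel \<Longrightarrow>
      emeasure \<nu> {x \<in> space \<nu>. fst x \<le> r \<and> snd x \<in> B} = (\<integral>\<^sup>+w. f r w * indicator B w \<partial>lborel)"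
    by blast
  define Q where "Q = \<rat> \<inter> {0..<2 * pi}"
  have Qc: "countable Q" unfolding Q_def by (rule countable_subset[OF _ countable_rat]) auto
  have fin: "(\<integral>\<^sup>+w. f r w \<partial>lborel) < \<infinity>" for r
    using fB[of UNIV r] emeasure_finite[of "{x \<in> space \<nu>. fst x \<le> r \<and> snd x \<in> UNIV}"] by (simp add: less_top)
  have f_mono: "AE w in lborel. f r w \<le> f r' w" if "r \<le> r'" for r r'
  proof (rule AE_le_of_nn_integrals[OF _ _ fin])
    fix A :: "real set" assume "A \<in> sets lborel"
    then have A: "A \<in> sets borel" by simp
    show "(\<integral>\<^sup>+w. f r w * indicator A w \<partial>lborel) \<le> (\<integral>\<^sup>+w. f r' w * indicator A w \<partial>lborel)"
      unfolding fB[OF A, symmetric] using that nu_sets[OF A] by (intro emeasure_mono) auto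
  qed auto
  have f_le: "AE w in lborel. f r w \<le> g w" for r
  proof (rule AE_le_of_nn_integrals[OF _ _ fin])
    fix A :: "real set" assume "A \<in> sets lborel"
    then have A: "A \<in> sets borel" by simp
    show "(\<integral>\<^sup>+w. f r w * indicator A w \<partial>lborel) \<le> (\<integral>\<^sup>+w. ennreal (g w) * indicator A w \<partial>lborel)"
      unfolding fB[OF A, symmetric] emeasure_frequency[OF A, symmetric]
      by (intro emeasure_mono nu_sets[OF A]) auto
  qed auto
  have f_top: "AE w in lborel. \<forall>\<eta>. 0 < \<eta> \<and> \<eta> < g w \<longrightarrow> (\<exists>r\<in>Q. ennreal \<eta> < f r w)"
  proof -
    obtain q where q: "\<And>n. q n \<in> \<rat>" "\<And>n. - (2 * pi) < q n" "\<And>n. q n < 0" "\<And>n. q (Suc n) < q n" "q \<longlonglongrightarrow> - (2 * pi)"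
      using rational_sequence[of "- (2 * pi)" 0] pi_gt_zero by auto
    define c where "c n = - q n" for n
    have c: "c n \<in> Q" for n using q(1-3)[of n] by (auto simp: Q_def c_def)
    have c_mono: "incseq c" by (rule incseq_SucI) (use q(4) less_imp_le in \<open>auto simp: c_def\<close>)
    have c_ex: "\<exists>n. y \<le> c n" if "y < 2 * pi" for y
    proof -
      have "c \<longlonglongrightarrow> 2 * pi" using tendsto_minus[OF q(5)] by (simp add: c_def[abs_def])
      then have "\<forall>\<^sub>F n in sequentially. y < c n" using that by (intro order_tendstoD(1)) auto
      then show ?thesis by (meson eventually_happens less_imp_le sequentially_bot)
    qed
    have "AE w in lborel. ennreal (g w) \<le> (SUP n. f (c n) w)"
    proof (rule AE_le_of_nn_integrals)
      show "(\<integral>\<^sup>+w. ennreal (g w) \<partial>lborel) < \<infinity>" by (simp add: total_mass)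
      fix A :: "real set" assume "A \<in> sets lborel"
      then have A: "A \<in> sets borel" by simp
      have "(\<integral>\<^sup>+w. ennreal (g w) * indicator A w \<partial>lborel) = emeasure \<nu> {x \<in> space \<nu>. snd x \<in> A}"
        by (rule emeasure_frequency[OF A, symmetric])
      also have "{x \<in> space \<nu>. snd x \<in> A} = (\<Union>n. {x \<in> space \<nu>. fst x \<le> c n \<and> snd x \<in> A})"
        using c_ex by (auto simp: space_phase[OF sets_nu])
      also have "emeasure \<nu> \<dots> = (SUP n. emeasure \<nu> {x \<in> space \<nu>. fst x \<le> c n \<and> snd x \<in> A})"
      proof (rule SUP_emeasure_incseq[symmetric])
        show "range (\<lambda>n. {x \<in> space \<nu>. fst x \<le> c n \<and> snd x \<in> A}) \<subseteq> sets \<nu>" using nu_sets(1)[OF A] by auto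
        show "incseq (\<lambda>n. {x \<in> space \<nu>. fst x \<le> c n \<and> snd x \<in> A})"
          unfolding incseq_def using incseqD[OF c_mono] by (auto intro: order_trans)
      qed
      also have "\<dots> \<le> (\<integral>\<^sup>+w. (SUP n. f (c n) w) * indicator A w \<partial>lborel)"
        unfolding fB[OF A] by (intro SUP_least nn_integral_mono mult_right_mono SUP_upper) auto
      finally show "(\<integral>\<^sup>+w. ennreal (g w) * indicator A w \<partial>lborel) \<le> (\<integral>\<^sup>+w. (SUP n. f (c n) w) * indicator A w \<partial>lborel)" .
    qed auto
    then show ?thesis
    proof eventually_elim
      case (elim w)
      show ?case
      proof (intro allI impI)
        fix \<eta> assume "0 < \<eta> \<and> \<eta> < g w"
        then have "ennreal \<eta> < ennreal (g w)" by (simp add: ennreal_less_iff)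
        then have "ennreal \<eta> < (SUP n. f (c n) w)" using elim by simp
        then show "\<exists>r\<in>Q. ennreal \<eta> < f r w" using c by (auto simp: less_SUP_iff)
      qed
    qed
  qed
  have "AE w in lborel. \<forall>r\<in>Q. \<forall>r'\<in>Q. r \<le> r' \<longrightarrow> f r w \<le> f r' w"
  proof -
    have "AE w in lborel. r \<le> r' \<longrightarrow> f r w \<le> f r' w" for r r'
      using f_mono[of r r'] by (cases "r \<le> r'") auto
    then show ?thesis by (simp add: AE_ball_countable[OF Qc])
  qed
  moreover have "AE w in lborel. \<forall>r\<in>Q. f r w \<le> g w" using f_le by (simp add: AE_ball_countable[OF Qc])
  ultimately have good: "AE w in lborel. (\<forall>r\<in>Q. \<forall>r'\<in>Q. r \<le> r' \<longrightarrow> f r w \<le> f r' w) \<and> (\<forall>r\<in>Q. f r w \<le> g w)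
      \<and> (\<forall>\<eta>. 0 < \<eta> \<and> \<eta> < g w \<longrightarrow> (\<exists>r\<in>Q. ennreal \<eta> < f r w))"
    using f_top by eventually_elim auto
  define \<psi> where "\<psi> z = (if \<exists>r\<in>Q. ennreal (snd z) < f r (fst z) then Inf {r\<in>Q. ennreal (snd z) < f r (fst z)} else 0)" for z
  have bdd: "bdd_below {r\<in>Q. P r}" for P by (rule bdd_belowI[of _ 0]) (auto simp: Q_def)
  have \<psi>_less: "\<psi> z < c \<longleftrightarrow> (\<exists>r\<in>Q. r < c \<and> ennreal (snd z) < f r (fst z)) \<or> (\<not> (\<exists>r\<in>Q. ennreal (snd z) < f r (fst z)) \<and> 0 < c)" for z c
    using cInf_less_iff[OF _ bdd, of "\<lambda>r. ennreal (snd z) < f r (fst z)" c] by (auto simp: \<psi>_def)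
  have \<psi>_range: "\<psi> z \<in> {0..<2 * pi}" for z
  proof -
    have "0 \<le> \<psi> z" by (auto simp: \<psi>_def Q_def intro!: cInf_greatest)
    moreover have "\<psi> z < 2 * pi" unfolding \<psi>_less by (auto simp: Q_def)
    ultimately show ?thesis by simp
  qed
  have \<psi>_meas [measurable]: "\<psi> \<in> borel_measurable (borel \<Otimes>\<^sub>M borel)"
  proof (rule borel_measurableI_less)
    fix c
    define A where "A r = {z \<in> space (borel \<Otimes>\<^sub>M borel). ennreal (snd z) < f r (fst z)}" for r
    have A: "A r \<in> sets (borel \<Otimes>\<^sub>M borel)" for r unfolding A_def by measurable
    have U: "(\<Union>r\<in>Q \<inter> {..<c}. A r) \<in> sets (borel \<Otimes>\<^sub>M borel)" "(\<Union>r\<in>Q. A r) \<in> sets (borel \<Otimes>\<^sub>M borel)"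
      by (intro sets.countable_UN'' A countable_Int1 Qc)+
    have "{x \<in> space (borel \<Otimes>\<^sub>M borel). \<psi> x < c} = (\<Union>r\<in>Q \<inter> {..<c}. A r) \<union>
        (if 0 < c then space (borel \<Otimes>\<^sub>M borel) - (\<Union>r\<in>Q. A r) else {})"
      unfolding \<psi>_less A_def by auto
    also have "\<dots> \<in> sets (borel \<Otimes>\<^sub>M borel)" using U by (cases "0 < c") auto
    finally show "{x \<in> space (borel \<Otimes>\<^sub>M borel). \<psi> x < c} \<in> sets (borel \<Otimes>\<^sub>M borel)" .
  qed
  have \<psi>_sec [measurable]: "(\<lambda>\<eta>. \<psi> (w, \<eta>)) \<in> borel_measurable borel" for w by measurable
  define \<kappa> where "\<kappa> w = distr (restrict_space lborel {0<..<g w}) circle_borel (\<lambda>\<eta>. \<psi> (w, \<eta>))" for w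
  have \<kappa>_meas: "(\<lambda>\<eta>. \<psi> (w, \<eta>)) \<in> measurable (restrict_space lborel {0<..<g w}) circle_borel" for w
    unfolding circle_borel_def
    by (intro measurable_restrict_space2 measurable_restrict_space1) (use \<psi>_range in \<open>auto\<close>)
  have \<kappa>_eq: "emeasure (\<kappa> w) A = (\<integral>\<^sup>+\<eta>. indicator A (\<psi> (w, \<eta>)) * indicator {0<..<g w} \<eta> \<partial>lborel)"
    if A: "A \<in> sets circle_borel" for A w
  proof -
    have Ab [measurable]: "A \<in> sets borel" using A circle_borel_iff by blast
    have "emeasure (\<kappa> w) A = emeasure (restrict_space lborel {0<..<g w}) {\<eta> \<in> {0<..<g w}. \<psi> (w, \<eta>) \<in> A}"
      unfolding \<kappa>_def using A
      by (subst emeasure_distr[OF \<kappa>_meas]) (auto simp: space_restrict_space intro!: arg_cong2[where f=emeasure])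
    also have "\<dots> = emeasure lborel {\<eta> \<in> {0<..<g w}. \<psi> (w, \<eta>) \<in> A}"
      by (intro emeasure_restrict_space) auto
    also have "\<dots> = (\<integral>\<^sup>+\<eta>. indicator {\<eta> \<in> {0<..<g w}. \<psi> (w, \<eta>) \<in> A} \<eta> \<partial>lborel)"
    proof (rule nn_integral_indicator[symmetric])
      have "{\<eta> \<in> space borel. 0 < \<eta> \<and> \<eta> < g w \<and> \<psi> (w, \<eta>) \<in> A} \<in> sets borel" by measurable
      then show "{\<eta> \<in> {0<..<g w}. \<psi> (w, \<eta>) \<in> A} \<in> sets lborel" by (simp add: conj_assoc)
    qed
    also have "\<dots> = (\<integral>\<^sup>+\<eta>. indicator A (\<psi> (w, \<eta>)) * indicator {0<..<g w} \<eta> \<partial>lborel)"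
      by (intro nn_integral_cong) (auto simp: indicator_def)
    finally show ?thesis .
  qed
  define T where "T z = (\<psi> z, fst z)" for z :: "real \<times> real"
  have T_meas: "T \<in> measurable (mass_space g) phase_borel"
    unfolding phase_borel_def
  proof (rule measurable_restrict_space2)
    show "T \<in> space (mass_space g) \<rightarrow> {0..<2 * pi} \<times> UNIV" using \<psi>_range by (auto simp: T_def)
    have "T \<in> measurable (borel \<Otimes>\<^sub>M borel) (borel \<Otimes>\<^sub>M borel)" unfolding T_def by measurable
    then have "T \<in> measurable (mass_space g) (borel \<Otimes>\<^sub>M borel)"
      by (simp cong: measurable_cong_sets)
    then show "T \<in> measurable (mass_space g) borel" by (simp only: borel_prod)
  qed
  define \<nu>' where "\<nu>' = distr (mass_space g) phase_borel T"
  have s': "sets \<nu>' = sets phase_borel" by (simp add: \<nu>'_def)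
  have p': "prob_space \<nu>'" unfolding \<nu>'_def by (rule prob_space.prob_space_distr[OF prob_mass_space T_meas])
  interpret P': prob_space \<nu>' by (rule p')
  have e': "emeasure \<nu>' S = (\<integral>\<^sup>+w. (\<integral>\<^sup>+\<eta>. indicator S (\<psi> (w, \<eta>), w) * indicator {0<..<g w} \<eta> \<partial>lborel) \<partial>lborel)"
    if S: "S \<in> sets phase_borel" for S
  proof -
    have [measurable]: "S \<in> sets (borel \<Otimes>\<^sub>M borel)" using S by (rule phase_setsI)
    have "emeasure \<nu>' S = (\<integral>\<^sup>+x. indicator S x \<partial>\<nu>')" using S s' by simp
    also have "\<dots> = (\<integral>\<^sup>+z. indicator S (T z) \<partial>mass_space g)"
      unfolding \<nu>'_def by (rule nn_integral_distr[OF T_meas]) (use S in simp)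
    also have "\<dots> = (\<integral>\<^sup>+w. (\<integral>\<^sup>+\<eta>. indicator S (\<psi> (w, \<eta>), w) * indicator {0<..<g w} \<eta> \<partial>lborel) \<partial>lborel)"
      unfolding T_def by (subst nn_integral_mass_space) (auto)
    finally show ?thesis .
  qed
  have e'c: "emeasure \<nu>' {x \<in> space \<nu>'. fst x \<le> c \<and> snd x \<in> B}
     = (\<integral>\<^sup>+w. emeasure lborel {\<eta>. 0 < \<eta> \<and> \<eta> < g w \<and> \<psi> (w, \<eta>) \<le> c} * indicator B w \<partial>lborel)"
    if B: "B \<in> sets borel" for B c
  proof -
    have S: "{x \<in> space \<nu>'. fst x \<le> c \<and> snd x \<in> B} \<in> sets phase_borel"
      using phase_rect_sets[OF s' B] by (simp only: s')
    have "(\<integral>\<^sup>+\<eta>. indicator {x \<in> space \<nu>'. fst x \<le> c \<and> snd x \<in> B} (\<psi> (w, \<eta>), w) * indicator {0<..<g w} \<eta> \<partial>lborel)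
       = emeasure lborel {\<eta>. 0 < \<eta> \<and> \<eta> < g w \<and> \<psi> (w, \<eta>) \<le> c} * indicator B w" for w
    proof -
      have m: "{\<eta>. 0 < \<eta> \<and> \<eta> < g w \<and> \<psi> (w, \<eta>) \<le> c} \<in> sets lborel"
      proof -
        have "{\<eta> \<in> space borel. 0 < \<eta> \<and> \<eta> < g w \<and> \<psi> (w, \<eta>) \<le> c} \<in> sets borel" by measurable
        then show ?thesis by simp
      qed
      have "(\<integral>\<^sup>+\<eta>. indicator {x \<in> space \<nu>'. fst x \<le> c \<and> snd x \<in> B} (\<psi> (w, \<eta>), w) * indicator {0<..<g w} \<eta> \<partial>lborel)
        = (\<integral>\<^sup>+\<eta>. indicator {\<eta>. 0 < \<eta> \<and> \<eta> < g w \<and> \<psi> (w, \<eta>) \<le> c} \<eta> * indicator B w \<partial>lborel)"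
        using \<psi>_range by (intro nn_integral_cong) (auto simp: indicator_def space_phase[OF s'])
      then show ?thesis using m by (simp add: nn_integral_multc)
    qed
    then show ?thesis using e'[OF S] by simp
  qed
  \<comment> \<open>The densities \<open>f r\<close> need not be right continuous in \<open>r\<close>, so the bound from above leaves a gap
    between the levels \<open>r\<close> and \<open>r'\<close>; it is closed by a limit along rational numbers.\<close>
  have upper: "emeasure \<nu>' {x \<in> space \<nu>'. fst x \<le> r \<and> snd x \<in> B} \<le> emeasure \<nu> {x \<in> space \<nu>. fst x \<le> r' \<and> snd x \<in> B}"
    if B: "B \<in> sets borel" and r: "r < r'" "r' \<in> Q" for r r' B
    unfolding e'c[OF B] fB[OF B]
  proof (rule nn_integral_mono_AE)
    show "AE w in lborel. emeasure lborel {\<eta>. 0 < \<eta> \<and> \<eta> < g w \<and> \<psi> (w, \<eta>) \<le> r} * indicator B w \<le> f r' w * indicator B w"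
      using good
    proof eventually_elim
      case (elim w)
      have "f r' w \<le> ennreal (g w)" using elim r(2) by blast
      then have "f r' w < top" by (rule le_less_trans) simp
      then have fr: "f r' w = ennreal (enn2real (f r' w))" by simp
      have "{\<eta>. 0 < \<eta> \<and> \<eta> < g w \<and> \<psi> (w, \<eta>) \<le> r} \<subseteq> {0<..<enn2real (f r' w)}"
      proof
        fix \<eta> assume \<eta>: "\<eta> \<in> {\<eta>. 0 < \<eta> \<and> \<eta> < g w \<and> \<psi> (w, \<eta>) \<le> r}"
        then have "\<psi> (w, \<eta>) < r'" using r by auto
        then obtain q where q: "q \<in> Q" "q < r'" "ennreal \<eta> < f q w"
          unfolding \<psi>_less using elim \<eta> by auto
        moreover have "f q w \<le> f r' w" using elim r(2) q less_imp_le by blast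
        ultimately have "ennreal \<eta> < f r' w" by (meson order_less_le_trans)
        then have "ennreal \<eta> < ennreal (enn2real (f r' w))" using fr by simp
        then have "\<eta> < enn2real (f r' w)" using \<eta> by (simp add: ennreal_less_iff)
        then show "\<eta> \<in> {0<..<enn2real (f r' w)}" using \<eta> by simp
      qed
      then have "emeasure lborel {\<eta>. 0 < \<eta> \<and> \<eta> < g w \<and> \<psi> (w, \<eta>) \<le> r} \<le> emeasure lborel {0<..<enn2real (f r' w)}"
        by (rule emeasure_mono) simp
      also have "\<dots> = f r' w" using fr by simp
      finally show ?case by (intro mult_right_mono) auto
    qed
  qed
  have lower: "emeasure \<nu> {x \<in> space \<nu>. fst x \<le> r \<and> snd x \<in> B} \<le> emeasure \<nu>' {x \<in> space \<nu>'. fst x \<le> r \<and> snd x \<in> B}"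
    if B: "B \<in> sets borel" and r: "r \<in> Q" for r B
    unfolding e'c[OF B] fB[OF B]
  proof (rule nn_integral_mono_AE)
    show "AE w in lborel. f r w * indicator B w \<le> emeasure lborel {\<eta>. 0 < \<eta> \<and> \<eta> < g w \<and> \<psi> (w, \<eta>) \<le> r} * indicator B w"
      using good
    proof eventually_elim
      case (elim w)
      have le: "f r w \<le> ennreal (g w)" using elim r by blast
      then have "f r w < top" by (rule le_less_trans) simp
      then have fr: "f r w = ennreal (enn2real (f r w))" by simp
      have frg: "enn2real (f r w) \<le> g w"
        using enn2real_mono[OF le] g_nonneg by simp
      have sub: "{0<..<enn2real (f r w)} \<subseteq> {\<eta>. 0 < \<eta> \<and> \<eta> < g w \<and> \<psi> (w, \<eta>) \<le> r}"
      proof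
        fix \<eta> assume \<eta>: "\<eta> \<in> {0<..<enn2real (f r w)}"
        then have "ennreal \<eta> < ennreal (enn2real (f r w))" by (simp add: ennreal_less_iff)
        then have l: "ennreal \<eta> < f r w" using fr by simp
        then have "\<psi> (w, \<eta>) \<le> r"
          using r bdd[of "\<lambda>r. ennreal \<eta> < f r w"] by (auto simp: \<psi>_def intro!: cInf_lower)
        then show "\<eta> \<in> {\<eta>. 0 < \<eta> \<and> \<eta> < g w \<and> \<psi> (w, \<eta>) \<le> r}" using \<eta> frg by auto
      qed
      have m: "{\<eta>. 0 < \<eta> \<and> \<eta> < g w \<and> \<psi> (w, \<eta>) \<le> r} \<in> sets lborel"
      proof -
        have "{\<eta> \<in> space borel. 0 < \<eta> \<and> \<eta> < g w \<and> \<psi> (w, \<eta>) \<le> r} \<in> sets borel" by measurable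
        then show ?thesis by simp
      qed
      have "f r w = emeasure lborel {0<..<enn2real (f r w)}" using fr by simp
      also have "\<dots> \<le> emeasure lborel {\<eta>. 0 < \<eta> \<and> \<eta> < g w \<and> \<psi> (w, \<eta>) \<le> r}"
        by (rule emeasure_mono[OF sub m])
      finally show ?case by (intro mult_right_mono) auto
    qed
  qed
  have "\<nu> = \<nu>'"
  proof (rule phase_measure_eqI[OF sets_nu prob_nu s'])
    fix c :: real and B :: "real set"
    assume c: "0 \<le> c" "c < 2 * pi" and B: "B \<in> sets borel"
    obtain q where q: "\<And>n. q n \<in> \<rat>" "\<And>n. c < q n" "\<And>n. q n < 2 * pi" "\<And>n. q (Suc n) < q n" "q \<longlonglongrightarrow> c"
      using rational_sequence[OF c(2)] by blast
    have qQ: "q n \<in> Q" for n using q(1-3)[of n] c by (auto simp: Q_def)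
    have dec: "decseq q" by (rule decseq_SucI) (use q(4) less_imp_le in blast)
    have lim: "emeasure L {x \<in> space L. fst x \<le> c \<and> snd x \<in> B} = (INF n. emeasure L {x \<in> space L. fst x \<le> q n \<and> snd x \<in> B})"
      if L: "sets L = sets phase_borel" "prob_space L" for L
    proof -
      interpret L: prob_space L by fact
      have "(INF n. emeasure L {x \<in> space L. fst x \<le> q n \<and> snd x \<in> B}) = emeasure L (\<Inter>n. {x \<in> space L. fst x \<le> q n \<and> snd x \<in> B})"
      proof (rule INF_emeasure_decseq')
        show "{x \<in> space L. fst x \<le> q n \<and> snd x \<in> B} \<in> sets L" for n
          by (rule phase_rect_sets[OF L(1) B])
        show "decseq (\<lambda>n. {x \<in> space L. fst x \<le> q n \<and> snd x \<in> B})"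
          unfolding decseq_def using decseqD[OF dec] by (auto intro: order_trans)
      qed (simp add: L.emeasure_eq_measure)
      also have "(\<Inter>n. {x \<in> space L. fst x \<le> q n \<and> snd x \<in> B}) = {x \<in> space L. fst x \<le> c \<and> snd x \<in> B}"
      proof (intro equalityI subsetI)
        fix x assume "x \<in> (\<Inter>n. {x \<in> space L. fst x \<le> q n \<and> snd x \<in> B})"
        then have x: "x \<in> space L" "snd x \<in> B" "\<And>n. fst x \<le> q n" by auto
        have "fst x \<le> c" by (rule LIMSEQ_le_const[OF q(5)]) (use x in auto)
        then show "x \<in> {x \<in> space L. fst x \<le> c \<and> snd x \<in> B}" using x by simp
      next
        fix x assume x: "x \<in> {x \<in> space L. fst x \<le> c \<and> snd x \<in> B}"
        have "fst x \<le> q n" for n using x q(2)[of n] by simp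
        then show "x \<in> (\<Inter>n. {x \<in> space L. fst x \<le> q n \<and> snd x \<in> B})" using x by simp
      qed
      finally show ?thesis by simp
    qed
    show "emeasure \<nu> {x \<in> space \<nu>. fst x \<le> c \<and> snd x \<in> B} = emeasure \<nu>' {x \<in> space \<nu>'. fst x \<le> c \<and> snd x \<in> B}"
      unfolding lim[OF sets_nu prob_nu] lim[OF s' p']
    proof (rule antisym)
      show "(INF n. emeasure \<nu> {x \<in> space \<nu>. fst x \<le> q n \<and> snd x \<in> B}) \<le> (INF n. emeasure \<nu>' {x \<in> space \<nu>'. fst x \<le> q n \<and> snd x \<in> B})"
        by (intro INF_mono) (use lower[OF B qQ] in auto)
      show "(INF n. emeasure \<nu>' {x \<in> space \<nu>'. fst x \<le> q n \<and> snd x \<in> B}) \<le> (INF n. emeasure \<nu> {x \<in> space \<nu>. fst x \<le> q n \<and> snd x \<in> B})"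
        by (rule INF_greatest, rule INF_lower2[where i="Suc _"]) (use upper[OF B q(4) qQ] in auto)
    qed
  qed
  then have main: "emeasure \<nu> S = (\<integral>\<^sup>+w. emeasure (\<kappa> w) {\<theta> \<in> {0..<2 * pi}. (\<theta>, w) \<in> S} \<partial>lborel)"
    if S: "S \<in> sets phase_borel" for S
  proof -
    have "emeasure (\<kappa> w) {\<theta> \<in> {0..<2 * pi}. (\<theta>, w) \<in> S}
       = (\<integral>\<^sup>+\<eta>. indicator S (\<psi> (w, \<eta>), w) * indicator {0<..<g w} \<eta> \<partial>lborel)" for w
      unfolding \<kappa>_eq[OF phase_section[OF S]]
      by (intro nn_integral_cong) (use \<psi>_range in \<open>auto simp: indicator_def\<close>)
    then show ?thesis using e'[OF S] \<open>\<nu> = \<nu>'\<close> by simp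
  qed
  have "disintegrates g \<nu> \<kappa>"
    unfolding disintegrates_def
  proof (intro conjI allI ballI)
    fix w
    show "sets (\<kappa> w) = sets circle_borel" by (simp add: \<kappa>_def)
    have "{0..<2 * pi} \<in> sets circle_borel" by (simp add: circle_borel_iff)
    then have "emeasure (\<kappa> w) {0..<2 * pi}
        = (\<integral>\<^sup>+\<eta>. indicator {0..<2 * pi} (\<psi> (w, \<eta>)) * indicator {0<..<g w} \<eta> \<partial>lborel)"
      by (rule \<kappa>_eq)
    also have "\<dots> = (\<integral>\<^sup>+\<eta>. indicator {0<..<g w} \<eta> \<partial>lborel)"
      by (intro nn_integral_cong) (use \<psi>_range in \<open>auto simp: indicator_def\<close>)
    finally have "emeasure (\<kappa> w) {0..<2 * pi} = (\<integral>\<^sup>+\<eta>. indicator {0<..<g w} \<eta> \<partial>lborel)" .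
    then show "emeasure (\<kappa> w) {0..<2 * pi} = ennreal (g w)" by (simp add: g_nonneg)
  next
    fix A assume A: "A \<in> sets circle_borel"
    then have [measurable]: "A \<in> sets borel" using circle_borel_iff by blast
    have "(\<lambda>z. indicator A (\<psi> z) * indicator {0<..<g (fst z)} (snd z) :: ennreal) \<in> borel_measurable (borel \<Otimes>\<^sub>M borel)"
      using mass_indicator_measurable[OF g_measurable] by measurable
    then have "(\<lambda>z. indicator A (\<psi> z) * indicator {0<..<g (fst z)} (snd z) :: ennreal) \<in> borel_measurable (borel \<Otimes>\<^sub>M lborel)"
      by (simp cong: measurable_cong_sets sets_pair_measure_cong)
    then have "(\<lambda>w. \<integral>\<^sup>+\<eta>. indicator A (\<psi> (w, \<eta>)) * indicator {0<..<g (fst (w, \<eta>))} (snd (w, \<eta>)) \<partial>lborel) \<in> borel_measurable borel"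
      by (rule lborel.borel_measurable_nn_integral_fst)
    then show "(\<lambda>w. emeasure (\<kappa> w) A) \<in> borel_measurable borel" using A by (simp add: \<kappa>_eq)
  qed (rule main)
  then show ?thesis by blast
qed

subsection \<open>The pseudo-inverse as a quantile function\<close>

text \<open>The pseudo-inverse refers to a disintegration chosen by a description operator; the existence result shows
  that the choice has the defining properties.\<close>

definition cond :: "real \<Rightarrow> real measure" where
  "cond = disintegration g \<nu>"

lemma disintegrates_cond: "disintegrates g \<nu> cond"
  unfolding cond_def disintegration_def using exists_disintegration by (rule someI_ex)

lemma sets_cond: "sets (cond w) = sets circle_borel"
  and mass_cond: "emeasure (cond w) {0..<2 * pi} = ennreal (g w)"
  and measurable_cond: "A \<in> sets circle_borel \<Longrightarrow> (\<lambda>w. emeasure (cond w) A) \<in> borel_measurable borel"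
  and nu_cond: "S \<in> sets phase_borel \<Longrightarrow>
      emeasure \<nu> S = (\<integral>\<^sup>+w. emeasure (cond w) {\<theta> \<in> {0..<2 * pi}. (\<theta>, w) \<in> S} \<partial>lborel)"
  using disintegrates_cond by (auto simp: disintegrates_def)

lemma space_cond: "space (cond w) = {0..<2 * pi}"
  by (rule space_circle[OF sets_cond])

lemma finite_cond: "finite_measure (cond w)"
  by (rule finite_measureI) (simp add: space_cond mass_cond)

lemma measure_cond_space: "measure (cond w) {0..<2 * pi} = g w"
  using mass_cond g_nonneg by (simp add: measure_def)

text \<open>Mass on either side of a point. Open and closed half lines are distinguished, because the conditional
  measures may have atoms.\<close>

definition mle where "mle c w = measure (cond w) {\<theta> \<in> {0..<2 * pi}. \<theta> \<le> c}"
definition mlt where "mlt c w = measure (cond w) {\<theta> \<in> {0..<2 * pi}. \<theta> < c}"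
definition mge where "mge c w = measure (cond w) {\<theta> \<in> {0..<2 * pi}. c \<le> \<theta>}"
definition mgt where "mgt c w = measure (cond w) {\<theta> \<in> {0..<2 * pi}. c < \<theta>}"

lemma half_sets: "{\<theta> \<in> {0..<2 * pi}. P \<theta>} \<in> sets circle_borel" if "Measurable.pred borel P" for P
proof -
  note [measurable] = that
  have "{\<theta> \<in> space borel. 0 \<le> \<theta> \<and> \<theta> < 2 * pi \<and> P \<theta>} \<in> sets borel" by measurable
  then show ?thesis by (simp add: circle_borel_iff conj_assoc) auto
qed

lemma half_sets_cond: "{\<theta> \<in> {0..<2 * pi}. P \<theta>} \<in> sets (cond w)" if "Measurable.pred borel P" for P
  unfolding sets_cond by (rule half_sets[OF that])

lemma nu_halfs:
  assumes P: "Measurable.pred borel P" and B: "B \<in> sets borel"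
  shows "emeasure \<nu> {x \<in> space \<nu>. P (fst x) \<and> snd x \<in> B}
    = (\<integral>\<^sup>+w. ennreal (measure (cond w) {\<theta> \<in> {0..<2 * pi}. P \<theta>}) * indicator B w \<partial>lborel)"
proof -
  note [measurable] = P B
  have S: "{x \<in> space \<nu>. P (fst x) \<and> snd x \<in> B} \<in> sets phase_borel"
    unfolding sets_nu[symmetric] by (rule sets_phaseI[OF sets_nu]) measurable
  interpret C: finite_measure "cond w" for w by (rule finite_cond)
  have "emeasure (cond w) {\<theta> \<in> {0..<2 * pi}. (\<theta>, w) \<in> {x \<in> space \<nu>. P (fst x) \<and> snd x \<in> B}}
     = ennreal (measure (cond w) {\<theta> \<in> {0..<2 * pi}. P \<theta>}) * indicator B w" for w
  proof (cases "w \<in> B")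
    case True
    then have "{\<theta> \<in> {0..<2 * pi}. (\<theta>, w) \<in> {x \<in> space \<nu>. P (fst x) \<and> snd x \<in> B}} = {\<theta> \<in> {0..<2 * pi}. P \<theta>}"
      by (auto simp: space_phase[OF sets_nu])
    then show ?thesis using True by (simp only: C.emeasure_eq_measure) simp
  next
    case False
    then have "{\<theta> \<in> {0..<2 * pi}. (\<theta>, w) \<in> {x \<in> space \<nu>. P (fst x) \<and> snd x \<in> B}} = {}" by auto
    then show ?thesis using False by (simp only: emeasure_empty) simp
  qed
  then show ?thesis using nu_cond[OF S] by simp
qed

lemma measurable_half: "Measurable.pred borel P \<Longrightarrow> (\<lambda>w. measure (cond w) {\<theta> \<in> {0..<2 * pi}. P \<theta>}) \<in> borel_measurable borel"
  unfolding measure_def by (intro borel_measurable_enn2real measurable_cond half_sets)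

lemma m_le_g: "measure (cond w) {\<theta> \<in> {0..<2 * pi}. P \<theta>} \<le> g w"
proof -
  interpret C: finite_measure "cond w" by (rule finite_cond)
  show ?thesis using C.bounded_measure[of "{\<theta> \<in> {0..<2 * pi}. P \<theta>}"] by (simp add: space_cond measure_cond_space)
qed

lemma m_mono:
  assumes "\<And>\<theta>. 0 \<le> \<theta> \<Longrightarrow> \<theta> < 2 * pi \<Longrightarrow> P \<theta> \<Longrightarrow> Q \<theta>" "Measurable.pred borel Q"
  shows "measure (cond w) {\<theta> \<in> {0..<2 * pi}. P \<theta>} \<le> measure (cond w) {\<theta> \<in> {0..<2 * pi}. Q \<theta>}"
proof -
  interpret C: finite_measure "cond w" by (rule finite_cond)
  show ?thesis using assms(1) by (intro C.finite_measure_mono half_sets_cond[OF assms(2)]) auto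
qed

lemma m_compl:
  assumes "Measurable.pred borel P"
  shows "measure (cond w) {\<theta> \<in> {0..<2 * pi}. \<not> P \<theta>} = g w - measure (cond w) {\<theta> \<in> {0..<2 * pi}. P \<theta>}"
proof -
  interpret C: finite_measure "cond w" by (rule finite_cond)
  have "{\<theta> \<in> {0..<2 * pi}. \<not> P \<theta>} = space (cond w) - {\<theta> \<in> {0..<2 * pi}. P \<theta>}" by (auto simp: space_cond)
  then show ?thesis using C.finite_measure_compl[OF half_sets_cond[OF assms]] by (simp add: space_cond measure_cond_space)
qed

lemma cdf_eq: "c < 2 * pi \<Longrightarrow> measure (cond w) {0..c} = mle c w"
  unfolding mle_def by (rule arg_cong2[where f=measure]) auto

text \<open>The value \<open>0\<close> outside the region under the graph of \<open>g\<close> keeps the function in \<open>[0, 2\<pi>)\<close> and measurable on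
  the whole plane.\<close>

definition quantile :: "real \<times> real \<Rightarrow> real" where
  "quantile z = (if 0 < snd z \<and> snd z < g (fst z) then pseudo_inverse g \<nu> (snd z) (fst z) else 0)"

lemma quantile_eq: "0 < \<eta> \<Longrightarrow> \<eta> < g w \<Longrightarrow> quantile (w, \<eta>) = Inf {\<theta> \<in> {0..<2 * pi}. \<eta> < mle \<theta> w}"
  unfolding quantile_def pseudo_inverse_def cond_def[symmetric]
  by (auto simp: cdf_eq intro!: arg_cong[where f=Inf])

lemma mle_exceeds:
  assumes "\<eta> < g w" shows "\<exists>c\<in>{0..<2 * pi}. \<eta> < mle c w"
proof -
  interpret C: finite_measure "cond w" by (rule finite_cond)
  define c where "c n = 2 * pi - 2 * pi / real (Suc n)" for n
  have c: "0 \<le> c n" "c n < 2 * pi" for n by (auto simp: c_def field_simps)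
  have c_mono: "c m \<le> c n" if "m \<le> n" for m n using that by (auto simp: c_def intro!: divide_left_mono)
  have c_ex: "\<exists>n. y \<le> c n" if "y < 2 * pi" for y
  proof -
    have "c \<longlonglongrightarrow> 2 * pi - 0" unfolding c_def by (intro tendsto_intros LIMSEQ_Suc lim_const_over_n)
    then have "\<forall>\<^sub>F n in sequentially. y < c n" using that by (intro order_tendstoD(1)) auto
    then show ?thesis by (meson eventually_happens less_imp_le sequentially_bot)
  qed
  have "(\<lambda>n. measure (cond w) {\<theta> \<in> {0..<2 * pi}. \<theta> \<le> c n}) \<longlonglongrightarrow> measure (cond w) (\<Union>n. {\<theta> \<in> {0..<2 * pi}. \<theta> \<le> c n})"
  proof (rule C.finite_Lim_measure_incseq)
    show "range (\<lambda>n. {\<theta> \<in> {0..<2 * pi}. \<theta> \<le> c n}) \<subseteq> sets (cond w)"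
      by (rule image_subsetI, rule half_sets_cond) measurable
    show "incseq (\<lambda>n. {\<theta> \<in> {0..<2 * pi}. \<theta> \<le> c n})" unfolding incseq_def using c_mono by (auto intro: order_trans)
  qed
  moreover have "(\<Union>n. {\<theta> \<in> {0..<2 * pi}. \<theta> \<le> c n}) = {0..<2 * pi}" using c_ex by auto
  ultimately have "(\<lambda>n. mle (c n) w) \<longlonglongrightarrow> g w" by (simp add: mle_def measure_cond_space)
  then have "\<forall>\<^sub>F n in sequentially. \<eta> < mle (c n) w" using assms by (rule order_tendstoD(1))
  then obtain n where "\<eta> < mle (c n) w" by (meson eventually_happens sequentially_bot)
  then show ?thesis using c by (intro bexI[of _ "c n"]) auto
qed

lemma mle_mono: "c \<le> d \<Longrightarrow> mle c w \<le> mle d w"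
  unfolding mle_def by (rule m_mono) auto

lemma mle_right_continuous:
  assumes c: "c < 2 * pi" and gt: "\<And>d. c < d \<Longrightarrow> d < 2 * pi \<Longrightarrow> \<eta> \<le> mle d w"
  shows "\<eta> \<le> mle c w"
proof -
  interpret C: finite_measure "cond w" by (rule finite_cond)
  obtain q where q: "\<And>n. q n \<in> \<rat>" "\<And>n. c < q n" "\<And>n. q n < 2 * pi" "\<And>n. q (Suc n) < q n" "q \<longlonglongrightarrow> c"
    using rational_sequence[OF c] by blast
  have dec: "decseq q" by (rule decseq_SucI) (use q(4) less_imp_le in blast)
  have "(\<lambda>n. measure (cond w) {\<theta> \<in> {0..<2 * pi}. \<theta> \<le> q n}) \<longlonglongrightarrow> measure (cond w) (\<Inter>n. {\<theta> \<in> {0..<2 * pi}. \<theta> \<le> q n})"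
  proof (rule C.finite_Lim_measure_decseq)
    show "range (\<lambda>n. {\<theta> \<in> {0..<2 * pi}. \<theta> \<le> q n}) \<subseteq> sets (cond w)"
      by (rule image_subsetI, rule half_sets_cond) measurable
    show "decseq (\<lambda>n. {\<theta> \<in> {0..<2 * pi}. \<theta> \<le> q n})"
      unfolding decseq_def using decseqD[OF dec] by (auto intro: order_trans)
  qed
  moreover have "(\<Inter>n. {\<theta> \<in> {0..<2 * pi}. \<theta> \<le> q n}) = {\<theta> \<in> {0..<2 * pi}. \<theta> \<le> c}"
  proof (intro equalityI subsetI)
    fix x assume "x \<in> (\<Inter>n. {\<theta> \<in> {0..<2 * pi}. \<theta> \<le> q n})"
    then have x: "x \<in> {0..<2 * pi}" "\<And>n. x \<le> q n" by auto
    have "x \<le> c" by (rule LIMSEQ_le_const[OF q(5)]) (use x in auto)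
    then show "x \<in> {\<theta> \<in> {0..<2 * pi}. \<theta> \<le> c}" using x by simp
  next
    fix x assume x: "x \<in> {\<theta> \<in> {0..<2 * pi}. \<theta> \<le> c}"
    have "x \<le> q n" for n using x q(2)[of n] by simp
    then show "x \<in> (\<Inter>n. {\<theta> \<in> {0..<2 * pi}. \<theta> \<le> q n})" using x by simp
  qed
  ultimately have "(\<lambda>n. mle (q n) w) \<longlonglongrightarrow> mle c w" by (simp add: mle_def)
  then show ?thesis by (rule LIMSEQ_le_const) (use gt q in auto)
qed

context
  fixes \<eta> w :: real assumes \<eta>: "0 < \<eta>" "\<eta> < g w"
begin

lemma quantile_bdd: "bdd_below {\<theta> \<in> {0..<2 * pi}. \<eta> < mle \<theta> w}"
  by (rule bdd_belowI[of _ 0]) auto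

lemma quantile_less_iff:
  "quantile (w, \<eta>) < c \<longleftrightarrow> (\<exists>r\<in>{0..<2 * pi}. r < c \<and> \<eta> < mle r w)"
proof -
  have "{\<theta> \<in> {0..<2 * pi}. \<eta> < mle \<theta> w} \<noteq> {}" using mle_exceeds[OF \<eta>(2)] by auto
  from cInf_less_iff[OF this quantile_bdd, of c] show ?thesis unfolding quantile_eq[OF \<eta>] by auto
qed

lemma quantile_range: "quantile (w, \<eta>) \<in> {0..<2 * pi}"
proof -
  have "0 \<le> quantile (w, \<eta>)"
    unfolding quantile_eq[OF \<eta>] using mle_exceeds[OF \<eta>(2)] by (intro cInf_greatest) auto
  moreover have "quantile (w, \<eta>) < 2 * pi"
    unfolding quantile_less_iff using mle_exceeds[OF \<eta>(2)] by auto
  ultimately show ?thesis by simp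
qed

lemma quantile_le: "0 \<le> c \<Longrightarrow> c < 2 * pi \<Longrightarrow> \<eta> < mle c w \<Longrightarrow> quantile (w, \<eta>) \<le> c"
  unfolding quantile_eq[OF \<eta>] by (intro cInf_lower quantile_bdd) auto

lemma less_mle: "quantile (w, \<eta>) < c \<Longrightarrow> \<eta> < mle c w"
  unfolding quantile_less_iff using mle_mono[of _ c w] by (meson less_imp_le order_less_le_trans)

lemma le_mle: "quantile (w, \<eta>) \<le> c \<Longrightarrow> c < 2 * pi \<Longrightarrow> \<eta> \<le> mle c w"
  by (rule mle_right_continuous) (auto intro!: less_imp_le less_mle)

end

lemma quantile_bounds: "0 \<le> quantile z" "quantile z < 2 * pi"
  using quantile_range[of "snd z" "fst z"] pi_gt_zero by (auto simp: quantile_def)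

lemma quantile_measurable [measurable]: "quantile \<in> borel_measurable (borel \<Otimes>\<^sub>M borel)"
proof (rule borel_measurableI_less)
  fix c :: real
  define Q where "Q = \<rat> \<inter> {0..<2 * pi}"
  have Qc: "countable Q" unfolding Q_def by (rule countable_subset[OF _ countable_rat]) auto
  have [measurable]: "mle r \<in> borel_measurable borel" for r
    unfolding mle_def[abs_def] by (rule measurable_half) measurable
  define A where "A r = {z \<in> space (borel \<Otimes>\<^sub>M borel). 0 < snd z \<and> snd z < g (fst z) \<and> snd z < mle r (fst z)}" for r
  define N where "N = {z \<in> space (borel \<Otimes>\<^sub>M borel). \<not> (0 < snd z \<and> snd z < g (fst z)) \<and> 0 < c}"
  have A: "A r \<in> sets (borel \<Otimes>\<^sub>M borel)" for r unfolding A_def by measurable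
  have N: "N \<in> sets (borel \<Otimes>\<^sub>M borel)" unfolding N_def by measurable
  have U: "(\<Union>r\<in>Q \<inter> {..<c}. A r) \<in> sets (borel \<Otimes>\<^sub>M borel)"
    by (intro sets.countable_UN'' A countable_Int1 Qc)
  have "{z \<in> space (borel \<Otimes>\<^sub>M borel). quantile z < c} = (\<Union>r\<in>Q \<inter> {..<c}. A r) \<union> N"
  proof (intro set_eqI)
    fix z :: "real \<times> real"
    obtain w \<eta> where z: "z = (w, \<eta>)" by (cases z)
    show "z \<in> {z \<in> space (borel \<Otimes>\<^sub>M borel). quantile z < c} \<longleftrightarrow> z \<in> (\<Union>r\<in>Q \<inter> {..<c}. A r) \<union> N"
    proof (cases "0 < \<eta> \<and> \<eta> < g w")
      case False
      then show ?thesis by (auto simp: z A_def N_def quantile_def space_pair_measure)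
    next
      case True
      have "quantile (w, \<eta>) < c \<longleftrightarrow> (\<exists>r\<in>Q \<inter> {..<c}. \<eta> < mle r w)"
      proof
        assume l: "quantile (w, \<eta>) < c"
        have qr: "quantile (w, \<eta>) \<in> {0..<2 * pi}" using quantile_range True by blast
        then obtain r where r: "r \<in> \<rat>" "quantile (w, \<eta>) < r" "r < min c (2 * pi)"
          using Rats_dense_in_real[of "quantile (w, \<eta>)" "min c (2 * pi)"] l by auto
        have "\<eta> < mle r w" using less_mle[OF _ _ r(2)] True by blast
        then show "\<exists>r\<in>Q \<inter> {..<c}. \<eta> < mle r w" using r qr by (intro bexI[of _ r]) (auto simp: Q_def)
      next
        assume "\<exists>r\<in>Q \<inter> {..<c}. \<eta> < mle r w"
        then show "quantile (w, \<eta>) < c" using True by (subst quantile_less_iff) (auto simp: Q_def)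
      qed
      then show ?thesis using True by (auto simp: z A_def N_def space_pair_measure)
    qed
  qed
  then show "{z \<in> space (borel \<Otimes>\<^sub>M borel). quantile z < c} \<in> sets (borel \<Otimes>\<^sub>M borel)" using U N by simp
qed

lemma quantile_pair_measurable: "(\<lambda>z. (quantile z, fst z)) \<in> measurable (mass_space g) phase_borel"
  unfolding phase_borel_def
proof (rule measurable_restrict_space2)
  show "(\<lambda>z. (quantile z, fst z)) \<in> space (mass_space g) \<rightarrow> {0..<2 * pi} \<times> UNIV" using quantile_bounds by auto
  have "(\<lambda>z. (quantile z, fst z)) \<in> measurable (borel \<Otimes>\<^sub>M borel) (borel \<Otimes>\<^sub>M borel)" by measurable
  then have "(\<lambda>z. (quantile z, fst z)) \<in> measurable (mass_space g) (borel \<Otimes>\<^sub>M borel)"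
    by (simp cong: measurable_cong_sets)
  then show "(\<lambda>z. (quantile z, fst z)) \<in> measurable (mass_space g) borel" by (simp only: borel_prod)
qed

text \<open>The pseudo-inverse represents the measure: this turns integrals over the phase space into integrals over
  the region under the graph of \<open>g\<close>, which is the same for all measures with frequency density \<open>g\<close>.\<close>

lemma distr_quantile: "distr (mass_space g) phase_borel (\<lambda>z. (quantile z, fst z)) = \<nu>"
proof (rule phase_measure_eqI[symmetric, OF sets_nu prob_nu])
  show s': "sets (distr (mass_space g) phase_borel (\<lambda>z. (quantile z, fst z))) = sets phase_borel" by simp
  fix c :: real and B :: "real set"
  assume c: "0 \<le> c" "c < 2 * pi" and B [measurable]: "B \<in> sets borel"
  let ?N = "distr (mass_space g) phase_borel (\<lambda>z. (quantile z, fst z))"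
  have S: "{x \<in> space ?N. fst x \<le> c \<and> snd x \<in> B} \<in> sets phase_borel"
    using phase_rect_sets[OF s' B] by (simp only: s')
  have Sb [measurable]: "{x \<in> space ?N. fst x \<le> c \<and> snd x \<in> B} \<in> sets (borel \<Otimes>\<^sub>M borel)" by (rule phase_setsI[OF S])
  have sp: "space ?N = {0..<2 * pi} \<times> UNIV" by (rule space_phase[OF s'])
  have em: "emeasure lborel {\<eta>. 0 < \<eta> \<and> \<eta> < g w \<and> quantile (w, \<eta>) \<le> c} = ennreal (mle c w)"
    and ms: "{\<eta>. 0 < \<eta> \<and> \<eta> < g w \<and> quantile (w, \<eta>) \<le> c} \<in> sets lborel" for w
  proof -
    have "{\<eta> \<in> space borel. 0 < \<eta> \<and> \<eta> < g w \<and> quantile (w, \<eta>) \<le> c} \<in> sets borel" by measurable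
    then show m: "{\<eta>. 0 < \<eta> \<and> \<eta> < g w \<and> quantile (w, \<eta>) \<le> c} \<in> sets lborel" by simp
    have n: "0 \<le> mle c w" "mle c w \<le> g w" using m_le_g by (auto simp: mle_def)
    have "ennreal (mle c w) = emeasure lborel {0<..<mle c w}" using n by simp
    also have "\<dots> \<le> emeasure lborel {\<eta>. 0 < \<eta> \<and> \<eta> < g w \<and> quantile (w, \<eta>) \<le> c}"
      using quantile_le[OF _ _ c] n by (intro emeasure_mono m) auto
    finally have 1: "ennreal (mle c w) \<le> emeasure lborel {\<eta>. 0 < \<eta> \<and> \<eta> < g w \<and> quantile (w, \<eta>) \<le> c}" .
    have "emeasure lborel {\<eta>. 0 < \<eta> \<and> \<eta> < g w \<and> quantile (w, \<eta>) \<le> c} \<le> emeasure lborel {0..mle c w}"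
      using le_mle[OF _ _ _ c(2)] by (intro emeasure_mono) auto
    also have "\<dots> = ennreal (mle c w)" using n by simp
    finally show "emeasure lborel {\<eta>. 0 < \<eta> \<and> \<eta> < g w \<and> quantile (w, \<eta>) \<le> c} = ennreal (mle c w)"
      using 1 by (rule antisym)
  qed
  have "emeasure ?N {x \<in> space ?N. fst x \<le> c \<and> snd x \<in> B} = (\<integral>\<^sup>+x. indicator {x \<in> space ?N. fst x \<le> c \<and> snd x \<in> B} x \<partial>?N)"
    using S by simp
  also have "\<dots> = (\<integral>\<^sup>+z. indicator {x \<in> space ?N. fst x \<le> c \<and> snd x \<in> B} (quantile z, fst z) \<partial>mass_space g)"
    by (rule nn_integral_distr[OF quantile_pair_measurable]) (use S in simp)
  also have "\<dots> = (\<integral>\<^sup>+w. (\<integral>\<^sup>+\<eta>. indicator {x \<in> space ?N. fst x \<le> c \<and> snd x \<in> B} (quantile (w, \<eta>), fst (w, \<eta>)) * indicator {0<..<g w} \<eta> \<partial>lborel) \<partial>lborel)"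
    by (rule nn_integral_mass_space[OF g_measurable]) measurable
  also have "\<dots> = (\<integral>\<^sup>+w. (\<integral>\<^sup>+\<eta>. indicator {\<eta>. 0 < \<eta> \<and> \<eta> < g w \<and> quantile (w, \<eta>) \<le> c} \<eta> * indicator B w \<partial>lborel) \<partial>lborel)"
    using quantile_bounds by (intro nn_integral_cong) (auto simp: indicator_def space_phase[OF refl])
  also have "\<dots> = (\<integral>\<^sup>+w. ennreal (mle c w) * indicator B w \<partial>lborel)"
    using ms em by (simp add: nn_integral_multc)
  also have "\<dots> = emeasure \<nu> {x \<in> space \<nu>. fst x \<le> c \<and> snd x \<in> B}"
    unfolding mle_def by (rule nu_halfs[symmetric]) (use B in auto)
  finally show "emeasure \<nu> {x \<in> space \<nu>. fst x \<le> c \<and> snd x \<in> B} = emeasure ?N {x \<in> space ?N. fst x \<le> c \<and> snd x \<in> B}" by simp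
qed

lemma integral_quantile:
  fixes f :: "real \<times> real \<Rightarrow> real"
  assumes [measurable]: "f \<in> borel_measurable (borel \<Otimes>\<^sub>M borel)"
  shows "(LINT x|\<nu>. f x) = (LINT z|mass_space g. f (quantile z, fst z))"
proof -
  have "f \<in> borel_measurable phase_borel" by (rule borel_measurable_phase[OF refl]) fact
  from integral_distr[OF quantile_pair_measurable this] show ?thesis by (simp only: distr_quantile)
qed

lemma AE_quantile:
  assumes P: "Measurable.pred (borel \<Otimes>\<^sub>M borel) P" and "AE x in \<nu>. P x"
  shows "AE z in mass_space g. P (quantile z, fst z)"
proof -
  have "{x \<in> space phase_borel. P x} \<in> sets phase_borel" by (rule sets_phaseI[OF refl P])
  from AE_distr_iff[OF quantile_pair_measurable this] show ?thesis
    using assms(2) by (simp only: distr_quantile)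
qed

end

subsection \<open>Comparison of measures on intervals\<close>

text \<open>The difference of the two distribution functions is monotone and hence itself the distribution function of a
  measure. It fills the gap between \<open>M1\<close> and \<open>M2\<close> on intervals, and therefore on all Borel sets.\<close>

lemma measure_le_if_le_on_intervals:
  fixes M1 M2 :: "real measure"
  assumes M1: "finite_borel_measure M1" and M2: "finite_borel_measure M2"
    and le: "\<And>x y. x < y \<Longrightarrow> measure M1 {x<..y} \<le> measure M2 {x<..y}"
    and B: "B \<in> sets borel"
  shows "emeasure M1 B \<le> emeasure M2 B"
proof -
  interpret M1: finite_borel_measure M1 by (rule M1)
  interpret M2: finite_borel_measure M2 by (rule M2)
  define F where "F x = cdf M2 x - cdf M1 x" for x
  define M3 where "M3 = interval_measure F"
  have F_diff: "F y - F x = measure M2 {x<..y} - measure M1 {x<..y}" if "x < y" for x y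
    using M1.cdf_diff_eq[OF that] M2.cdf_diff_eq[OF that] by (simp add: F_def)
  have F_mono: "F x \<le> F y" if "x \<le> y" for x y
    using F_diff[of x y] le[of x y] that by (cases "x = y") auto
  have F_cont: "continuous (at_right a) F" for a
    unfolding F_def using M1.cdf_is_right_cont M2.cdf_is_right_cont by (intro continuous_diff)
  have M3: "emeasure M3 {x<..y} = ennreal (F y - F x)" if "x \<le> y" for x y
    unfolding M3_def by (rule emeasure_interval_measure_Ioc[OF that F_mono F_cont])
  define G where "G = range (\<lambda>(a, b). {a<..b :: real})"
  have sG: "sets borel = sigma_sets UNIV G"
    unfolding G_def borel_sigma_sets_Ioc by (simp add: sets_measure_of)
  have s3: "sets M3 = sets borel" by (simp add: M3_def)
  have s1: "sets M1 = sets borel" and s2: "sets M2 = sets borel"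
    using M1 M2 by (auto simp: finite_borel_measure_def finite_borel_measure_axioms_def)
  have Ioc: "emeasure M2 {x<..y} = emeasure M1 {x<..y} + emeasure M3 {x<..y}" for x y
  proof (cases "x < y")
    case True
    then have "emeasure M1 {x<..y} + emeasure M3 {x<..y} = ennreal (measure M1 {x<..y} + (F y - F x))"
      using M3[of x y] F_mono[of x y] by (simp add: M1.emeasure_eq_measure ennreal_plus)
    also have "measure M1 {x<..y} + (F y - F x) = measure M2 {x<..y}" using F_diff[OF True] by simp
    finally show ?thesis by (simp add: M2.emeasure_eq_measure)
  qed simp
  have U: "(SUP n. emeasure M {- real n<..real n}) = emeasure M UNIV" if "sets M = sets borel" for M
  proof -
    have "(SUP n. emeasure M {- real n<..real n}) = emeasure M (\<Union>n. {- real n<..real n})"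
      by (rule SUP_emeasure_incseq) (auto simp: incseq_def that)
    also have "(\<Union>n. {- real n<..real n}) = UNIV"
    proof (intro set_eqI iffI UNIV_I)
      fix x :: real
      obtain n where "\<bar>x\<bar> < real n" using reals_Archimedean2 by blast
      then show "x \<in> (\<Union>n. {- real n<..real n})" by (intro UN_I[of n]) auto
    qed
    finally show ?thesis .
  qed
  have UNIV: "emeasure M2 UNIV = emeasure M1 UNIV + emeasure M3 UNIV"
  proof -
    have "emeasure M2 UNIV = (SUP n. emeasure M1 {- real n<..real n} + emeasure M3 {- real n<..real n})"
      using U[OF s2] by (simp add: Ioc)
    also have "\<dots> = (SUP n. emeasure M1 {- real n<..real n}) + (SUP n. emeasure M3 {- real n<..real n})"
      by (intro ennreal_SUP_add) (auto simp: incseq_def s1 s3 intro!: emeasure_mono)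
    finally show ?thesis using U[OF s1] U[OF s3] by simp
  qed
  have fin: "emeasure M1 UNIV \<noteq> \<infinity>" "emeasure M2 UNIV \<noteq> \<infinity>"
    using M1.emeasure_finite M2.emeasure_finite by auto
  have fin3: "emeasure M3 UNIV \<noteq> \<infinity>" using UNIV fin by auto
  have "emeasure M2 B = emeasure M1 B + emeasure M3 B"
  proof (rule sigma_sets_induct_disjoint[where \<Omega>=UNIV and G=G and P="\<lambda>B. emeasure M2 B = emeasure M1 B + emeasure M3 B"])
    show "Int_stable G"
    proof (rule Int_stableI)
      fix A C assume "A \<in> G" "C \<in> G"
      then obtain x y u v where "A = {x<..y}" "C = {u<..v}" by (auto simp: G_def)
      then have "A \<inter> C = {max x u<..min y v}" by auto
      then show "A \<inter> C \<in> G" by (auto simp: G_def intro!: image_eqI[of _ _ "(max x u, min y v)"])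
    qed
    show "G \<subseteq> Pow UNIV" by simp
    show "B \<in> sigma_sets UNIV G" using B sG by simp
    show "emeasure M2 A = emeasure M1 A + emeasure M3 A" if "A \<in> G" for A
      using that Ioc by (auto simp: G_def)
    show "emeasure M2 {} = emeasure M1 {} + emeasure M3 {}" by simp
  next
    fix A assume A: "A \<in> sigma_sets UNIV G" and IH: "emeasure M2 A = emeasure M1 A + emeasure M3 A"
    have As: "A \<in> sets borel" using A sG by simp
    have c: "emeasure M A + emeasure M (UNIV - A) = emeasure M UNIV" if "sets M = sets borel" for M
    proof -
      have "emeasure M A + emeasure M (UNIV - A) = emeasure M (A \<union> (UNIV - A))"
        using As sets.compl_sets[OF As] by (intro plus_emeasure) (auto simp: that)
      then show ?thesis by simp
    qed
    have le: "emeasure M A \<noteq> \<infinity>" if "sets M = sets borel" "emeasure M UNIV \<noteq> \<infinity>" for M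
      using emeasure_mono[of A UNIV M] that by (auto simp: top_unique)
    have "emeasure M2 A + emeasure M2 (UNIV - A) = (emeasure M1 A + emeasure M1 (UNIV - A)) + (emeasure M3 A + emeasure M3 (UNIV - A))"
      using c[OF s1] c[OF s2] c[OF s3] UNIV by simp
    also have "\<dots> = emeasure M2 A + (emeasure M1 (UNIV - A) + emeasure M3 (UNIV - A))"
      by (simp add: IH ac_simps)
    finally show "emeasure M2 (UNIV - A) = emeasure M1 (UNIV - A) + emeasure M3 (UNIV - A)"
      using le[OF s2 fin(2)] by (simp add: ennreal_add_left_cancel)
  next
    fix A :: "nat \<Rightarrow> real set"
    assume d: "disjoint_family A" and A: "range A \<subseteq> sigma_sets UNIV G"
      and IH: "\<And>i. emeasure M2 (A i) = emeasure M1 (A i) + emeasure M3 (A i)"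
    have As: "range A \<subseteq> sets M" if "sets M = sets borel" for M using A sG that by simp
    have "emeasure M2 (\<Union>i. A i) = (\<Sum>i. emeasure M1 (A i) + emeasure M3 (A i))"
      using suminf_emeasure[OF As[OF s2] d] IH by simp
    also have "\<dots> = (\<Sum>i. emeasure M1 (A i)) + (\<Sum>i. emeasure M3 (A i))"
      by (rule suminf_add[symmetric]) auto
    finally show "emeasure M2 (\<Union>i. A i) = emeasure M1 (\<Union>i. A i) + emeasure M3 (\<Union>i. A i)"
      using suminf_emeasure[OF As[OF s1] d] suminf_emeasure[OF As[OF s3] d] by simp
  qed
  then show ?thesis by simp
qed

text \<open>Localization of the previous lemma to frequencies in \<open>(l, r)\<close>: an inequality of integrals over intervals
  becomes an inequality of densities.\<close>

lemma AE_le_if_le_on_intervals: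
  fixes f h :: "real \<Rightarrow> real"
  assumes f [measurable]: "f \<in> borel_measurable borel" and h [measurable]: "h \<in> borel_measurable borel"
    and fin: "(\<integral>\<^sup>+w. ennreal (f w) \<partial>lborel) < \<infinity>" "(\<integral>\<^sup>+w. ennreal (h w) \<partial>lborel) < \<infinity>"
    and nonneg: "\<And>w. 0 \<le> h w"
    and le: "\<And>p q. l \<le> p \<Longrightarrow> q \<le> r \<Longrightarrow> p < q \<Longrightarrow> (\<integral>\<^sup>+w. ennreal (f w) * indicator {p<..<q} w \<partial>lborel)
        \<le> (\<integral>\<^sup>+w. ennreal (h w) * indicator {p<..<q} w \<partial>lborel)"
  shows "AE w in lborel. l < w \<and> w < r \<longrightarrow> f w \<le> h w"
proof -
  define D where "D u = density lborel (\<lambda>w. ennreal (u w) * indicator {l<..<r} w)" for u :: "real \<Rightarrow> real"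
  have eD: "emeasure (D u) B = (\<integral>\<^sup>+w. ennreal (u w) * indicator {l<..<r} w * indicator B w \<partial>lborel)"
    if "u \<in> borel_measurable borel" "B \<in> sets borel" for u B
    unfolding D_def using that by (subst emeasure_density) auto
  have fD: "finite_borel_measure (D u)" if u [measurable]: "u \<in> borel_measurable borel" and fu: "(\<integral>\<^sup>+w. ennreal (u w) \<partial>lborel) < \<infinity>" for u
  proof -
    have "emeasure (D u) UNIV \<le> (\<integral>\<^sup>+w. ennreal (u w) \<partial>lborel)"
      by (subst eD) (auto intro!: nn_integral_mono simp: indicator_def)
    then have "emeasure (D u) (space (D u)) \<noteq> \<infinity>" using fu by (auto simp: D_def top_unique)
    then show ?thesis
      unfolding finite_borel_measure_def finite_borel_measure_axioms_def
      by (auto intro: finite_measureI simp: D_def)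
  qed
  interpret F: finite_borel_measure "D f" by (rule fD[OF f fin(1)])
  interpret H: finite_borel_measure "D h" by (rule fD[OF h fin(2)])
  have Ioc: "measure (D f) {x<..y} \<le> measure (D h) {x<..y}" if "x < y" for x y
  proof -
    have e: "emeasure (D u) {x<..y} = (\<integral>\<^sup>+w. ennreal (u w) * indicator {max x l<..<min y r} w \<partial>lborel)"
      if u [measurable]: "u \<in> borel_measurable borel" for u
    proof -
      have "AE w in lborel. w \<noteq> y" by (rule AE_lborel_singleton)
      then show ?thesis
        by (subst eD) (auto intro!: nn_integral_cong_AE elim!: eventually_mono simp: indicator_def)
    qed
    have "emeasure (D f) {x<..y} \<le> emeasure (D h) {x<..y}"
      unfolding e[OF f] e[OF h]
    proof (cases "max x l < min y r")
      case True
      then show "(\<integral>\<^sup>+w. ennreal (f w) * indicator {max x l<..<min y r} w \<partial>lborel)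
        \<le> (\<integral>\<^sup>+w. ennreal (h w) * indicator {max x l<..<min y r} w \<partial>lborel)" by (intro le) auto
    next
      case False
      then have "{max x l<..<min y r} = {}" by auto
      then show "(\<integral>\<^sup>+w. ennreal (f w) * indicator {max x l<..<min y r} w \<partial>lborel)
        \<le> (\<integral>\<^sup>+w. ennreal (h w) * indicator {max x l<..<min y r} w \<partial>lborel)" by simp
    qed
    then show ?thesis by (simp add: F.emeasure_eq_measure H.emeasure_eq_measure)
  qed
  have "AE w in lborel. ennreal (f w) * indicator {l<..<r} w \<le> ennreal (h w) * indicator {l<..<r} w"
  proof (rule AE_le_of_nn_integrals)
    have "(\<integral>\<^sup>+w. ennreal (f w) * indicator {l<..<r} w \<partial>lborel) \<le> (\<integral>\<^sup>+w. ennreal (f w) \<partial>lborel)"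
      by (intro nn_integral_mono) (auto simp: indicator_def)
    then show "(\<integral>\<^sup>+w. ennreal (f w) * indicator {l<..<r} w \<partial>lborel) < \<infinity>" using fin(1) by simp
    fix A :: "real set" assume "A \<in> sets lborel"
    then have A: "A \<in> sets borel" by simp
    show "(\<integral>\<^sup>+w. ennreal (f w) * indicator {l<..<r} w * indicator A w \<partial>lborel)
       \<le> (\<integral>\<^sup>+w. ennreal (h w) * indicator {l<..<r} w * indicator A w \<partial>lborel)"
      using measure_le_if_le_on_intervals[OF fD[OF f fin(1)] fD[OF h fin(2)] Ioc A] by (simp add: eD A)
  qed auto
  then show ?thesis
    by eventually_elim (auto simp: ennreal_le_iff nonneg)
qed

section \<open>Transport of pseudo-inverses\<close>

context frequency_measure
begin

lemma nn_integral_half_mass: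
  assumes P: "Measurable.pred borel P"
  shows "(\<integral>\<^sup>+w. ennreal (measure (cond w) {\<theta> \<in> {0..<2 * pi}. P \<theta>}) * indicator {p<..<q} w \<partial>lborel)
    = ennreal (measure \<nu> {x \<in> space \<nu>. p < snd x \<and> snd x < q \<and> P (fst x)})"
proof -
  have "{x \<in> space \<nu>. P (fst x) \<and> snd x \<in> {p<..<q}} = {x \<in> space \<nu>. p < snd x \<and> snd x < q \<and> P (fst x)}"
    by auto
  then show ?thesis using nu_halfs[OF P, of "{p<..<q}"] by (simp only: emeasure_eq_measure) simp
qed

lemma finite_half:
  "(\<integral>\<^sup>+w. ennreal (measure (cond w) {\<theta> \<in> {0..<2 * pi}. P \<theta>}) \<partial>lborel) < \<infinity>"
proof -
  have "(\<integral>\<^sup>+w. ennreal (measure (cond w) {\<theta> \<in> {0..<2 * pi}. P \<theta>}) \<partial>lborel) \<le> (\<integral>\<^sup>+w. ennreal (g w) \<partial>lborel)"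
    by (intro nn_integral_mono ennreal_leI m_le_g)
  also have "\<dots> = 1" by (rule total_mass)
  finally show ?thesis by (auto intro: le_less_trans)
qed

end

text \<open>A map \<open>X\<close>, in the application the flow of the characteristics, carries \<open>\<nu>0\<close> to \<open>\<nu>1\<close> in a one-sided sense. The
  comparison is made with the characteristic of the lowest frequency of the interval for the mass to the right and
  with that of the highest frequency for the mass to the left, the only ones for which crossings go in one direction.\<close>

locale frequency_measure_pair = N0: frequency_measure g \<nu>0 + N1: frequency_measure g \<nu>1
  for g \<nu>0 \<nu>1 +
  fixes X :: "real \<Rightarrow> real \<Rightarrow> real"
  assumes X_cont: "continuous_on UNIV (\<lambda>p. X (fst p) (snd p))"
    and X_mono: "\<And>\<theta> \<theta>' w w'. \<theta> \<le> \<theta>' \<Longrightarrow> w \<le> w' \<Longrightarrow> X \<theta> w \<le> X \<theta>' w'"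
    and right: "\<And>p q \<theta>. p < q \<Longrightarrow> measure \<nu>0 {x \<in> space \<nu>0. p < snd x \<and> snd x < q \<and> \<theta> < fst x}
        \<le> measure \<nu>1 {x \<in> space \<nu>1. p < snd x \<and> snd x < q \<and> X \<theta> p < fst x}"
    and left: "\<And>p q \<theta>. p < q \<Longrightarrow> measure \<nu>0 {x \<in> space \<nu>0. p < snd x \<and> snd x < q \<and> fst x < \<theta>}
        \<le> measure \<nu>1 {x \<in> space \<nu>1. p < snd x \<and> snd x < q \<and> fst x < X \<theta> q}"
begin

lemma X_cont1: "continuous_on UNIV (\<lambda>\<theta>. X \<theta> w)" and X_cont2: "continuous_on UNIV (X \<theta>)"
  using continuous_on_compose2[OF X_cont, of UNIV "\<lambda>\<theta>. (\<theta>, w)"]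
    continuous_on_compose2[OF X_cont, of UNIV "\<lambda>w. (\<theta>, w)"]
  by (simp_all add: continuous_intros)

lemma half_measurable: "Measurable.pred borel (\<lambda>x :: real. c < x)" "Measurable.pred borel (\<lambda>x :: real. x < c)"
  "Measurable.pred borel (\<lambda>x :: real. c \<le> x)" "Measurable.pred borel (\<lambda>x :: real. x \<le> c)"
  by measurable

text \<open>First with a rational frequency \<open>p\<close> below \<open>w\<close>, then in the limit \<open>p \<rightarrow> w\<close>, in which the open half line on the
  right-hand side becomes a closed one.\<close>

lemma AE_right: "AE w in lborel. \<forall>\<theta>\<in>\<rat>. N0.mgt \<theta> w \<le> N1.mge (X \<theta> w) w"
proof -
  have 1: "AE w in lborel. p0 < w \<and> w < r \<longrightarrow> N0.mgt \<theta> w \<le> N1.mgt (X \<theta> p0) w" for \<theta> p0 r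
    unfolding N0.mgt_def N1.mgt_def
  proof (rule AE_le_if_le_on_intervals)
    fix p q assume pq: "p0 \<le> p" "p < (q :: real)"
    have "measure \<nu>0 {x \<in> space \<nu>0. p < snd x \<and> snd x < q \<and> \<theta> < fst x}
      \<le> measure \<nu>1 {x \<in> space \<nu>1. p < snd x \<and> snd x < q \<and> X \<theta> p < fst x}" by (rule right[OF pq(2)])
    also have "\<dots> \<le> measure \<nu>1 {x \<in> space \<nu>1. p < snd x \<and> snd x < q \<and> X \<theta> p0 < fst x}"
      using X_mono[of \<theta> \<theta> p0 p] pq
      by (intro N1.finite_measure_mono sets_phaseI[OF N1.sets_nu]) auto
    finally show "(\<integral>\<^sup>+w. ennreal (measure (N0.cond w) {\<theta>' \<in> {0..<2 * pi}. \<theta> < \<theta>'}) * indicator {p<..<q} w \<partial>lborel)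
       \<le> (\<integral>\<^sup>+w. ennreal (measure (N1.cond w) {\<theta>' \<in> {0..<2 * pi}. X \<theta> p0 < \<theta>'}) * indicator {p<..<q} w \<partial>lborel)"
      unfolding N0.nn_integral_half_mass[OF half_measurable(1)] N1.nn_integral_half_mass[OF half_measurable(1)]
      by (rule ennreal_leI)
  qed (intro N0.measurable_half N1.measurable_half N0.finite_half N1.finite_half half_measurable measure_nonneg)+
  have "AE w in lborel. \<forall>\<theta>\<in>\<rat>. \<forall>p\<in>\<rat>. \<forall>r\<in>\<rat>. p < w \<and> w < r \<longrightarrow> N0.mgt \<theta> w \<le> N1.mgt (X \<theta> p) w"
    by (intro AE_ball_countable[OF countable_rat, THEN iffD2] ballI 1)
  then show ?thesis
  proof eventually_elim
    case (elim w)
    show ?case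
    proof
      fix \<theta> :: real assume \<theta>: "\<theta> \<in> \<rat>"
      interpret C: finite_measure "N1.cond w" by (rule N1.finite_cond)
      obtain r where r: "r \<in> \<rat>" "w < r" using Rats_dense_in_real[of w "w + 1"] by auto
      have "- w < - w + 1" by simp
      from rational_sequence[OF this]
      obtain q where q: "\<And>n. q n \<in> \<rat>" "\<And>n. - w < q n" and "\<And>n. q n < - w + 1"
        and q3: "\<And>n. q (Suc n) < q n" and q4: "q \<longlonglongrightarrow> - w" by blast
      define p where "p n = - q n" for n
      have p: "p n \<in> \<rat>" "p n < w" for n using q(1,2)[of n] by (auto simp: p_def)
      have inc: "incseq p" by (rule incseq_SucI) (use q3 less_imp_le in \<open>auto simp: p_def\<close>)
      have plim: "p \<longlonglongrightarrow> w" using tendsto_minus[OF q4] by (simp add: p_def[abs_def])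
      have Xlim: "(\<lambda>n. X \<theta> (p n)) \<longlonglongrightarrow> X \<theta> w"
        by (rule continuous_on_tendsto_compose[OF X_cont2 plim]) auto
      have "(\<lambda>n. measure (N1.cond w) {x \<in> {0..<2 * pi}. X \<theta> (p n) < x}) \<longlonglongrightarrow> measure (N1.cond w) (\<Inter>n. {x \<in> {0..<2 * pi}. X \<theta> (p n) < x})"
      proof (rule C.finite_Lim_measure_decseq)
        show "range (\<lambda>n. {x \<in> {0..<2 * pi}. X \<theta> (p n) < x}) \<subseteq> sets (N1.cond w)"
          by (rule image_subsetI, rule N1.half_sets_cond) measurable
        show "decseq (\<lambda>n. {x \<in> {0..<2 * pi}. X \<theta> (p n) < x})"
          unfolding decseq_def using X_mono[OF order_refl incseqD[OF inc]] by (auto intro: le_less_trans)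
      qed
      moreover have "N0.mgt \<theta> w \<le> measure (N1.cond w) {x \<in> {0..<2 * pi}. X \<theta> (p n) < x}" for n
        using elim \<theta> p[of n] r by (auto simp: N1.mgt_def)
      ultimately have "N0.mgt \<theta> w \<le> measure (N1.cond w) (\<Inter>n. {x \<in> {0..<2 * pi}. X \<theta> (p n) < x})"
        by (intro LIMSEQ_le_const) auto
      also have "\<dots> \<le> N1.mge (X \<theta> w) w"
        unfolding N1.mge_def
      proof (intro C.finite_measure_mono N1.half_sets_cond half_measurable)
        show "(\<Inter>n. {x \<in> {0..<2 * pi}. X \<theta> (p n) < x}) \<subseteq> {x \<in> {0..<2 * pi}. X \<theta> w \<le> x}"
        proof
          fix x assume "x \<in> (\<Inter>n. {x \<in> {0..<2 * pi}. X \<theta> (p n) < x})"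
          then have x: "x \<in> {0..<2 * pi}" "\<And>n. X \<theta> (p n) \<le> x" by (auto simp: less_imp_le)
          have "X \<theta> w \<le> x" by (rule LIMSEQ_le_const2[OF Xlim]) (use x in auto)
          then show "x \<in> {x \<in> {0..<2 * pi}. X \<theta> w \<le> x}" using x by simp
        qed
      qed
      finally show "N0.mgt \<theta> w \<le> N1.mge (X \<theta> w) w" .
    qed
  qed
qed

lemma AE_left: "AE w in lborel. \<forall>\<theta>\<in>\<rat>. N0.mlt \<theta> w \<le> N1.mle (X \<theta> w) w"
proof -
  have 1: "AE w in lborel. l < w \<and> w < q0 \<longrightarrow> N0.mlt \<theta> w \<le> N1.mlt (X \<theta> q0) w" for \<theta> q0 l
    unfolding N0.mlt_def N1.mlt_def
  proof (rule AE_le_if_le_on_intervals)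
    fix p q assume pq: "q \<le> q0" "p < (q :: real)"
    have "measure \<nu>0 {x \<in> space \<nu>0. p < snd x \<and> snd x < q \<and> fst x < \<theta>}
      \<le> measure \<nu>1 {x \<in> space \<nu>1. p < snd x \<and> snd x < q \<and> fst x < X \<theta> q}" by (rule left[OF pq(2)])
    also have "\<dots> \<le> measure \<nu>1 {x \<in> space \<nu>1. p < snd x \<and> snd x < q \<and> fst x < X \<theta> q0}"
      using X_mono[of \<theta> \<theta> q q0] pq
      by (intro N1.finite_measure_mono sets_phaseI[OF N1.sets_nu]) auto
    finally show "(\<integral>\<^sup>+w. ennreal (measure (N0.cond w) {\<theta>' \<in> {0..<2 * pi}. \<theta>' < \<theta>}) * indicator {p<..<q} w \<partial>lborel)
       \<le> (\<integral>\<^sup>+w. ennreal (measure (N1.cond w) {\<theta>' \<in> {0..<2 * pi}. \<theta>' < X \<theta> q0}) * indicator {p<..<q} w \<partial>lborel)"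
      unfolding N0.nn_integral_half_mass[OF half_measurable(2)] N1.nn_integral_half_mass[OF half_measurable(2)]
      by (rule ennreal_leI)
  qed (intro N0.measurable_half N1.measurable_half N0.finite_half N1.finite_half half_measurable measure_nonneg)+
  have "AE w in lborel. \<forall>\<theta>\<in>\<rat>. \<forall>q\<in>\<rat>. \<forall>l\<in>\<rat>. l < w \<and> w < q \<longrightarrow> N0.mlt \<theta> w \<le> N1.mlt (X \<theta> q) w"
    by (intro AE_ball_countable[OF countable_rat, THEN iffD2] ballI 1)
  then show ?thesis
  proof eventually_elim
    case (elim w)
    show ?case
    proof
      fix \<theta> :: real assume \<theta>: "\<theta> \<in> \<rat>"
      interpret C: finite_measure "N1.cond w" by (rule N1.finite_cond)
      obtain l where l: "l \<in> \<rat>" "l < w" using Rats_dense_in_real[of "w - 1" w] by auto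
      have "w < w + 1" by simp
      from rational_sequence[OF this]
      obtain q where q: "\<And>n. q n \<in> \<rat>" "\<And>n. w < q n" and "\<And>n. q n < w + 1"
        and q3: "\<And>n. q (Suc n) < q n" and q4: "q \<longlonglongrightarrow> w" by blast
      have dec: "decseq q" by (rule decseq_SucI) (use q3 less_imp_le in auto)
      have Xlim: "(\<lambda>n. X \<theta> (q n)) \<longlonglongrightarrow> X \<theta> w"
        by (rule continuous_on_tendsto_compose[OF X_cont2 q4]) auto
      have "(\<lambda>n. measure (N1.cond w) {x \<in> {0..<2 * pi}. x < X \<theta> (q n)}) \<longlonglongrightarrow> measure (N1.cond w) (\<Inter>n. {x \<in> {0..<2 * pi}. x < X \<theta> (q n)})"
      proof (rule C.finite_Lim_measure_decseq)
        show "range (\<lambda>n. {x \<in> {0..<2 * pi}. x < X \<theta> (q n)}) \<subseteq> sets (N1.cond w)"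
          by (rule image_subsetI, rule N1.half_sets_cond) measurable
        show "decseq (\<lambda>n. {x \<in> {0..<2 * pi}. x < X \<theta> (q n)})"
          unfolding decseq_def using X_mono[OF order_refl decseqD[OF dec]] by (auto intro: less_le_trans)
      qed
      moreover have "N0.mlt \<theta> w \<le> measure (N1.cond w) {x \<in> {0..<2 * pi}. x < X \<theta> (q n)}" for n
        using elim \<theta> q(1,2)[of n] l by (auto simp: N1.mlt_def)
      ultimately have "N0.mlt \<theta> w \<le> measure (N1.cond w) (\<Inter>n. {x \<in> {0..<2 * pi}. x < X \<theta> (q n)})"
        by (intro LIMSEQ_le_const) auto
      also have "\<dots> \<le> N1.mle (X \<theta> w) w"
        unfolding N1.mle_def
      proof (intro C.finite_measure_mono N1.half_sets_cond half_measurable)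
        show "(\<Inter>n. {x \<in> {0..<2 * pi}. x < X \<theta> (q n)}) \<subseteq> {x \<in> {0..<2 * pi}. x \<le> X \<theta> w}"
        proof
          fix x assume "x \<in> (\<Inter>n. {x \<in> {0..<2 * pi}. x < X \<theta> (q n)})"
          then have x: "x \<in> {0..<2 * pi}" "\<And>n. x \<le> X \<theta> (q n)" by (auto simp: less_imp_le)
          have "x \<le> X \<theta> w" by (rule LIMSEQ_le_const[OF Xlim]) (use x in auto)
          then show "x \<in> {x \<in> {0..<2 * pi}. x \<le> X \<theta> w}" using x by simp
        qed
      qed
      finally show "N0.mlt \<theta> w \<le> N1.mle (X \<theta> w) w" .
    qed
  qed
qed

text \<open>Monotone maps transport quantiles. No atom of either measure causes trouble, because the two
  inequalities sandwich the value: one bounds the quantile from above, the other one from below.\<close>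

lemma quantile_transport: "AE z in mass_space g. N1.quantile z = X (N0.quantile z) (fst z)"
proof -
  have [measurable]: "(\<lambda>z. X (N0.quantile z) (fst z)) \<in> borel_measurable (borel \<Otimes>\<^sub>M borel)"
  proof -
    have "(\<lambda>p. X (fst p) (snd p)) \<in> borel_measurable (borel \<Otimes>\<^sub>M borel)"
      using borel_measurable_continuous_onI[OF X_cont] by (simp only: borel_prod)
    then have "(\<lambda>p. X (fst p) (snd p)) \<circ> (\<lambda>z. (N0.quantile z, fst z)) \<in> borel_measurable (borel \<Otimes>\<^sub>M borel)"
      by (rule measurable_comp[rotated]) measurable
    then show ?thesis by (simp add: comp_def)
  qed
  have "AE w in lborel. \<forall>\<eta>. 0 < \<eta> \<and> \<eta> < g w \<longrightarrow> N1.quantile (w, \<eta>) = X (N0.quantile (w, \<eta>)) w"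
    using AE_left AE_right
  proof eventually_elim
    case (elim w)
    show ?case
    proof (intro allI impI)
      fix \<eta> assume "0 < \<eta> \<and> \<eta> < g w"
      then have \<eta>: "0 < \<eta>" "\<eta> < g w" by auto
      define a where "a = N0.quantile (w, \<eta>)"
      define b where "b = N1.quantile (w, \<eta>)"
      have a: "0 \<le> a" "a < 2 * pi" and b: "0 \<le> b" "b < 2 * pi"
        unfolding a_def b_def by (rule N0.quantile_bounds N1.quantile_bounds)+
      have Xa: "isCont (\<lambda>\<theta>. X \<theta> w) a"
        using X_cont1 by (simp add: continuous_on_eq_continuous_at)
      have 1: "b \<le> X a w"
      proof (rule ccontr)
        assume "\<not> b \<le> X a w"
        then have "\<forall>\<^sub>F \<theta> in at a. X \<theta> w < b" using Xa by (intro order_tendstoD(2)[of _ "X a w"]) (auto simp: isCont_def)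
        then obtain d where d: "d > 0" "\<And>\<theta>. \<theta> \<noteq> a \<Longrightarrow> \<bar>\<theta> - a\<bar> < d \<Longrightarrow> X \<theta> w < b"
          by (auto simp: eventually_at dist_real_def)
        obtain \<theta> where \<theta>: "\<theta> \<in> \<rat>" "a < \<theta>" "\<theta> < a + d"
          using Rats_dense_in_real[of a "a + d"] d(1) by auto
        have Xb: "X \<theta> w < b" using \<theta> by (intro d(2)) auto
        have "\<eta> < N0.mle ((a + \<theta>) / 2) w"
          by (rule N0.less_mle[OF \<eta>]) (use \<theta> in \<open>auto simp: a_def[symmetric]\<close>)
        also have "\<dots> \<le> N0.mlt \<theta> w"
          unfolding N0.mle_def N0.mlt_def by (rule N0.m_mono) (use \<theta> in auto)
        also have "\<dots> \<le> N1.mle (X \<theta> w) w" using elim \<theta> by blast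
        finally have l: "\<eta> < N1.mle (X \<theta> w) w" .
        have "0 \<le> X \<theta> w"
        proof (rule ccontr)
          assume "\<not> 0 \<le> X \<theta> w"
          then have "{x \<in> {0..<2 * pi}. x \<le> X \<theta> w} = {}" by auto
          then have "N1.mle (X \<theta> w) w = 0" by (simp only: N1.mle_def measure_empty)
          then show False using l \<eta> by simp
        qed
        then have "b \<le> X \<theta> w" unfolding b_def using Xb b by (intro N1.quantile_le[OF \<eta> _ _ l]) auto
        then show False using Xb by simp
      qed
      have 2: "X a w \<le> b"
      proof (rule ccontr)
        assume "\<not> X a w \<le> b"
        then have "\<forall>\<^sub>F \<theta> in at a. b < X \<theta> w" using Xa by (intro order_tendstoD(1)[of _ "X a w"]) (auto simp: isCont_def)
        then obtain d where d: "d > 0" "\<And>\<theta>. \<theta> \<noteq> a \<Longrightarrow> \<bar>\<theta> - a\<bar> < d \<Longrightarrow> b < X \<theta> w"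
          by (auto simp: eventually_at dist_real_def)
        obtain \<theta> where \<theta>: "\<theta> \<in> \<rat>" "a - d < \<theta>" "\<theta> < a"
          using Rats_dense_in_real[of "a - d" a] d(1) by auto
        have Xb: "b < X \<theta> w" using \<theta> by (intro d(2)) auto
        have "N0.mle \<theta> w \<le> \<eta>"
        proof (cases "0 \<le> \<theta>")
          case True
          show ?thesis
          proof (rule ccontr)
            assume "\<not> N0.mle \<theta> w \<le> \<eta>"
            then have "a \<le> \<theta>" unfolding a_def using True \<theta> a by (intro N0.quantile_le[OF \<eta>]) auto
            then show False using \<theta> by simp
          qed
        next
          case False
          then have "{x \<in> {0..<2 * pi}. x \<le> \<theta>} = {}" by auto
          then have "N0.mle \<theta> w = 0" by (simp only: N0.mle_def measure_empty)
          then show ?thesis using \<eta> by simp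
        qed
        moreover have "N0.mgt \<theta> w = g w - N0.mle \<theta> w"
          unfolding N0.mgt_def N0.mle_def using N0.m_compl[OF half_measurable(4)[of \<theta>], where w=w] by (simp add: not_le)
        moreover have "N0.mgt \<theta> w \<le> N1.mge (X \<theta> w) w" using elim \<theta> by blast
        moreover have "N1.mge (X \<theta> w) w = g w - N1.mlt (X \<theta> w) w"
          unfolding N1.mge_def N1.mlt_def using N1.m_compl[OF half_measurable(2)[of "X \<theta> w"], where w=w] by (simp add: not_less)
        ultimately have "N1.mlt (X \<theta> w) w \<le> \<eta>" by linarith
        moreover have "\<eta> < N1.mle ((b + X \<theta> w) / 2) w"
          by (rule N1.less_mle[OF \<eta>]) (use Xb in \<open>auto simp: b_def[symmetric]\<close>)
        moreover have "N1.mle ((b + X \<theta> w) / 2) w \<le> N1.mlt (X \<theta> w) w"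
          unfolding N1.mle_def N1.mlt_def by (rule N1.m_mono) (use Xb in auto)
        ultimately show False by linarith
      qed
      show "N1.quantile (w, \<eta>) = X (N0.quantile (w, \<eta>)) w"
        using 1 2 by (simp add: a_def b_def)
    qed
  qed
  then have "AE w in lborel. AE \<eta> in lborel. 0 < \<eta> \<and> \<eta> < g w \<longrightarrow> N1.quantile (w, \<eta>) = X (N0.quantile (w, \<eta>)) (fst (w, \<eta>))"
    by eventually_elim simp
  moreover have "Measurable.pred (borel \<Otimes>\<^sub>M borel) (\<lambda>z. N1.quantile z = X (N0.quantile z) (fst z))" by measurable
  ultimately show ?thesis by (simp only: AE_mass_space[OF N0.g_measurable])
qed

end

section \<open>Contraction of two families of phases\<close>

text \<open>Jordan's inequality, from concavity.\<close>

lemma sin_ge_chord: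
  fixes x :: real assumes "0 \<le> x" "x \<le> pi / 2" shows "2 * x / pi \<le> sin x"
proof -
  have "concave_on {0..pi} sin"
  proof (rule f''_le0_imp_concave)
    show "convex {0..pi}" by simp
    show "(sin has_real_derivative cos y) (at y)" for y :: real by (rule DERIV_sin)
    show "(cos has_real_derivative - sin y) (at y)" for y :: real by (rule DERIV_cos)
    show "- sin y \<le> 0" if "y \<in> {0..pi}" for y using that by (simp add: sin_ge_zero)
  qed
  then have "(1 - 2 * x / pi) * sin 0 + (2 * x / pi) * sin (pi / 2) \<le> sin ((1 - 2 * x / pi) *\<^sub>R 0 + (2 * x / pi) *\<^sub>R (pi / 2))"
    by (rule concave_onD) (use assms pi_gt_zero in \<open>auto simp: field_simps\<close>)
  then show ?thesis by simp
qed

text \<open>In the product formula for the difference of sines, Jordan's inequality bounds the sine of the half difference,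
  and the half sum stays in \<open>[- d, d]\<close>, where the cosine is at least \<open>cos d\<close>. This is where the factor \<open>2 cos d / \<pi>\<close>
  of the final rate comes from.\<close>

lemma sin_difference_bounds:
  fixes x y d :: real
  assumes d: "0 < d" "d < pi / 2" and x: "\<bar>x\<bar> \<le> d" and y: "\<bar>y\<bar> \<le> d" and le: "y \<le> x"
  shows "2 * cos d / pi * (x - y) \<le> sin x - sin y"
proof -
  have c: "cos d \<le> cos ((x + y) / 2)"
  proof -
    have "cos d \<le> cos \<bar>(x + y) / 2\<bar>" using d x y by (intro cos_monotone_0_pi_le) auto
    then show ?thesis by (simp add: abs_if split: if_splits)
  qed
  have cd: "0 < cos d" using d by (intro cos_gt_zero) auto
  have s: "2 * ((x - y) / 2) / pi \<le> sin ((x - y) / 2)"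
    using assms by (intro sin_ge_chord) auto
  have "2 * cos d / pi * (x - y) = 2 * (2 * ((x - y) / 2) / pi) * cos d" by (simp add: field_simps)
  also have "\<dots> \<le> 2 * sin ((x - y) / 2) * cos ((x + y) / 2)"
    using c cd s le by (intro mult_mono mult_left_mono) (auto intro: order_trans[OF _ s])
  also have "\<dots> = sin x - sin y" by (simp add: sin_diff_sin)
  finally show ?thesis .
qed

text \<open>Dominated convergence for the difference quotients, which are bounded by \<open>C\<close> by the mean value theorem.\<close>

lemma DERIV_integral:
  fixes f :: "real \<Rightarrow> 'a \<Rightarrow> real"
  assumes fin: "finite_measure M" and l: "l < t" "t < r"
    and meas: "\<And>s. l < s \<Longrightarrow> s < r \<Longrightarrow> f s \<in> borel_measurable M" "f' t \<in> borel_measurable M"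
    and int: "\<And>s. l < s \<Longrightarrow> s < r \<Longrightarrow> integrable M (f s)"
    and bound: "AE x in M. \<forall>s. l < s \<and> s < r \<longrightarrow> (((\<lambda>s. f s x) has_real_derivative f' s x) (at s) \<and> \<bar>f' s x\<bar> \<le> C)"
  shows "((\<lambda>s. LINT x|M. f s x) has_real_derivative (LINT x|M. f' t x)) (at t)"
proof -
  interpret finite_measure M by (rule fin)
  have "((\<lambda>h. LINT x|M. (f (t + h) x - f t x) / h) \<longlongrightarrow> (LINT x|M. f' t x)) (at 0 within {l - t<..<r - t})"
  proof (subst tendsto_at_iff_sequentially, intro allI impI)
    fix X :: "nat \<Rightarrow> real"
    assume X: "\<forall>i. X i \<in> {l - t<..<r - t} - {0}" "X \<longlonglongrightarrow> 0"
    have Xr: "l < t + X i" "t + X i < r" "X i \<noteq> 0" for i using X(1) by (auto simp: algebra_simps)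
    show "((\<lambda>h. LINT x|M. (f (t + h) x - f t x) / h) \<circ> X) \<longlonglongrightarrow> (LINT x|M. f' t x)"
      unfolding comp_def
    proof (rule integral_dominated_convergence[where w="\<lambda>_. C"])
      show "f' t \<in> borel_measurable M" by (rule meas(2))
      show "(\<lambda>x. (f (t + X i) x - f t x) / X i) \<in> borel_measurable M" for i
        using meas(1)[OF Xr(1,2)] meas(1)[OF l] by measurable
      show "AE x in M. (\<lambda>i. (f (t + X i) x - f t x) / X i) \<longlonglongrightarrow> f' t x"
        using bound
      proof eventually_elim
        case (elim x)
        then have "((\<lambda>h. (f (t + h) x - f t x) / h) \<longlongrightarrow> f' t x) (at 0)" using l by (auto simp: DERIV_def)
        then show ?case
          by (rule filterlim_compose) (use X Xr in \<open>auto simp: filterlim_at intro!: always_eventually\<close>)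
      qed
      show "AE x in M. norm ((f (t + X i) x - f t x) / X i) \<le> C" for i
        using bound
      proof eventually_elim
        case (elim x)
        have "norm (f (t + X i) x - f t x) \<le> C * norm (t + X i - t)"
        proof (rule field_differentiable_bound[where S="{l<..<r}" and f'="\<lambda>s. f' s x"])
          show "((\<lambda>s. f s x) has_field_derivative f' s x) (at s within {l<..<r})" if "s \<in> {l<..<r}" for s
            using elim that by (auto intro: has_field_derivative_at_within)
        qed (use elim l Xr in auto)
        then show ?case using Xr(3)[of i] by (simp add: divide_le_eq)
      qed
    qed simp
  qed
  moreover have "at 0 within {l - t<..<r - t} = at (0::real)"
    by (rule at_within_open) (use l in auto)
  moreover have "\<forall>\<^sub>F h in at 0. (LINT x|M. (f (t + h) x - f t x) / h) = ((LINT x|M. f (t + h) x) - (LINT x|M. f t x)) / h"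
  proof -
    have "\<forall>\<^sub>F h in at 0. h \<in> {l - t<..<r - t}"
      using l by (intro eventually_at_in_open') auto
    then show ?thesis
    proof eventually_elim
      case (elim h)
      then have "integrable M (f (t + h))" "integrable M (f t)" using l by (auto intro!: int)
      then show ?case by simp
    qed
  qed
  ultimately show ?thesis
    unfolding DERIV_def by (simp only:) (rule Lim_transform_eventually)
qed

text \<open>The heart of the contraction estimate. Put \<open>u = a - b\<close>. The equations give
  \<open>u' = - K \<integral> (sin (a - a\<^sub>*) - sin (b - b\<^sub>*))\<close>, and the bracket equals \<open>u - u\<^sub>*\<close> times a symmetric coefficient
  that is at least \<open>2 cos d / \<pi>\<close>. Since \<open>u\<close> has mean zero, the weighted difference
  \<open>v = exp (2 K cos d (t - t0) / \<pi>) u\<close> solves an equation of the same form with a nonnegative coefficient,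
  so that symmetrization shows that \<open>\<integral> \<Psi> (v)\<close> decreases for every convex \<open>\<Psi>\<close>.\<close>

locale phase_contraction = prob_space M for M :: "'e measure" +
  fixes a b a' b' :: "real \<Rightarrow> 'e \<Rightarrow> real" and K d t0 R :: real
  assumes K_pos: "K > 0" and d: "0 < d" "d < pi / 2" and t0: "t0 > 0"
    and a_meas [measurable]: "\<And>t. t \<ge> 0 \<Longrightarrow> a t \<in> borel_measurable M"
    and b_meas [measurable]: "\<And>t. t \<ge> 0 \<Longrightarrow> b t \<in> borel_measurable M"
    and a'_meas: "\<And>t. t \<ge> 0 \<Longrightarrow> a' t \<in> borel_measurable M"
    and b'_meas: "\<And>t. t \<ge> 0 \<Longrightarrow> b' t \<in> borel_measurable M"
    and deriv: "AE e in M. \<forall>t>0. ((\<lambda>t. a t e) has_real_derivative a' t e) (at t) \<and> ((\<lambda>t. b t e) has_real_derivative b' t e) (at t)"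
    and bounded: "\<And>T. AE e in M. \<forall>t\<in>{0..T}. \<bar>a t e\<bar> \<le> R * (1 + T) \<and> \<bar>b t e\<bar> \<le> R * (1 + T) \<and> \<bar>a' t e\<bar> \<le> R \<and> \<bar>b' t e\<bar> \<le> R"
    and equation: "\<And>t. t > 0 \<Longrightarrow> AE e in M. a' t e - b' t e = - K * (LINT e'|M. sin (a t e - a t e') - sin (b t e - b t e'))"
    and mean: "\<And>t. t \<ge> 0 \<Longrightarrow> (LINT e|M. a t e) = (LINT e|M. b t e)"
    and close: "\<And>t. t \<ge> t0 \<Longrightarrow> AE e in M. AE e' in M. \<bar>a t e - a t e'\<bar> \<le> d \<and> \<bar>b t e - b t e'\<bar> \<le> d"
begin

definition rate :: real where "rate = 2 * K * cos d / pi"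

definition u :: "real \<Rightarrow> 'e \<Rightarrow> real" where "u t e = a t e - b t e"

definition v :: "real \<Rightarrow> 'e \<Rightarrow> real" where "v t e = exp (rate * (t - t0)) * u t e"

definition v' :: "real \<Rightarrow> 'e \<Rightarrow> real" where "v' t e = exp (rate * (t - t0)) * (rate * u t e + (a' t e - b' t e))"

lemma u_meas [measurable]: "t \<ge> 0 \<Longrightarrow> u t \<in> borel_measurable M"
  unfolding u_def by measurable

lemma v_meas [measurable]: "t \<ge> 0 \<Longrightarrow> v t \<in> borel_measurable M"
  unfolding v_def by measurable

lemma v'_meas: "t \<ge> 0 \<Longrightarrow> v' t \<in> borel_measurable M"
  unfolding v'_def using a'_meas b'_meas by measurable

lemma R_nonneg: "0 \<le> R"
proof -
  have "AE e in M. 0 \<le> R" using bounded[of 0] by eventually_elim auto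
  then show ?thesis by simp
qed

lemma rate_pos: "rate > 0"
  using K_pos d by (simp add: rate_def cos_gt_zero)

lemma integrable_a: "t \<ge> 0 \<Longrightarrow> integrable M (a t)" and integrable_b: "t \<ge> 0 \<Longrightarrow> integrable M (b t)"
  by (rule integrable_const_bound[OF eventually_mono[OF bounded[of t]]]; force)+

lemma integrable_u: "t \<ge> 0 \<Longrightarrow> integrable M (u t)"
  unfolding u_def using integrable_a integrable_b by simp

lemma mean_u: "t \<ge> 0 \<Longrightarrow> (LINT e|M. u t e) = 0"
  unfolding u_def using integrable_a integrable_b mean by simp

text \<open>The interaction that drives \<open>v\<close>, up to the weight: as \<open>u\<close> has mean zero, \<open>rate * u\<close> may be written as an average
  of differences and absorbed.\<close>

definition q :: "real \<Rightarrow> 'e \<Rightarrow> 'e \<Rightarrow> real" where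
  "q t e e' = rate * (u t e - u t e') - K * (sin (a t e - a t e') - sin (b t e - b t e'))"

lemma q_antisym: "q t e' e = - q t e e'"
proof -
  have "sin (a t e' - a t e) = - sin (a t e - a t e')" "sin (b t e' - b t e) = - sin (b t e - b t e')"
    by (metis minus_diff_eq sin_minus)+
  then show ?thesis by (simp add: q_def algebra_simps)
qed

lemma q_sign:
  assumes "\<bar>a t e - a t e'\<bar> \<le> d" "\<bar>b t e - b t e'\<bar> \<le> d" "u t e' \<le> u t e"
  shows "q t e e' \<le> 0"
proof -
  have "2 * cos d / pi * ((a t e - a t e') - (b t e - b t e')) \<le> sin (a t e - a t e') - sin (b t e - b t e')"
    by (rule sin_difference_bounds[OF d assms(1,2)]) (use assms(3) in \<open>simp add: u_def\<close>)
  then have "K * (2 * cos d / pi * ((a t e - a t e') - (b t e - b t e'))) \<le> K * (sin (a t e - a t e') - sin (b t e - b t e'))"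
    using K_pos by (intro mult_left_mono) auto
  then show ?thesis by (simp add: q_def rate_def u_def algebra_simps)
qed

lemma v'_eq:
  assumes t: "t > 0" shows "AE e in M. v' t e = exp (rate * (t - t0)) * (LINT e'|M. q t e e')"
  using equation[OF t] bounded[of t]
proof eventually_elim
  case (elim e)
  have t': "t \<ge> 0" using t by simp
  note [measurable] = a_meas[OF t'] b_meas[OF t']
  have i: "integrable M (\<lambda>e'. sin (a t e - a t e') - sin (b t e - b t e'))"
    by (intro Bochner_Integration.integrable_diff integrable_const_bound[of _ 1]) auto
  have "(LINT e'|M. q t e e') = (LINT e'|M. rate * (u t e - u t e')) - (LINT e'|M. K * (sin (a t e - a t e') - sin (b t e - b t e')))"
    unfolding q_def using i integrable_u[OF t'] by (intro Bochner_Integration.integral_diff) auto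
  also have "\<dots> = rate * u t e + (a' t e - b' t e)"
    using integrable_u[OF t'] mean_u[OF t'] elim i by (simp add: prob_space)
  finally show ?case by (simp add: v'_def)
qed

text \<open>Symmetrization: exchanging the two variables and averaging turns the integrand into
  \<open>(\<psi> (v e) - \<psi> (v e')) q e e' / 2\<close>, whose factors have opposite signs for monotone \<open>\<psi>\<close>.\<close>

lemma dissipation:
  assumes t: "t \<ge> t0"
    and \<psi>: "mono \<psi>" "continuous_on UNIV (\<psi> :: real \<Rightarrow> real)"
  shows "(LINT e|M. \<psi> (v t e) * v' t e) \<le> 0"
proof -
  have t1: "t > 0" "t \<ge> 0" using t t0 by auto
  note [measurable] = a_meas[OF t1(2)] b_meas[OF t1(2)] u_meas[OF t1(2)] v_meas[OF t1(2)] borel_measurable_continuous_onI[OF \<psi>(2)]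
  interpret MM: pair_prob_space M M ..
  define E where "E = exp (rate * (t - t0))"
  have E: "E > 0" by (simp add: E_def)
  define f where "f = (\<lambda>(e, e'). \<psi> (v t e) * q t e e')"
  have f_meas [measurable]: "f \<in> borel_measurable (M \<Otimes>\<^sub>M M)" unfolding f_def q_def by measurable
  define c where "c = R * (1 + t)"
  have c: "c \<ge> 0" using R_nonneg t1 by (simp add: c_def)
  have ub: "AE e in M. \<bar>u t e\<bar> \<le> 2 * c"
    using bounded[of t]
  proof eventually_elim
    case (elim e)
    then have "\<bar>a t e\<bar> \<le> c" "\<bar>b t e\<bar> \<le> c" using t1 by (auto simp: c_def)
    then show ?case unfolding u_def by linarith
  qed
  have vb: "\<bar>v t e\<bar> \<le> E * (2 * c)" if "\<bar>u t e\<bar> \<le> 2 * c" for e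
    unfolding v_def E_def[symmetric] abs_mult using that E by (intro mult_mono) auto
  obtain C where C: "\<And>x. \<bar>x\<bar> \<le> E * (2 * c) \<Longrightarrow> \<bar>\<psi> x\<bar> \<le> C"
  proof
    fix x :: real assume "\<bar>x\<bar> \<le> E * (2 * c)"
    then have "- (E * (2 * c)) \<le> x" "x \<le> E * (2 * c)" by auto
    then have "\<psi> (- (E * (2 * c))) \<le> \<psi> x" "\<psi> x \<le> \<psi> (E * (2 * c))" using \<psi>(1) by (auto dest: monoD)
    then show "\<bar>\<psi> x\<bar> \<le> max \<bar>\<psi> (- (E * (2 * c)))\<bar> \<bar>\<psi> (E * (2 * c))\<bar>" by linarith
  qed
  have qb: "\<bar>q t e e'\<bar> \<le> rate * (4 * c) + K * 2" if "\<bar>u t e\<bar> \<le> 2 * c" "\<bar>u t e'\<bar> \<le> 2 * c" for e e'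
  proof -
    have "\<bar>q t e e'\<bar> \<le> \<bar>rate * (u t e - u t e')\<bar> + \<bar>K * (sin (a t e - a t e') - sin (b t e - b t e'))\<bar>"
      unfolding q_def by (rule abs_triangle_ineq4)
    also have "\<dots> = rate * \<bar>u t e - u t e'\<bar> + K * \<bar>sin (a t e - a t e') - sin (b t e - b t e')\<bar>"
      using rate_pos K_pos by (simp add: abs_mult)
    also have "\<dots> \<le> rate * (4 * c) + K * 2"
    proof (intro add_mono mult_left_mono)
      show "\<bar>u t e - u t e'\<bar> \<le> 4 * c" using that by linarith
      show "\<bar>sin (a t e - a t e') - sin (b t e - b t e')\<bar> \<le> 2"
        using abs_sin_le_one[of "a t e - a t e'"] abs_sin_le_one[of "b t e - b t e'"] by linarith
    qed (use rate_pos K_pos in auto)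
    finally show ?thesis .
  qed
  have ub2: "AE z in M \<Otimes>\<^sub>M M. \<bar>u t (fst z)\<bar> \<le> 2 * c \<and> \<bar>u t (snd z)\<bar> \<le> 2 * c"
    by (subst MM.AE_pair_iff[symmetric]) (measurable, use ub in \<open>auto elim!: eventually_mono\<close>)
  have fi: "integrable (M \<Otimes>\<^sub>M M) f"
  proof (rule MM.integrable_const_bound[where B="C * (rate * (4 * c) + K * 2)"])
    show "AE z in M \<Otimes>\<^sub>M M. norm (f z) \<le> C * (rate * (4 * c) + K * 2)"
      using ub2
    proof eventually_elim
      case (elim z)
      have "\<bar>\<psi> (v t (fst z))\<bar> \<le> C" using C vb elim by blast
      then show ?case
        unfolding f_def case_prod_beta real_norm_def abs_mult
        using elim qb[of "fst z" "snd z"] by (intro mult_mono) auto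
    qed
  qed measurable
  have "(LINT e|M. \<psi> (v t e) * v' t e) = (LINT e|M. E * (LINT e'|M. f (e, e')))"
  proof (rule integral_cong_AE)
    have "AE e in M. \<psi> (v t e) * v' t e = E * (LINT e'|M. f (e, e'))"
      using v'_eq[OF t1(1)] by eventually_elim (simp add: f_def E_def)
    then show "AE e in M. \<psi> (v t e) * v' t e = E * (LINT e'|M. f (e, e'))" .
    show "(\<lambda>e. E * (LINT e'|M. f (e, e'))) \<in> borel_measurable M" by measurable
    show "(\<lambda>e. \<psi> (v t e) * v' t e) \<in> borel_measurable M"
      using v'_meas[OF t1(2)] by measurable
  qed
  also have "\<dots> = E * (LINT z|(M \<Otimes>\<^sub>M M). f z)" by (simp add: MM.integral_fst'[OF fi])
  also have "\<dots> \<le> 0"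
  proof -
    have swap: "(LINT z|(M \<Otimes>\<^sub>M M). f z) = (LINT z|(M \<Otimes>\<^sub>M M). f (snd z, fst z))"
      using MM.integral_product_swap[OF f_meas] by (simp add: case_prod_beta')
    have fi': "integrable (M \<Otimes>\<^sub>M M) (\<lambda>z. f (snd z, fst z))"
      using MM.integrable_product_swap[OF fi] by (simp add: case_prod_beta')
    have "2 * (LINT z|(M \<Otimes>\<^sub>M M). f z) = (LINT z|(M \<Otimes>\<^sub>M M). f z + f (snd z, fst z))"
      using fi fi' swap by simp
    also have "\<dots> \<le> 0"
    proof (rule integral_nonpos_AE)
      have "AE z in M \<Otimes>\<^sub>M M. \<bar>a t (fst z) - a t (snd z)\<bar> \<le> d \<and> \<bar>b t (fst z) - b t (snd z)\<bar> \<le> d"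
        by (subst MM.AE_pair_iff[symmetric]) (measurable, use close[OF t] in simp)
      then show "AE z in M \<Otimes>\<^sub>M M. f z + f (snd z, fst z) \<le> 0"
      proof eventually_elim
        case (elim z)
        obtain e e' where z: "z = (e, e')" by (cases z)
        have cl: "\<bar>a t e - a t e'\<bar> \<le> d" "\<bar>b t e - b t e'\<bar> \<le> d" "\<bar>a t e' - a t e\<bar> \<le> d" "\<bar>b t e' - b t e\<bar> \<le> d"
          using elim z by (auto simp: abs_minus_commute)
        have eq: "f z + f (snd z, fst z) = (\<psi> (v t e) - \<psi> (v t e')) * q t e e'"
          using q_antisym[of t e' e] by (simp add: f_def z algebra_simps)
        show ?case
        proof (cases "u t e' \<le> u t e")
          case True
          then have "v t e' \<le> v t e" using E by (simp add: v_def E_def[symmetric])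
          then have "\<psi> (v t e') \<le> \<psi> (v t e)" using \<psi>(1) by (auto dest: monoD)
          then show ?thesis unfolding eq using q_sign[OF cl(1,2) True] by (intro mult_nonneg_nonpos) auto
        next
          case False
          then have le: "u t e \<le> u t e'" by simp
          then have "v t e \<le> v t e'" using E by (simp add: v_def E_def[symmetric])
          then have "\<psi> (v t e) \<le> \<psi> (v t e')" using \<psi>(1) by (auto dest: monoD)
          moreover have "0 \<le> q t e e'" using q_sign[OF cl(3,4) le] q_antisym[of t e' e] by simp
          ultimately show ?thesis unfolding eq by (intro mult_nonpos_nonneg) auto
        qed
      qed
    qed
    finally show ?thesis using E by (simp add: mult_nonneg_nonpos)
  qed
  finally show ?thesis .
qed

lemma convex_integral_decreasing:
  assumes t: "t \<ge> t0"
    and \<Psi>: "\<And>x. (\<Psi> has_real_derivative \<psi> x) (at x)" and \<psi>: "mono \<psi>" "continuous_on UNIV \<psi>"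
  shows "(LINT e|M. \<Psi> (v t e)) \<le> (LINT e|M. \<Psi> (v t0 e))"
proof (rule DERIV_nonpos_imp_nonincreasing[OF t])
  fix s assume s: "t0 \<le> s" "s \<le> t"
  define l where "l = t0 / 2"
  define r where "r = t + 1"
  have l: "0 < l" "l < s" and r: "s < r" using t0 s by (auto simp: l_def r_def)
  define c where "c = R * (1 + r)"
  define E where "E = exp (rate * (r - t0))"
  have c: "c \<ge> 0" using R_nonneg l r by (simp add: c_def)
  have c\<Psi>: "continuous_on UNIV \<Psi>" by (meson DERIV_isCont \<Psi> continuous_at_imp_continuous_on)
  have [measurable]: "\<Psi> \<in> borel_measurable borel" "\<psi> \<in> borel_measurable borel"
    using c\<Psi> \<psi>(2) by (auto intro: borel_measurable_continuous_onI)
  have uv: "\<bar>v s e\<bar> \<le> E * (2 * c)" "\<bar>v' s e\<bar> \<le> E * (rate * (2 * c) + 2 * R)"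
    if "\<bar>a s e\<bar> \<le> c \<and> \<bar>b s e\<bar> \<le> c \<and> \<bar>a' s e\<bar> \<le> R \<and> \<bar>b' s e\<bar> \<le> R" "s < r" for s e
  proof -
    have E: "exp (rate * (s - t0)) \<le> E" unfolding E_def using that(2) rate_pos by simp
    have u: "\<bar>u s e\<bar> \<le> 2 * c" using that(1) unfolding u_def by linarith
    show "\<bar>v s e\<bar> \<le> E * (2 * c)" unfolding v_def abs_mult using E u by (intro mult_mono) (auto simp: E_def)
    have "\<bar>rate * u s e\<bar> \<le> rate * (2 * c)" unfolding abs_mult using rate_pos u by (intro mult_mono) auto
    then have "\<bar>rate * u s e + (a' s e - b' s e)\<bar> \<le> rate * (2 * c) + 2 * R" using that(1) by linarith
    then show "\<bar>v' s e\<bar> \<le> E * (rate * (2 * c) + 2 * R)"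
      unfolding v'_def abs_mult using E by (intro mult_mono) (auto simp: E_def)
  qed
  have bd: "AE e in M. \<forall>s. l < s \<and> s < r \<longrightarrow> \<bar>v s e\<bar> \<le> E * (2 * c) \<and> \<bar>v' s e\<bar> \<le> E * (rate * (2 * c) + 2 * R)"
    using bounded[of r]
  proof eventually_elim
    case (elim e)
    show ?case
    proof (intro allI impI)
      fix s assume "l < s \<and> s < r"
      then have "s \<in> {0..r}" "s < r" using l by auto
      then show "\<bar>v s e\<bar> \<le> E * (2 * c) \<and> \<bar>v' s e\<bar> \<le> E * (rate * (2 * c) + 2 * R)"
        using elim uv[of s e] by (auto simp: c_def)
    qed
  qed
  have bounded_on: "\<exists>C. \<forall>x. \<bar>x\<bar> \<le> E * (2 * c) \<longrightarrow> \<bar>F x\<bar> \<le> C" if "continuous_on UNIV F" for F :: "real \<Rightarrow> real"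
  proof -
    have "compact (F ` {- (E * (2 * c))..E * (2 * c)})"
      by (intro compact_continuous_image continuous_on_subset[OF that]) auto
    then have "bounded (F ` {- (E * (2 * c))..E * (2 * c)})" by (rule compact_imp_bounded)
    then obtain C where C: "\<forall>y \<in> F ` {- (E * (2 * c))..E * (2 * c)}. norm y \<le> C"
      unfolding bounded_iff by blast
    show ?thesis using C by (intro exI[of _ C]) (auto simp: abs_le_iff)
  qed
  obtain C where C: "\<And>x. \<bar>x\<bar> \<le> E * (2 * c) \<Longrightarrow> \<bar>\<psi> x\<bar> \<le> C"
    using bounded_on[OF \<psi>(2)] by blast
  obtain C' where C': "\<And>x. \<bar>x\<bar> \<le> E * (2 * c) \<Longrightarrow> \<bar>\<Psi> x\<bar> \<le> C'"
    using bounded_on[OF c\<Psi>] by blast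
  have "((\<lambda>s. LINT e|M. \<Psi> (v s e)) has_real_derivative (LINT e|M. \<psi> (v s e) * v' s e)) (at s)"
  proof (rule DERIV_integral[where l=l and r=r and C="C * (E * (rate * (2 * c) + 2 * R))"])
    show "finite_measure M" by (rule finite_measure_axioms)
    show m: "(\<lambda>e. \<Psi> (v s e)) \<in> borel_measurable M" if "l < s" "s < r" for s
    proof -
      have "0 \<le> s" using l that by simp
      note [measurable] = v_meas[OF this]
      show ?thesis by measurable
    qed
    show "(\<lambda>e. \<psi> (v s e) * v' s e) \<in> borel_measurable M"
    proof -
      have "0 \<le> s" using l by simp
      note [measurable] = v_meas[OF this] v'_meas[OF this]
      show ?thesis by measurable
    qed
    show "integrable M (\<lambda>e. \<Psi> (v s e))" if s: "l < s" "s < r" for s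
    proof (rule integrable_const_bound[where B=C'])
      show "AE e in M. norm (\<Psi> (v s e)) \<le> C'"
        using bd
      proof eventually_elim
        case (elim e)
        then have "\<bar>v s e\<bar> \<le> E * (2 * c)" using s by blast
        then show ?case using C'[of "v s e"] by simp
      qed
    qed (rule m[OF s])
    show "AE e in M. \<forall>s. l < s \<and> s < r \<longrightarrow>
        ((\<lambda>s. \<Psi> (v s e)) has_real_derivative \<psi> (v s e) * v' s e) (at s) \<and> \<bar>\<psi> (v s e) * v' s e\<bar> \<le> C * (E * (rate * (2 * c) + 2 * R))"
      using bd deriv
    proof eventually_elim
      case (elim e)
      show ?case
      proof (intro allI impI conjI)
        fix s assume s: "l < s \<and> s < r"
        have 1: "\<bar>v s e\<bar> \<le> E * (2 * c)" "\<bar>v' s e\<bar> \<le> E * (rate * (2 * c) + 2 * R)" using elim(1) s by blast+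
        have "s > 0" using s l by simp
        then have da: "((\<lambda>t. a t e) has_real_derivative a' s e) (at s)" "((\<lambda>t. b t e) has_real_derivative b' s e) (at s)"
          using elim(2) by blast+
        have "((\<lambda>s. v s e) has_real_derivative v' s e) (at s)"
          unfolding v_def u_def v'_def
          by (rule derivative_eq_intros da refl)+ (simp add: algebra_simps)
        then show "((\<lambda>s. \<Psi> (v s e)) has_real_derivative \<psi> (v s e) * v' s e) (at s)"
          by (rule DERIV_chain2[OF \<Psi>])
        have 2: "\<bar>\<psi> (v s e)\<bar> \<le> C" by (rule C[OF 1(1)])
        then have "0 \<le> C" using abs_ge_zero order_trans by blast
        then show "\<bar>\<psi> (v s e) * v' s e\<bar> \<le> C * (E * (rate * (2 * c) + 2 * R))"
          unfolding abs_mult by (intro mult_mono 1 2) auto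
      qed
    qed
  qed (use l r in auto)
  then show "\<exists>y. ((\<lambda>s. LINT e|M. \<Psi> (v s e)) has_real_derivative y) (at s) \<and> y \<le> 0"
    by (intro exI[of _ "LINT e|M. \<psi> (v s e) * v' s e"] conjI dissipation[OF s(1) \<psi>])
qed

lemma v_t0: "v t0 e = u t0 e"
  by (simp add: v_def)

lemma v_bounded:
  assumes "t \<ge> 0" obtains B where "AE e in M. \<bar>v t e\<bar> \<le> B" "B \<ge> 0"
proof
  define c where "c = R * (1 + t)"
  have "AE e in M. \<bar>u t e\<bar> \<le> 2 * c"
    using bounded[of t]
  proof eventually_elim
    case (elim e)
    then have "\<bar>a t e\<bar> \<le> c" "\<bar>b t e\<bar> \<le> c" using assms by (auto simp: c_def)
    then show ?case unfolding u_def by linarith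
  qed
  then show "AE e in M. \<bar>v t e\<bar> \<le> exp (rate * (t - t0)) * (2 * c)"
    by eventually_elim (simp add: v_def abs_mult)
  show "0 \<le> exp (rate * (t - t0)) * (2 * c)" using R_nonneg assms by (simp add: c_def)
qed

text \<open>For the uniform norm, \<open>\<Psi>\<close> measures the excess over the level \<open>c\<close>: its integral is zero initially and stays so.\<close>

lemma contraction_uniform:
  assumes t: "t \<ge> t0" and c: "c \<ge> 0" and bd: "AE e in M. \<bar>u t0 e\<bar> \<le> c"
  shows "AE e in M. exp (rate * (t - t0)) * \<bar>u t e\<bar> \<le> c"
proof -
  define \<Psi> where "\<Psi> x = pos2 (x - c) + pos2 (- x - c)" for x
  define \<psi> where "\<psi> x = 2 * max 0 (x - c) - 2 * max 0 (- x - c)" for x :: real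
  have t': "t \<ge> 0" using t t0 by simp
  have \<Psi>_0: "\<Psi> x = 0 \<longleftrightarrow> \<bar>x\<bar> \<le> c" for x
    unfolding \<Psi>_def by (subst add_nonneg_eq_0_iff) auto
  have "(LINT e|M. \<Psi> (v t e)) \<le> (LINT e|M. \<Psi> (v t0 e))"
  proof (rule convex_integral_decreasing[OF t])
    show "(\<Psi> has_real_derivative \<psi> x) (at x)" for x
      unfolding \<Psi>_def \<psi>_def by (auto intro!: derivative_eq_intros)
    show "mono \<psi>" unfolding \<psi>_def by (intro monoI diff_mono mult_left_mono max.mono) auto
    show "continuous_on UNIV \<psi>" unfolding \<psi>_def by (intro continuous_intros)
  qed
  also have "\<dots> = (LINT e|M. 0)"
  proof (rule integral_cong_AE)
    show "(\<lambda>e. \<Psi> (v t0 e)) \<in> borel_measurable M"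
    proof -
      have [measurable]: "v t0 \<in> borel_measurable M" by (rule v_meas) (use t0 in simp)
      show ?thesis unfolding \<Psi>_def by measurable
    qed
    show "AE e in M. \<Psi> (v t0 e) = 0" using bd by eventually_elim (simp add: \<Psi>_0 v_t0)
  qed simp
  finally have le: "(LINT e|M. \<Psi> (v t e)) \<le> 0" by simp
  obtain B where B: "AE e in M. \<bar>v t e\<bar> \<le> B" "B \<ge> 0" using v_bounded[OF t'] .
  have nn: "0 \<le> \<Psi> x" for x by (simp add: \<Psi>_def)
  have i: "integrable M (\<lambda>e. \<Psi> (v t e))"
  proof (rule integrable_const_bound[where B="B\<^sup>2 + B\<^sup>2"])
    show "AE e in M. norm (\<Psi> (v t e)) \<le> B\<^sup>2 + B\<^sup>2"
      using B(1)
    proof eventually_elim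
      case (elim e)
      have "pos2 (v t e - c) \<le> B\<^sup>2" "pos2 (- v t e - c) \<le> B\<^sup>2"
        unfolding pos2_def using elim c B(2) by (intro power_mono; auto simp: abs_le_iff)+
      then show ?case using nn[of "v t e"] by (simp add: \<Psi>_def)
    qed
    show "(\<lambda>e. \<Psi> (v t e)) \<in> borel_measurable M"
    proof -
      note [measurable] = v_meas[OF t']
      show ?thesis unfolding \<Psi>_def by measurable
    qed
  qed
  have "(LINT e|M. \<Psi> (v t e)) = 0"
    using le Bochner_Integration.integral_nonneg[of M "\<lambda>e. \<Psi> (v t e)"] nn by (simp add: order.antisym)
  then have "AE e in M. \<Psi> (v t e) = 0" using integral_nonneg_eq_0_iff_AE[OF i] nn by simp
  then show ?thesis by eventually_elim (simp add: \<Psi>_0, simp add: v_def abs_mult)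
qed

text \<open>The function \<open>|x| ^ p\<close> is not differentiable at \<open>0\<close> for \<open>p = 1\<close>, so it is approximated by
  \<open>(x\<^sup>2 + \<epsilon>) ^ (p/2)\<close>, which is smooth and convex for every \<open>p \<ge> 1\<close>.\<close>

lemma mono_smoothed_power:
  fixes p \<epsilon> :: real assumes p: "p \<ge> 1" and \<epsilon>: "\<epsilon> > 0"
  shows "mono (\<lambda>x. p * x * (x\<^sup>2 + \<epsilon>) powr (p / 2 - 1))"
proof (rule monoI)
  fix x y :: real assume "x \<le> y"
  then show "p * x * (x\<^sup>2 + \<epsilon>) powr (p / 2 - 1) \<le> p * y * (y\<^sup>2 + \<epsilon>) powr (p / 2 - 1)"
  proof (rule DERIV_nonneg_imp_nondecreasing)
    fix z :: real
    have pos: "z\<^sup>2 + \<epsilon> > 0" using \<epsilon> by (simp add: add_nonneg_pos)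
    have "((\<lambda>z. p * z * (z\<^sup>2 + \<epsilon>) powr (p / 2 - 1)) has_real_derivative
      p * (z\<^sup>2 + \<epsilon>) powr (p / 2 - 1) + p * z * ((p / 2 - 1) * (z\<^sup>2 + \<epsilon>) powr (p / 2 - 1 - 1) * (2 * z))) (at z)"
      using pos by (auto intro!: derivative_eq_intros simp: powr_diff divide_simps)
    moreover have "p * (z\<^sup>2 + \<epsilon>) powr (p / 2 - 1) + p * z * ((p / 2 - 1) * (z\<^sup>2 + \<epsilon>) powr (p / 2 - 1 - 1) * (2 * z))
      = p * (z\<^sup>2 + \<epsilon>) powr (p / 2 - 1 - 1) * ((z\<^sup>2 + \<epsilon>) + (p - 2) * z\<^sup>2)"
    proof -
      have "(z\<^sup>2 + \<epsilon>) powr (p / 2 - 1) = (z\<^sup>2 + \<epsilon>) powr (p / 2 - 1 - 1) * (z\<^sup>2 + \<epsilon>)"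
        using pos powr_add[of "z\<^sup>2 + \<epsilon>" "p / 2 - 1 - 1" 1] by simp
      then show ?thesis by (simp add: power2_eq_square algebra_simps)
    qed
    moreover have "(z\<^sup>2 + \<epsilon>) + (p - 2) * z\<^sup>2 = (p - 1) * z\<^sup>2 + \<epsilon>" by (simp add: algebra_simps)
    moreover have "0 \<le> p * (z\<^sup>2 + \<epsilon>) powr (p / 2 - 1 - 1) * ((p - 1) * z\<^sup>2 + \<epsilon>)"
      using p \<epsilon> by simp
    ultimately show "\<exists>D. ((\<lambda>z. p * z * (z\<^sup>2 + \<epsilon>) powr (p / 2 - 1)) has_real_derivative D) (at z) \<and> 0 \<le> D"
      by (metis (no_types, lifting))
  qed
qed

lemma contraction_power:
  assumes t: "t \<ge> t0" and p: "p \<ge> 1"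
  shows "exp (rate * (t - t0)) powr p * (LINT e|M. \<bar>u t e\<bar> powr p) \<le> (LINT e|M. \<bar>u t0 e\<bar> powr p)"
proof -
  define \<epsilon> where "\<epsilon> n = 1 / real (Suc n)" for n
  have \<epsilon>: "\<epsilon> n > 0" "\<epsilon> n \<le> 1" for n by (auto simp: \<epsilon>_def)
  have \<epsilon>0: "\<epsilon> \<longlonglongrightarrow> 0" unfolding \<epsilon>_def by (intro LIMSEQ_Suc lim_const_over_n)
  define \<Psi> where "\<Psi> n x = (x\<^sup>2 + \<epsilon> n) powr (p / 2)" for n x
  have pos: "x\<^sup>2 + \<epsilon> n > 0" for n x using \<epsilon>[of n] by (simp add: add_nonneg_pos)
  have dec: "(LINT e|M. \<Psi> n (v t e)) \<le> (LINT e|M. \<Psi> n (v t0 e))" for n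
  proof (rule convex_integral_decreasing[OF t, where \<psi>="\<lambda>x. p * x * (x\<^sup>2 + \<epsilon> n) powr (p / 2 - 1)"])
    show "(\<Psi> n has_real_derivative p * x * (x\<^sup>2 + \<epsilon> n) powr (p / 2 - 1)) (at x)" for x
      unfolding \<Psi>_def using pos[of x n] by (auto intro!: derivative_eq_intros simp: powr_diff divide_simps)
    show "mono (\<lambda>x. p * x * (x\<^sup>2 + \<epsilon> n) powr (p / 2 - 1))" by (rule mono_smoothed_power[OF p \<epsilon>(1)])
    show "continuous_on UNIV (\<lambda>x. p * x * (x\<^sup>2 + \<epsilon> n) powr (p / 2 - 1))"
      using pos by (intro continuous_intros) (auto simp: less_imp_neq[symmetric])
  qed
  have lim: "(\<lambda>n. LINT e|M. \<Psi> n (v s e)) \<longlonglongrightarrow> (LINT e|M. \<bar>v s e\<bar> powr p)" if s: "s \<ge> 0" for s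
  proof -
    obtain B where B: "AE e in M. \<bar>v s e\<bar> \<le> B" "B \<ge> 0" using v_bounded[OF s] .
    note [measurable] = v_meas[OF s]
    show ?thesis
    proof (rule integral_dominated_convergence[where w="\<lambda>_. (B\<^sup>2 + 1) powr (p / 2)"])
      show "AE e in M. (\<lambda>n. \<Psi> n (v s e)) \<longlonglongrightarrow> \<bar>v s e\<bar> powr p"
      proof (rule AE_I2)
        fix e
        have "(\<lambda>n. \<Psi> n (v s e)) \<longlonglongrightarrow> ((v s e)\<^sup>2 + 0) powr (p / 2)"
          unfolding \<Psi>_def by (rule tendsto_powr'[OF tendsto_add[OF tendsto_const \<epsilon>0] tendsto_const])
            (use p in \<open>auto intro!: always_eventually simp: less_imp_le[OF \<epsilon>(1)]\<close>)
        also have "((v s e)\<^sup>2 + 0) powr (p / 2) = \<bar>v s e\<bar> powr p"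
        proof (cases "v s e = 0")
          case False
          then have "(v s e)\<^sup>2 = \<bar>v s e\<bar> powr 2" by simp
          then show ?thesis by (simp only: add_0_right powr_powr) simp
        qed simp
        finally show "(\<lambda>n. \<Psi> n (v s e)) \<longlonglongrightarrow> \<bar>v s e\<bar> powr p" .
      qed
      show "AE e in M. norm (\<Psi> n (v s e)) \<le> (B\<^sup>2 + 1) powr (p / 2)" for n
        using B(1)
      proof eventually_elim
        case (elim e)
        then have "(v s e)\<^sup>2 \<le> B\<^sup>2" by (simp add: abs_le_square_iff[symmetric] B(2))
        then have "(v s e)\<^sup>2 + \<epsilon> n \<le> B\<^sup>2 + 1" using \<epsilon>(2)[of n] by simp
        then show ?case unfolding \<Psi>_def using p pos[of "v s e" n] by (simp add: powr_mono2)
      qed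
      show "(\<lambda>e. \<bar>v s e\<bar> powr p) \<in> borel_measurable M" by measurable
      show "(\<lambda>e. \<Psi> n (v s e)) \<in> borel_measurable M" for n unfolding \<Psi>_def by measurable
    qed simp
  qed
  have "(LINT e|M. \<bar>v t e\<bar> powr p) \<le> (LINT e|M. \<bar>v t0 e\<bar> powr p)"
    by (rule LIMSEQ_le[OF lim lim]) (use t t0 dec in auto)
  moreover have "(LINT e|M. \<bar>v t e\<bar> powr p) = exp (rate * (t - t0)) powr p * (LINT e|M. \<bar>u t e\<bar> powr p)"
    by (simp add: v_def abs_mult powr_mult)
  ultimately show ?thesis by (simp add: v_t0)
qed

end

section \<open>The modified Wasserstein metric in terms of quantiles\<close>

lemma ennpowr_ennreal: "0 \<le> x \<Longrightarrow> ennpowr (ennreal x) p = ennreal (x powr p)"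
  by (simp add: ennpowr_def)

lemma ennpowr_ennpowr: "x < top \<Longrightarrow> 0 < p \<Longrightarrow> ennpowr (ennpowr x (1 / p)) p = x"
  by (cases x) (auto simp: ennpowr_def powr_powr)

locale two_frequency_measures = N1: frequency_measure g \<nu>1 + N2: frequency_measure g \<nu>2 for g \<nu>1 \<nu>2
begin

definition gap :: "real \<times> real \<Rightarrow> real" where
  "gap z = \<bar>N1.quantile z - N2.quantile z\<bar>"

lemma gap_nonneg [simp]: "0 \<le> gap z" by (simp add: gap_def)

lemma gap_le: "gap z \<le> 2 * pi"
  using N1.quantile_bounds[of z] N2.quantile_bounds[of z] unfolding gap_def by linarith

lemma gap_measurable [measurable]: "gap \<in> borel_measurable (borel \<Otimes>\<^sub>M borel)"
  unfolding gap_def by measurable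

lemma gap_eq:
  "0 < \<eta> \<Longrightarrow> \<eta> < g w \<Longrightarrow> ennreal \<bar>pseudo_inverse g \<nu>1 \<eta> w - pseudo_inverse g \<nu>2 \<eta> w\<bar> = ennreal (gap (w, \<eta>))"
  by (simp add: gap_def N1.quantile_def N2.quantile_def)

lemma gap_real_eq:
  "0 < \<eta> \<Longrightarrow> \<eta> < g w \<Longrightarrow> \<bar>pseudo_inverse g \<nu>1 \<eta> w - pseudo_inverse g \<nu>2 \<eta> w\<bar> = gap (w, \<eta>)"
  by (simp add: gap_def N1.quantile_def N2.quantile_def)

text \<open>For finite \<open>p\<close> the iterated norm is, by Tonelli's theorem, a single \<open>L\<^sup>p\<close> norm over the region under the graph.\<close>

lemma W_tilde_finite:
  assumes p: "1 \<le> p" "p < top"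
  defines "r \<equiv> enn2real p"
  shows "W_tilde p g \<nu>1 \<nu>2 = ennreal ((LINT z|mass_space g. gap z powr r) powr (1 / r))"
proof -
  interpret M: prob_space "mass_space g" by (rule N1.prob_mass_space)
  have r: "1 \<le> r"
  proof -
    have "enn2real 1 \<le> enn2real p" using p by (intro enn2real_mono) auto
    then show ?thesis by (simp add: r_def)
  qed
  have ptop: "p \<noteq> top" using p by auto
  define I where "I w = (\<integral>\<^sup>+\<eta>. ennreal (gap (w, \<eta>) powr r) * indicator {0<..<g w} \<eta> \<partial>lborel)" for w
  have I_le: "I w < top" for w
  proof -
    have "I w \<le> (\<integral>\<^sup>+\<eta>. ennreal ((2 * pi) powr r) * indicator {0<..<g w} \<eta> \<partial>lborel)"
      unfolding I_def using r gap_le by (intro nn_integral_mono mult_right_mono ennreal_leI powr_mono2) auto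
    also have "\<dots> = ennreal ((2 * pi) powr r) * ennreal (g w)"
      by (subst nn_integral_cmult_indicator) (auto simp: N1.g_nonneg)
    also have "\<dots> < top" by (simp add: ennreal_mult_less_top)
    finally show ?thesis .
  qed
  have inner: "(\<integral>\<^sup>+\<eta>. ennpowr (ennreal \<bar>pseudo_inverse g \<nu>1 \<eta> w - pseudo_inverse g \<nu>2 \<eta> w\<bar>) r \<partial>restrict_space lborel {0<..<g w}) = I w" for w
  proof -
    have "(\<integral>\<^sup>+\<eta>. ennpowr (ennreal \<bar>pseudo_inverse g \<nu>1 \<eta> w - pseudo_inverse g \<nu>2 \<eta> w\<bar>) r \<partial>restrict_space lborel {0<..<g w})
      = (\<integral>\<^sup>+\<eta>. ennpowr (ennreal \<bar>pseudo_inverse g \<nu>1 \<eta> w - pseudo_inverse g \<nu>2 \<eta> w\<bar>) r * indicator {0<..<g w} \<eta> \<partial>lborel)"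
      by (rule nn_integral_restrict_space) simp
    also have "\<dots> = I w"
      unfolding I_def by (intro nn_integral_cong) (auto simp: indicator_def gap_real_eq ennpowr_ennreal)
    finally show ?thesis .
  qed
  have W: "ennpowr (W_dist p g \<nu>1 \<nu>2 w) r = I w" for w
    unfolding W_dist_def Lp_norm_def using ptop r I_le
    by (simp add: r_def[symmetric] inner ennpowr_ennpowr)
  have "W_tilde p g \<nu>1 \<nu>2 = ennpowr (\<integral>\<^sup>+w. I w \<partial>lborel) (1 / r)"
    unfolding W_tilde_def Lp_norm_def using ptop by (simp add: r_def[symmetric] W)
  also have "(\<integral>\<^sup>+w. I w \<partial>lborel) = (\<integral>\<^sup>+z. ennreal (gap z powr r) \<partial>mass_space g)"
    unfolding I_def by (rule nn_integral_mass_space[OF N1.g_measurable, symmetric]) measurable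
  also have "\<dots> = ennreal (LINT z|mass_space g. gap z powr r)"
  proof (rule nn_integral_eq_integral)
    show "integrable (mass_space g) (\<lambda>z. gap z powr r)"
      by (rule M.integrable_const_bound[of _ "(2 * pi) powr r"]) (use r gap_le in \<open>auto intro!: powr_mono2\<close>)
  qed simp
  finally show ?thesis by (simp add: ennpowr_ennreal)
qed

lemma W_dist_top_le_iff:
  "W_dist top g \<nu>1 \<nu>2 w \<le> c \<longleftrightarrow> (AE \<eta> in lborel. 0 < \<eta> \<and> \<eta> < g w \<longrightarrow> ennreal (gap (w, \<eta>)) \<le> c)"
proof -
  let ?M = "restrict_space lborel {0<..<g w}"
  let ?f = "\<lambda>\<eta>. ennreal \<bar>pseudo_inverse g \<nu>1 \<eta> w - pseudo_inverse g \<nu>2 \<eta> w\<bar>"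
  have m: "?f \<in> borel_measurable ?M"
  proof (subst measurable_cong)
    show "?f \<eta> = ennreal (gap (w, \<eta>))" if "\<eta> \<in> space ?M" for \<eta>
      using that by (intro gap_eq) (auto simp: space_restrict_space)
    show "(\<lambda>\<eta>. ennreal (gap (w, \<eta>))) \<in> borel_measurable ?M"
      by (intro measurable_restrict_space1) measurable
  qed
  have "W_dist top g \<nu>1 \<nu>2 w \<le> c \<longleftrightarrow> esssup ?M ?f \<le> c" by (simp add: W_dist_def Lp_norm_def)
  also have "\<dots> \<longleftrightarrow> (AE \<eta> in ?M. ?f \<eta> \<le> c)"
  proof
    assume "esssup ?M ?f \<le> c"
    then show "AE \<eta> in ?M. ?f \<eta> \<le> c" using esssup_AE[of ?f ?M] by (auto elim!: eventually_mono intro: order_trans)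
  qed (rule esssup_I[OF m])
  also have "\<dots> \<longleftrightarrow> (AE \<eta> in lborel. \<eta> \<in> {0<..<g w} \<longrightarrow> ?f \<eta> \<le> c)"
    by (rule AE_restrict_space_iff) simp
  also have "\<dots> \<longleftrightarrow> (AE \<eta> in lborel. 0 < \<eta> \<and> \<eta> < g w \<longrightarrow> ennreal (gap (w, \<eta>)) \<le> c)"
    by (intro AE_cong) (auto simp: gap_eq)
  finally show ?thesis .
qed

text \<open>The essential supremum over \<open>\<Omega>\<close> is characterized by almost-everywhere bounds only for measurable functions. The
  level sets of the inner essential supremum are described by measures of sections, which are measurable.\<close>

lemma W_dist_top_measurable: "W_dist top g \<nu>1 \<nu>2 \<in> borel_measurable borel"
proof (rule borel_measurableI_greater)
  fix y :: ennreal
  define S where "S = {z \<in> space (borel \<Otimes>\<^sub>M borel). 0 < snd z \<and> snd z < g (fst z) \<and> y < ennreal (gap z)}"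
  have S: "S \<in> sets (borel \<Otimes>\<^sub>M lborel)"
  proof -
    have "S \<in> sets (borel \<Otimes>\<^sub>M borel)" unfolding S_def by measurable
    then show ?thesis by (simp cong: sets_pair_measure_cong)
  qed
  have [measurable]: "(\<lambda>w. emeasure lborel (Pair w -` S)) \<in> borel_measurable borel"
    by (rule lborel.measurable_emeasure_Pair[OF S])
  have "y < W_dist top g \<nu>1 \<nu>2 w \<longleftrightarrow> emeasure lborel (Pair w -` S) \<noteq> 0" for w
  proof -
    have "W_dist top g \<nu>1 \<nu>2 w \<le> y \<longleftrightarrow> (AE \<eta> in lborel. \<eta> \<notin> Pair w -` S)"
      unfolding W_dist_top_le_iff by (intro AE_cong) (auto simp: S_def space_pair_measure not_less)
    also have "\<dots> \<longleftrightarrow> emeasure lborel (Pair w -` S) = 0"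
      by (rule AE_iff_measurable) (use sets_Pair1[OF S] in auto)
    finally show ?thesis by (simp add: not_le[symmetric])
  qed
  then have "{w \<in> space borel. y < W_dist top g \<nu>1 \<nu>2 w} = {w \<in> space borel. emeasure lborel (Pair w -` S) \<noteq> 0}" by auto
  also have "\<dots> \<in> sets borel" by measurable
  finally show "{w \<in> space borel. y < W_dist top g \<nu>1 \<nu>2 w} \<in> sets borel" .
qed

lemma W_tilde_top_le_iff: "W_tilde top g \<nu>1 \<nu>2 \<le> c \<longleftrightarrow> (AE z in mass_space g. ennreal (gap z) \<le> c)"
proof -
  have "W_tilde top g \<nu>1 \<nu>2 \<le> c \<longleftrightarrow> esssup lborel (W_dist top g \<nu>1 \<nu>2) \<le> c"
    by (simp add: W_tilde_def Lp_norm_def)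
  also have "\<dots> \<longleftrightarrow> (AE w in lborel. W_dist top g \<nu>1 \<nu>2 w \<le> c)"
  proof
    assume "esssup lborel (W_dist top g \<nu>1 \<nu>2) \<le> c"
    then show "AE w in lborel. W_dist top g \<nu>1 \<nu>2 w \<le> c"
      using esssup_AE[of "W_dist top g \<nu>1 \<nu>2" lborel] by (auto elim!: eventually_mono intro: order_trans)
  next
    assume "AE w in lborel. W_dist top g \<nu>1 \<nu>2 w \<le> c"
    then show "esssup lborel (W_dist top g \<nu>1 \<nu>2) \<le> c"
      by (intro esssup_I) (use W_dist_top_measurable in simp)
  qed
  also have "\<dots> \<longleftrightarrow> (AE z in mass_space g. ennreal (gap z) \<le> c)"
    unfolding W_dist_top_le_iff by (rule AE_mass_space[OF N1.g_measurable, symmetric]) measurable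
  finally show ?thesis .
qed

end

section \<open>Solutions as families of phases\<close>

context kuramoto_arc
begin

lemma frequency_measure0: "frequency_measure g \<mu>0"
  using frequency_density sets0 prob0 density0 by (simp add: frequency_measure_def)

lemma frequency_measure: "t \<ge> 0 \<Longrightarrow> frequency_measure g (\<mu> t)"
  using frequency_density sets prob marginal by (simp add: frequency_measure_def has_frequency_density_def)

sublocale M0: frequency_measure g \<mu>0 by (rule frequency_measure0)

text \<open>Points of the region under the graph of \<open>g\<close> label the particles: \<open>phase t z\<close> is the position at time \<open>t\<close> on the
  characteristic that starts at the initial pseudo-inverse. By \<open>quantile_phase\<close> below it is the pseudo-inverse at
  time \<open>t\<close>, so that the labels of two solutions can be compared.\<close>

definition phase :: "real \<Rightarrow> real \<times> real \<Rightarrow> real" where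
  "phase t z = curve (M0.quantile z) (fst z) t"

definition phase' :: "real \<Rightarrow> real \<times> real \<Rightarrow> real" where
  "phase' t z = curve' (M0.quantile z) (fst z) t"

lemma transport_pair: "t \<ge> 0 \<Longrightarrow> frequency_measure_pair g \<mu>0 (\<mu> t) (\<lambda>\<theta> w. curve \<theta> w t)"
proof -
  assume t: "t \<ge> 0"
  have right: "measure \<mu>0 {x \<in> space \<mu>0. p < snd x \<and> snd x < q \<and> \<theta> < fst x}
        \<le> measure (\<mu> t) {x \<in> space (\<mu> t). p < snd x \<and> snd x < q \<and> curve \<theta> p t < fst x}" if "p < q" for p q \<theta>
    using transport[OF t, of 1 p q p \<theta>] that by simp
  have left: "measure \<mu>0 {x \<in> space \<mu>0. p < snd x \<and> snd x < q \<and> fst x < \<theta>}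
        \<le> measure (\<mu> t) {x \<in> space (\<mu> t). p < snd x \<and> snd x < q \<and> fst x < curve \<theta> q t}" if "p < q" for p q \<theta>
    using transport[OF t, of "-1" p q q \<theta>] that by simp
  show ?thesis
    unfolding frequency_measure_pair_def frequency_measure_pair_axioms_def
    using frequency_measure0 frequency_measure[OF t] continuous_curve_param[OF t] curve_mono[OF _ _ t] right left
    by blast
qed

lemma phase_measurable [measurable]: "t \<ge> 0 \<Longrightarrow> phase t \<in> borel_measurable (borel \<Otimes>\<^sub>M borel)"
  unfolding phase_def by measurable

lemma phase'_measurable: assumes t: "t \<ge> 0" shows "phase' t \<in> borel_measurable (borel \<Otimes>\<^sub>M borel)"
proof -
  have [measurable]: "(\<lambda>x. drift x t) \<in> borel_measurable borel"
    by (intro borel_measurable_continuous_onI continuous_intros)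
  note [measurable] = phase_measurable[OF t]
  have "phase' t = (\<lambda>z. fst z + drift (phase t z) t)"
    unfolding phase'_def phase_def using curve'_eq[OF t] by auto
  then show ?thesis by simp
qed

lemma quantile_phase: "t \<ge> 0 \<Longrightarrow> AE z in mass_space g. frequency_measure.quantile g (\<mu> t) z = phase t z"
  unfolding phase_def by (rule frequency_measure_pair.quantile_transport[OF transport_pair])

lemma integral_phase:
  fixes f :: "real \<times> real \<Rightarrow> real"
  assumes t: "t \<ge> 0" and f [measurable]: "f \<in> borel_measurable (borel \<Otimes>\<^sub>M borel)"
  shows "(LINT x|\<mu> t. f x) = (LINT z|mass_space g. f (phase t z, fst z))"
proof -
  interpret T: frequency_measure g "\<mu> t" by (rule frequency_measure[OF t])
  note [measurable] = phase_measurable[OF t]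
  have "(LINT x|\<mu> t. f x) = (LINT z|mass_space g. f (T.quantile z, fst z))" by (rule T.integral_quantile[OF f])
  also have "\<dots> = (LINT z|mass_space g. f (phase t z, fst z))"
    by (intro integral_cong_AE eventually_mono[OF quantile_phase[OF t]]) auto
  finally show ?thesis .
qed

lemma AE_of_phase:
  assumes t: "t \<ge> 0" and P: "Measurable.pred (borel \<Otimes>\<^sub>M borel) P" and "AE x in \<mu> t. P x"
  shows "AE z in mass_space g. P (phase t z, fst z)"
proof -
  interpret T: frequency_measure g "\<mu> t" by (rule frequency_measure[OF t])
  show ?thesis
    using T.AE_quantile[OF P assms(3)] quantile_phase[OF t] by eventually_elim simp
qed

lemma frequency_AE: "AE z in mass_space g. a \<le> fst z \<and> fst z \<le> b"
proof -
  have "Measurable.pred (borel \<Otimes>\<^sub>M borel) (\<lambda>x :: real \<times> real. a \<le> snd x \<and> snd x \<le> b)" by measurable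
  from M0.AE_quantile[OF this range0] show ?thesis by simp
qed

definition bound :: real where "bound = 2 * pi + \<bar>a\<bar> + \<bar>b\<bar> + 2 * K"

lemma phase_bounds:
  assumes "a \<le> fst z" "fst z \<le> b" "t \<ge> 0"
  shows "\<bar>phase t z\<bar> \<le> bound * (1 + t)" "\<bar>phase' t z\<bar> \<le> bound"
proof -
  have w: "\<bar>fst z\<bar> \<le> \<bar>a\<bar> + \<bar>b\<bar>" using assms by linarith
  have d: "\<bar>phase' s z\<bar> \<le> \<bar>a\<bar> + \<bar>b\<bar> + 2 * K" if "s \<ge> 0" for s
    unfolding phase'_def curve'_eq[OF that] using w drift_bound[of "curve (M0.quantile z) (fst z) s" s] by linarith
  then show "\<bar>phase' t z\<bar> \<le> bound" using d[OF assms(3)] pi_gt_zero unfolding bound_def by linarith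
  have "norm (phase t z - phase 0 z) \<le> (\<bar>a\<bar> + \<bar>b\<bar> + 2 * K) * norm (t - 0)"
  proof (rule field_differentiable_bound[where S="{0..t}" and f'="\<lambda>s. phase' s z"])
    show "((\<lambda>s. phase s z) has_field_derivative phase' s z) (at s within {0..t})" if "s \<in> {0..t}" for s
      unfolding phase_def phase'_def by (rule has_field_derivative_at_within[OF DERIV_curve])
  qed (use d assms in auto)
  moreover have "\<bar>phase 0 z\<bar> \<le> 2 * pi" using M0.quantile_bounds[of z] by (simp add: phase_def)
  ultimately have "\<bar>phase t z\<bar> \<le> 2 * pi + (\<bar>a\<bar> + \<bar>b\<bar> + 2 * K) * t" using assms(3) by simp
  also have "\<dots> \<le> bound * (1 + t)"
  proof -
    have "0 \<le> 2 * pi * t" "0 \<le> \<bar>a\<bar> + \<bar>b\<bar> + 2 * K" using assms(3) K_pos by auto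
    then show ?thesis by (simp add: bound_def algebra_simps)
  qed
  finally show "\<bar>phase t z\<bar> \<le> bound * (1 + t)" .
qed

lemma phase_equation:
  assumes t: "t \<ge> 0" shows "phase' t z = fst z - K * (LINT z'|mass_space g. sin (phase t z - phase t z'))"
proof -
  have "(LINT x|\<mu> t. sin (phase t z - fst x)) = (LINT z'|mass_space g. sin (phase t z - fst (phase t z', fst z')))"
    by (rule integral_phase[OF t]) measurable
  then show ?thesis
    unfolding phase'_def curve'_eq[OF t] phase_def[symmetric] by (simp add: drift_eq[OF t])
qed

lemma mean_phase: assumes t: "t \<ge> 0" shows "(LINT z|mass_space g. phase t z) = pi"
  using integral_phase[OF t, of fst] mean[OF t] by simp

lemma phase_close:
  assumes t: "t \<ge> 0" shows "AE z in mass_space g. AE z' in mass_space g. \<bar>phase t z - phase t z'\<bar> \<le> width t"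
proof -
  have "Measurable.pred (borel \<Otimes>\<^sub>M borel) (\<lambda>x :: real \<times> real. lower t \<le> fst x \<and> fst x \<le> upper t)" by measurable
  from AE_of_phase[OF t this in_arc[OF t]] have *: "AE z in mass_space g. lower t \<le> phase t z \<and> phase t z \<le> upper t" by simp
  from * show ?thesis
  proof eventually_elim
    case (elim z)
    from * show ?case by eventually_elim (use elim in \<open>auto simp: width_def abs_le_iff\<close>)
  qed
qed

end

section \<open>Supports\<close>

definition preimage_cis :: "(complex \<times> real) set \<Rightarrow> (real \<times> real) set" where
  "preimage_cis U = {(\<theta>', \<Omega>') \<in> {0..<2 * pi} \<times> UNIV. (cis \<theta>', \<Omega>') \<in> U}"

lemma spt_iff: "(\<theta>, w) \<in> spt \<nu> \<longleftrightarrow> \<theta> \<in> {0..<2 * pi} \<and>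
    (\<forall>U. open U \<and> (cis \<theta>, w) \<in> U \<longrightarrow> emeasure \<nu> (preimage_cis U) > 0)"
  by (simp add: spt_def preimage_cis_def)

lemma preimage_cis_sets:
  assumes "open U" shows "preimage_cis U \<in> sets phase_borel"
proof -
  have "continuous_on UNIV (\<lambda>x :: real \<times> real. (cis (fst x), snd x))"
    by (intro continuous_intros)
  then have "open ((\<lambda>x :: real \<times> real. (cis (fst x), snd x)) -` U)"
    using assms by (simp add: continuous_on_open_vimage)
  then have "(\<lambda>x :: real \<times> real. (cis (fst x), snd x)) -` U \<in> sets borel" by auto
  moreover have "preimage_cis U = {0..<2 * pi} \<times> UNIV \<inter> ((\<lambda>x. (cis (fst x), snd x)) -` U)"
    by (auto simp: preimage_cis_def)
  ultimately show ?thesis unfolding phase_borel_def by (auto simp: sets_restrict_space)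
qed

text \<open>Second countability of the product of circle and line: the complement of the support is a countable union of null
  sets.\<close>

lemma AE_spt:
  assumes s: "sets \<nu> = sets phase_borel" shows "AE x in \<nu>. x \<in> spt \<nu>"
proof -
  obtain B :: "(complex \<times> real) set set" where B: "countable B" "topological_basis B"
    using ex_countable_basis by blast
  define N where "N = (\<Union>U\<in>{U\<in>B. emeasure \<nu> (preimage_cis U) = 0}. preimage_cis U)"
  have "N \<in> null_sets \<nu>"
    unfolding N_def
  proof (rule null_sets_UN')
    show "countable {U \<in> B. emeasure \<nu> (preimage_cis U) = 0}" using B(1) by auto
    show "preimage_cis U \<in> null_sets \<nu>" if "U \<in> {U \<in> B. emeasure \<nu> (preimage_cis U) = 0}" for U
      using that preimage_cis_sets[of U] topological_basis_open[OF B(2)] s by (auto intro: null_setsI)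
  qed
  from AE_not_in[OF this] show ?thesis
    using AE_space
  proof eventually_elim
    case (elim x)
    obtain \<theta> w where x: "x = (\<theta>, w)" by (cases x)
    have \<theta>: "\<theta> \<in> {0..<2 * pi}" using elim(2) by (simp add: x space_phase[OF s])
    have "emeasure \<nu> (preimage_cis U) > 0" if U: "open U" "(cis \<theta>, w) \<in> U" for U
    proof -
      obtain V where V: "V \<in> B" "(cis \<theta>, w) \<in> V" "V \<subseteq> U" using topological_basisE[OF B(2) U] .
      have "x \<in> preimage_cis V" using \<theta> V by (simp add: preimage_cis_def x)
      then have "emeasure \<nu> (preimage_cis V) \<noteq> 0" using elim(1) V(1) by (auto simp: N_def)
      moreover have "emeasure \<nu> (preimage_cis V) \<le> emeasure \<nu> (preimage_cis U)"
        using V(3) preimage_cis_sets[OF U(1)] s by (intro emeasure_mono) (auto simp: preimage_cis_def)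
      ultimately show ?thesis by (metis order_less_le_trans zero_less_iff_neq_zero)
    qed
    then show ?case using \<theta> by (simp add: x spt_iff)
  qed
qed

lemma spt_not_null:
  assumes s: "sets \<nu> = sets phase_borel" and x: "x \<in> spt \<nu>"
    and U: "open U" "(cis (fst x), snd x) \<in> U" and P: "AE x in \<nu>. (cis (fst x), snd x) \<notin> U"
  shows False
proof -
  have "AE x in \<nu>. x \<notin> preimage_cis U" using P by eventually_elim (auto simp: preimage_cis_def)
  then have "emeasure \<nu> (preimage_cis U) = 0"
    using preimage_cis_sets[OF U(1)] s by (subst (asm) AE_iff_measurable[of "preimage_cis U"])
      (auto simp: space_phase[OF s] preimage_cis_def)
  moreover have "emeasure \<nu> (preimage_cis U) > 0"
    using x U by (cases x) (simp add: spt_iff)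
  ultimately show False by simp
qed

lemma cis_inj_on_circle:
  assumes "cis x = cis y" "x \<in> {0..<2 * pi}" "y \<in> {0..<2 * pi}" shows "x = y"
proof -
  have "sin x = sin y \<and> cos x = cos y" using assms(1) by (simp add: cis.code complex_eq_iff)
  then obtain n :: int where n: "x = y + 2 * pi * n" by (auto simp: sin_cos_eq_iff)
  then have "\<bar>2 * pi * real_of_int n\<bar> < 2 * pi" using assms(2,3) by auto
  then have "\<bar>real_of_int n\<bar> < 1" using pi_gt_zero by (simp add: abs_mult)
  then have "n = 0" by linarith
  then show ?thesis using n by simp
qed

text \<open>The image of \<open>[l, u]\<close> on the circle is compact, so the phases outside form an open null set, which the support
  avoids.\<close>

lemma D_theta_le:
  assumes s: "sets \<nu> = sets phase_borel" and l: "0 \<le> l" "l \<le> u" "u < 2 * pi"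
    and AE: "AE x in \<nu>. l \<le> fst x \<and> fst x \<le> u"
  shows "D_theta \<nu> \<le> u - l"
proof -
  have "fst ` spt \<nu> \<subseteq> {l..u}"
  proof
    fix \<theta> assume "\<theta> \<in> fst ` spt \<nu>"
    then obtain w where x: "(\<theta>, w) \<in> spt \<nu>" by auto
    have \<theta>: "\<theta> \<in> {0..<2 * pi}" using x by (simp add: spt_iff)
    show "\<theta> \<in> {l..u}"
    proof (rule ccontr)
      assume neg: "\<theta> \<notin> {l..u}"
      define U where "U = (- (cis ` {l..u})) \<times> (UNIV :: real set)"
      have "compact (cis ` {l..u})" by (intro compact_continuous_image continuous_intros) auto
      then have U: "open U" unfolding U_def by (intro open_Times open_Compl compact_imp_closed) auto
      have "cis \<theta> \<notin> cis ` {l..u}" using cis_inj_on_circle[OF _ \<theta>] neg l by fastforce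
      then have "(cis (fst (\<theta>, w)), snd (\<theta>, w)) \<in> U" by (simp add: U_def)
      moreover have "AE x in \<nu>. (cis (fst x), snd x) \<notin> U" using AE by eventually_elim (auto simp: U_def)
      ultimately show False using spt_not_null[OF s x U] by blast
    qed
  qed
  then have "diameter (fst ` spt \<nu>) \<le> diameter {l..u}" by (rule diameter_subset) simp
  also have "\<dots> = u - l" using l by (simp add: diameter_closed_interval)
  finally show ?thesis by (simp add: D_theta_def)
qed

lemma range_bounds:
  fixes S :: "real set"
  assumes S: "S \<noteq> {}" "bounded S"
  shows "\<exists>l u. S \<subseteq> {l..u} \<and> u - l \<le> diameter S"
proof (intro exI conjI)
  have bd: "bdd_above S" "bdd_below S" using S(2) bounded_imp_bdd_above bounded_imp_bdd_below by auto
  show "S \<subseteq> {Inf S..Sup S}" using cInf_lower[OF _ bd(2)] cSup_upper[OF _ bd(1)] by auto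
  have d: "x - y \<le> diameter S" if "x \<in> S" "y \<in> S" for x y
    using diameter_bounded_bound[OF S(2) that] by (simp add: dist_real_def)
  have "Sup S - diameter S \<le> y" if "y \<in> S" for y
  proof -
    have "Sup S \<le> y + diameter S"
    proof (rule cSup_least[OF S(1)])
      fix x assume "x \<in> S" then show "x \<le> y + diameter S" using d[OF _ that, of x] by linarith
    qed
    then show ?thesis by simp
  qed
  then have "Sup S - diameter S \<le> Inf S" by (rule cInf_greatest[OF S(1)])
  then show "Sup S - Inf S \<le> diameter S" by simp
qed

context frequency_measure
begin

lemma spt_nonempty: "spt \<nu> \<noteq> {}"
proof
  assume "spt \<nu> = {}"
  then have "AE x in \<nu>. False" using AE_spt[OF sets_nu] by simp
  then show False by simp
qed

lemma phase_range: "\<exists>l u. (AE x in \<nu>. l \<le> fst x \<and> fst x \<le> u) \<and> u - l \<le> D_theta \<nu> \<and> 0 \<le> l \<and> u \<le> 2 * pi"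
proof -
  have "fst ` spt \<nu> \<subseteq> {0..<2 * pi}" by (auto simp: spt_def)
  then have bd: "bounded (fst ` spt \<nu>)" by (rule bounded_subset[rotated]) simp
  define S where "S = fst ` spt \<nu>"
  have S: "S \<noteq> {}" "bounded S" "S \<subseteq> {0..<2 * pi}" using spt_nonempty bd \<open>fst ` spt \<nu> \<subseteq> {0..<2 * pi}\<close> by (auto simp: S_def)
  obtain l u where lu: "S \<subseteq> {l..u}" "u - l \<le> diameter S" using range_bounds[OF S(1,2)] by blast
  have "AE x in \<nu>. max 0 l \<le> fst x \<and> fst x \<le> min u (2 * pi)"
    using AE_spt[OF sets_nu]
  proof eventually_elim
    case (elim x)
    then have "fst x \<in> S" by (auto simp: S_def)
    then show ?case using lu(1) S(3) by force
  qed
  moreover have "min u (2 * pi) - max 0 l \<le> D_theta \<nu>" using lu(2) by (simp add: D_theta_def S_def)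
  ultimately show ?thesis by (intro exI[of _ "max 0 l"] exI[of _ "min u (2 * pi)"]) auto
qed

lemma AE_frequency_iff:
  assumes P: "Measurable.pred borel P"
  shows "(AE x in \<nu>. P (snd x)) \<longleftrightarrow> (AE w in lborel. 0 < g w \<longrightarrow> P w)"
proof -
  have S: "{x \<in> space borel. P x} \<in> sets borel" using P by (simp add: pred_def)
  have "(AE x in \<nu>. P (snd x)) \<longleftrightarrow> (AE w in distr \<nu> borel snd. P w)"
    by (rule AE_distr_iff[OF snd_measurable S, symmetric])
  also have "\<dots> \<longleftrightarrow> (AE w in density lborel (\<lambda>w. ennreal (g w)). P w)"
    by (simp only: density_nu[unfolded has_frequency_density_def])
  also have "\<dots> \<longleftrightarrow> (AE w in lborel. 0 < g w \<longrightarrow> P w)"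
    by (subst AE_density) auto
  finally show ?thesis .
qed

text \<open>The bounded support of \<open>g\<close> makes the projection of the support bounded; the diameter of an unbounded set would not
  bound anything.\<close>

lemma frequency_range: "\<exists>a b. (AE x in \<nu>. a \<le> snd x \<and> snd x \<le> b) \<and> b - a \<le> D_Omega \<nu>"
proof -
  obtain R where R: "\<And>w. g w \<noteq> 0 \<Longrightarrow> \<bar>w\<bar> \<le> R"
    using freq by (auto simp: frequency_density_def bounded_iff)
  have AR: "AE x in \<nu>. \<bar>snd x\<bar> \<le> R"
    by (subst AE_frequency_iff) (auto intro!: AE_I2 R)
  have "snd ` spt \<nu> \<subseteq> {- R..R}"
  proof
    fix w assume "w \<in> snd ` spt \<nu>"
    then obtain \<theta> where x: "(\<theta>, w) \<in> spt \<nu>" by auto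
    show "w \<in> {- R..R}"
    proof (rule ccontr)
      assume neg: "w \<notin> {- R..R}"
      define U where "U = (UNIV :: complex set) \<times> (- {- R..R})"
      have U: "open U" unfolding U_def by (intro open_Times open_Compl) auto
      have "(cis (fst (\<theta>, w)), snd (\<theta>, w)) \<in> U" using neg by (simp add: U_def)
      moreover have "AE x in \<nu>. (cis (fst x), snd x) \<notin> U" using AR by eventually_elim (auto simp: U_def)
      ultimately show False using spt_not_null[OF sets_nu x U] by blast
    qed
  qed
  then have "bounded (snd ` spt \<nu>)" by (rule bounded_subset[rotated]) simp
  then obtain a b where ab: "snd ` spt \<nu> \<subseteq> {a..b}" "b - a \<le> diameter (snd ` spt \<nu>)"
    using range_bounds[of "snd ` spt \<nu>"] spt_nonempty by auto
  have "AE x in \<nu>. a \<le> snd x \<and> snd x \<le> b"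
    using AE_spt[OF sets_nu]
  proof eventually_elim
    case (elim x)
    then have "snd x \<in> snd ` spt \<nu>" by simp
    then show ?case using ab(1) by auto
  qed
  then show ?thesis using ab(2) by (auto simp: D_Omega_def)
qed

end

section \<open>The contraction estimate\<close>

text \<open>An interval that carries the phases contains their mean \<open>\<pi>\<close>; it is extended by the same amount on both
  sides to have length \<open>D\<close>.\<close>

lemma initial_arc:
  assumes fm: "frequency_measure g \<nu>0" and lt: "D_theta \<nu>0 < D" and m: "(LINT x|\<nu>0. fst x) = pi"
  shows "\<exists>\<theta>1. (AE x in \<nu>0. \<theta>1 \<le> fst x \<and> fst x \<le> \<theta>1 + D) \<and> pi - D < \<theta>1 \<and> \<theta>1 < pi"
proof -
  interpret frequency_measure g \<nu>0 by (rule fm)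
  obtain l u where lu: "AE x in \<nu>0. l \<le> fst x \<and> fst x \<le> u" "u - l \<le> D_theta \<nu>0" "0 \<le> l" "u \<le> 2 * pi"
    using phase_range by blast
  have i: "integrable \<nu>0 fst"
  proof (rule integrable_const_bound[of _ "2 * pi"])
    show "AE x in \<nu>0. norm (fst x) \<le> 2 * pi" using lu(1) by eventually_elim (use lu in auto)
    show "fst \<in> borel_measurable \<nu>0" by (rule borel_measurable_phase[OF sets_nu]) measurable
  qed
  have l: "l \<le> pi" unfolding m[symmetric] by (rule integral_ge_const[OF i eventually_mono[OF lu(1)]]) auto
  have u: "pi \<le> u" unfolding m[symmetric] by (rule integral_le_const[OF i eventually_mono[OF lu(1)]]) auto
  define \<theta>1 where "\<theta>1 = l - (D - (u - l)) / 2"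
  have "AE x in \<nu>0. \<theta>1 \<le> fst x \<and> fst x \<le> \<theta>1 + D"
    using lu(1) by eventually_elim (use lu(2) lt in \<open>auto simp: \<theta>1_def field_simps\<close>)
  moreover have "pi - D < \<theta>1" "\<theta>1 < pi" using l u lu(2) lt by (auto simp: \<theta>1_def field_simps)
  ultimately show ?thesis by blast
qed

text \<open>Both solutions are written as families of phases over the same label space \<open>mass_space g\<close>. There the two
  frequencies cancel in the difference of the phase equations, which puts the abstract contraction estimate in
  force.\<close>

lemma arcs_contraction:
  assumes A: "kuramoto_arc K g \<mu>0 \<mu> a b \<theta>1 D" and B: "kuramoto_arc K g \<nu>0 \<nu> a b \<theta>2 D"
    and Dinf: "0 < Dinf" "Dinf < pi / 2" and t0: "t0 > 0"
    and wA: "\<And>t. t \<ge> t0 \<Longrightarrow> kuramoto_arc.width K \<mu> a b \<theta>1 D t \<le> Dinf"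
    and wB: "\<And>t. t \<ge> t0 \<Longrightarrow> kuramoto_arc.width K \<nu> a b \<theta>2 D t \<le> Dinf"
    and t: "t > t0" and p: "(p :: ennreal) \<ge> 1"
  shows "W_tilde p g (\<mu> t) (\<nu> t)
       \<le> ennreal (exp (- (2 * K * cos Dinf / pi) * (t - t0))) * W_tilde p g (\<mu> t0) (\<nu> t0)"
proof -
  interpret A: kuramoto_arc K g \<mu>0 \<mu> a b \<theta>1 D by (rule A)
  interpret B: kuramoto_arc K g \<nu>0 \<nu> a b \<theta>2 D by (rule B)
  define M where "M = mass_space g"
  interpret M: prob_space M unfolding M_def by (rule A.M0.prob_mass_space)
  have m: "f \<in> borel_measurable M" if "f \<in> borel_measurable (borel \<Otimes>\<^sub>M borel)" for f :: "real \<times> real \<Rightarrow> real"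
    unfolding M_def using that by (simp cong: measurable_cong_sets)
  have fr: "AE z in M. a \<le> fst z \<and> fst z \<le> b" unfolding M_def by (rule A.frequency_AE)
  have bnd: "B.bound = A.bound" by (simp add: A.bound_def B.bound_def)
  have b0: "A.bound \<ge> 0" using A.K_pos pi_gt_zero by (simp add: A.bound_def)
  interpret P: phase_contraction M A.phase B.phase A.phase' B.phase' K Dinf t0 A.bound
  proof
    show "0 < K" by (rule A.K_pos)
    show "0 < Dinf" "Dinf < pi / 2" "0 < t0" by fact+
    show "A.phase s \<in> borel_measurable M" "B.phase s \<in> borel_measurable M"
      "A.phase' s \<in> borel_measurable M" "B.phase' s \<in> borel_measurable M" if "s \<ge> 0" for s
      using that by (auto intro!: m A.phase_measurable B.phase_measurable A.phase'_measurable B.phase'_measurable)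
    show "AE e in M. \<forall>t>0. ((\<lambda>t. A.phase t e) has_real_derivative A.phase' t e) (at t) \<and>
        ((\<lambda>t. B.phase t e) has_real_derivative B.phase' t e) (at t)"
      by (intro AE_I2 allI impI conjI)
        (auto simp: A.phase_def A.phase'_def B.phase_def B.phase'_def A.DERIV_curve B.DERIV_curve)
    show "AE e in M. \<forall>t\<in>{0..T}. \<bar>A.phase t e\<bar> \<le> A.bound * (1 + T) \<and> \<bar>B.phase t e\<bar> \<le> A.bound * (1 + T) \<and>
        \<bar>A.phase' t e\<bar> \<le> A.bound \<and> \<bar>B.phase' t e\<bar> \<le> A.bound" for T
      using fr
    proof eventually_elim
      case (elim e)
      show ?case
      proof
        fix s assume s: "s \<in> {0..T}"
        then have "A.bound * (1 + s) \<le> A.bound * (1 + T)" using b0 by (intro mult_left_mono) auto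
        then show "\<bar>A.phase s e\<bar> \<le> A.bound * (1 + T) \<and> \<bar>B.phase s e\<bar> \<le> A.bound * (1 + T) \<and>
            \<bar>A.phase' s e\<bar> \<le> A.bound \<and> \<bar>B.phase' s e\<bar> \<le> A.bound"
          using A.phase_bounds[of e s] B.phase_bounds[of e s] elim s bnd by auto
      qed
    qed
    show "AE e in M. A.phase' s e - B.phase' s e
        = - K * (LINT e'|M. sin (A.phase s e - A.phase s e') - sin (B.phase s e - B.phase s e'))" if "s > 0" for s
    proof (rule AE_I2)
      fix e
      have s: "s \<ge> 0" using that by simp
      have i: "integrable M (\<lambda>e'. sin (F e - F e'))" if "F \<in> borel_measurable M" for F :: "real \<times> real \<Rightarrow> real"
      proof (rule M.integrable_const_bound[of _ 1])
        note [measurable] = that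
        show "(\<lambda>e'. sin (F e - F e')) \<in> borel_measurable M" by measurable
      qed simp
      have diff: "(LINT e'|M. sin (A.phase s e - A.phase s e') - sin (B.phase s e - B.phase s e'))
        = (LINT e'|M. sin (A.phase s e - A.phase s e')) - (LINT e'|M. sin (B.phase s e - B.phase s e'))"
        by (intro Bochner_Integration.integral_diff i m A.phase_measurable B.phase_measurable s)
      show "A.phase' s e - B.phase' s e
        = - K * (LINT e'|M. sin (A.phase s e - A.phase s e') - sin (B.phase s e - B.phase s e'))"
        unfolding diff A.phase_equation[OF s] B.phase_equation[OF s] M_def[symmetric] right_diff_distrib
        by simp
    qed
    show "(LINT e|M. A.phase s e) = (LINT e|M. B.phase s e)" if "s \<ge> 0" for s
      using A.mean_phase[OF that] B.mean_phase[OF that] by (simp add: M_def)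
    show "AE e in M. AE e' in M. \<bar>A.phase s e - A.phase s e'\<bar> \<le> Dinf \<and> \<bar>B.phase s e - B.phase s e'\<bar> \<le> Dinf"
      if s: "s \<ge> t0" for s
    proof -
      have s': "s \<ge> 0" using s t0 by simp
      show ?thesis
        using A.phase_close[OF s'] B.phase_close[OF s'] unfolding M_def[symmetric]
      proof eventually_elim
        case (elim e)
        from elim(1) elim(2) show ?case
          by eventually_elim (use wA[OF s] wB[OF s] in \<open>auto intro: order_trans\<close>)
      qed
    qed
  qed
  define r where "r = exp (P.rate * (t - t0))"
  have r: "r > 0" by (simp add: r_def)
  have rinv: "exp (- (2 * K * cos Dinf / pi) * (t - t0)) = 1 / r"
    by (simp add: r_def P.rate_def exp_minus inverse_eq_divide)
  have t0': "t0 \<ge> 0" and t': "t \<ge> 0" and tt: "t \<ge> t0" using t t0 by auto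
  have twin: "two_frequency_measures g (\<mu> s) (\<nu> s)" if "s \<ge> 0" for s
    using A.frequency_measure[OF that] B.frequency_measure[OF that] by (simp add: two_frequency_measures_def)
  interpret Q: two_frequency_measures g "\<mu> t" "\<nu> t" by (rule twin[OF t'])
  interpret Q0: two_frequency_measures g "\<mu> t0" "\<nu> t0" by (rule twin[OF t0'])
  have gap: "AE z in M. Q.gap z = \<bar>P.u t z\<bar>"
    using A.quantile_phase[OF t'] B.quantile_phase[OF t'] unfolding M_def
    by eventually_elim (simp add: Q.gap_def P.u_def)
  have gap0: "AE z in M. Q0.gap z = \<bar>P.u t0 z\<bar>"
    using A.quantile_phase[OF t0'] B.quantile_phase[OF t0'] unfolding M_def
    by eventually_elim (simp add: Q0.gap_def P.u_def)
  show ?thesis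
  proof (cases "p = top")
    case False
    then have ptop: "p < top" by (simp add: less_top)
    define q where "q = enn2real p"
    have q: "1 \<le> q"
    proof -
      have "enn2real 1 \<le> enn2real p" using p ptop by (intro enn2real_mono) auto
      then show ?thesis by (simp add: q_def)
    qed
    have e: "(LINT z|M. Q.gap z powr q) = (LINT z|M. \<bar>P.u t z\<bar> powr q)"
    proof (rule integral_cong_AE)
      show "(\<lambda>z. Q.gap z powr q) \<in> borel_measurable M" by (rule m) measurable
      show "(\<lambda>z. \<bar>P.u t z\<bar> powr q) \<in> borel_measurable M" using P.u_meas[OF t'] by measurable
      show "AE z in M. Q.gap z powr q = \<bar>P.u t z\<bar> powr q" by (rule eventually_mono[OF gap]) simp
    qed
    have e0: "(LINT z|M. Q0.gap z powr q) = (LINT z|M. \<bar>P.u t0 z\<bar> powr q)"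
    proof (rule integral_cong_AE)
      show "(\<lambda>z. Q0.gap z powr q) \<in> borel_measurable M" by (rule m) measurable
      show "(\<lambda>z. \<bar>P.u t0 z\<bar> powr q) \<in> borel_measurable M" using P.u_meas[OF t0'] by measurable
      show "AE z in M. Q0.gap z powr q = \<bar>P.u t0 z\<bar> powr q" by (rule eventually_mono[OF gap0]) simp
    qed
    define J where "J = (LINT z|M. \<bar>P.u t z\<bar> powr q)"
    define J0 where "J0 = (LINT z|M. \<bar>P.u t0 z\<bar> powr q)"
    have J: "0 \<le> J" unfolding J_def by (rule Bochner_Integration.integral_nonneg) simp
    have "r powr q * J \<le> J0" unfolding J_def J0_def r_def by (rule P.contraction_power[OF tt q])
    then have "(r powr q * J) powr (1 / q) \<le> J0 powr (1 / q)"
      using q r J by (intro powr_mono2) auto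
    then have "r * J powr (1 / q) \<le> J0 powr (1 / q)"
      using q r J by (simp add: powr_mult powr_powr)
    then have "J powr (1 / q) \<le> 1 / r * J0 powr (1 / q)" using r by (simp add: field_simps)
    then have "ennreal (J powr (1 / q)) \<le> ennreal (1 / r) * ennreal (J0 powr (1 / q))"
      using r by (simp add: ennreal_leI flip: ennreal_mult)
    then show ?thesis
      unfolding rinv Q.W_tilde_finite[OF p ptop] Q0.W_tilde_finite[OF p ptop] M_def[symmetric] q_def[symmetric] e e0 J_def J0_def .
  next
    case True
    show ?thesis
    proof (cases "W_tilde top g (\<mu> t0) (\<nu> t0)")
      case (real c)
      then have W0: "W_tilde top g (\<mu> t0) (\<nu> t0) = ennreal c" and c: "0 \<le> c" by auto
      have "AE z in M. ennreal (Q0.gap z) \<le> ennreal c"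
        using Q0.W_tilde_top_le_iff[of "ennreal c"] W0 unfolding M_def by simp
      then have "AE z in M. \<bar>P.u t0 z\<bar> \<le> c"
        using gap0 by eventually_elim (use c in simp)
      from P.contraction_uniform[OF tt c this]
      have "AE z in M. r * \<bar>P.u t z\<bar> \<le> c" by (simp add: r_def)
      then have "AE z in M. ennreal (Q.gap z) \<le> ennreal (1 / r * c)"
        using gap by eventually_elim (use r in \<open>auto simp: field_simps intro!: ennreal_leI\<close>)
      then have "W_tilde top g (\<mu> t) (\<nu> t) \<le> ennreal (1 / r * c)"
        unfolding Q.W_tilde_top_le_iff M_def .
      also have "\<dots> = ennreal (1 / r) * ennreal c" using r c by (intro ennreal_mult) auto
      finally show ?thesis unfolding True rinv using W0 by simp
    next
      case top
      then show ?thesis unfolding True rinv using r by (simp add: ennreal_mult_top)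
    qed
  qed
qed

text \<open>For small \<open>D0\<close> take \<open>\<pi> - D0\<close>, which has the same sine; otherwise enlarge \<open>D0\<close> slightly, using continuity.\<close>

lemma exists_arc_length:
  fixes D0 K \<delta> :: real
  assumes "0 < D0" "D0 < pi" "K > 0" "\<delta> < K * sin D0"
  shows "\<exists>D. D0 < D \<and> pi / 2 < D \<and> D < pi \<and> \<delta> < K * sin D"
proof (cases "D0 < pi / 2")
  case True
  then show ?thesis using assms by (intro exI[of _ "pi - D0"]) auto
next
  case False
  have "((\<lambda>x. K * sin x) \<longlongrightarrow> K * sin D0) (at_right D0)" by (intro tendsto_intros)
  then have "\<forall>\<^sub>F x in at_right D0. \<delta> < K * sin x" using assms(4) by (rule order_tendstoD(1))
  moreover have "\<forall>\<^sub>F x in at_right D0. x \<in> {D0<..<pi}" using assms(2) by (rule eventually_at_right_real)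
  ultimately have "\<forall>\<^sub>F x in at_right D0. \<delta> < K * sin x \<and> x \<in> {D0<..<pi}" by eventually_elim simp
  then obtain x where "\<delta> < K * sin x" "D0 < x" "x < pi"
    using eventually_happens'[OF trivial_limit_at_right_real] by fastforce
  then show ?thesis using False by (intro exI[of _ x]) auto
qed

theorem theorem5p1:
  fixes K :: real and g :: "real \<Rightarrow> real"
    and \<mu>0 \<nu>0 :: "(real \<times> real) measure"
    and \<mu> \<nu> :: "real \<Rightarrow> (real \<times> real) measure"
  assumes "K > 0"
    and "frequency_density g"
    and "radon_measure \<mu>0" and "radon_measure \<nu>0"
    and "prob_space \<mu>0" and "prob_space \<nu>0"
    and "has_frequency_density \<mu>0 g" and "has_frequency_density \<nu>0 g"
    and "0 < D_theta \<nu>0" and "D_theta \<nu>0 \<le> D_theta \<mu>0" and "D_theta \<mu>0 < pi"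
    and "pairing \<mu>0 (\<lambda>\<theta> \<Omega>. \<theta>) = pi" and "pairing \<nu>0 (\<lambda>\<theta> \<Omega>. \<theta>) = pi"
    and "K > D_Omega \<mu>0 * max (1 / sin (D_theta \<mu>0)) (1 / sin (D_theta \<nu>0))"
    and "mv_solution K \<mu>0 \<mu>" and "mv_solution K \<nu>0 \<nu>"
  shows "\<exists>t0>0. \<exists>Dinf. 0 < Dinf \<and> Dinf < pi / 2 \<and>
    (\<forall>t\<ge>t0. D_theta (\<mu> t) \<le> Dinf \<and> D_theta (\<nu> t) \<le> Dinf) \<and>
    (\<forall>t>t0. \<forall>p::ennreal\<ge>1. W_tilde p g (\<mu> t) (\<nu> t)
       \<le> ennreal (exp (- (2 * K * cos Dinf / pi) * (t - t0))) * W_tilde p g (\<mu> t0) (\<nu> t0))"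
proof -
  have fm: "frequency_measure g \<mu>0" "frequency_measure g \<nu>0"
    using assms by (auto simp: frequency_measure_def radon_measure_def)
  interpret M0: frequency_measure g \<mu>0 by (rule fm(1))
  interpret N0: frequency_measure g \<nu>0 by (rule fm(2))
  obtain a b where ab: "AE x in \<mu>0. a \<le> snd x \<and> snd x \<le> b" "b - a \<le> D_Omega \<mu>0"
    using M0.frequency_range by blast
  have P: "Measurable.pred borel (\<lambda>w. a \<le> w \<and> w \<le> b)" by measurable
  have ab': "AE x in \<nu>0. a \<le> snd x \<and> snd x \<le> b"
    using ab(1) M0.AE_frequency_iff[OF P] N0.AE_frequency_iff[OF P] by simp
  define D0 where "D0 = D_theta \<mu>0"
  have D0: "0 < D0" "D0 < pi" using assms by (auto simp: D0_def)
  have s0: "sin D0 > 0" using D0 by (rule sin_gt_zero)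
  have "0 \<le> b - a"
  proof -
    have "AE x in \<mu>0. 0 \<le> b - a" using ab(1) by eventually_elim auto
    then show ?thesis by simp
  qed
  then have "D_Omega \<mu>0 * (1 / sin D0) \<le> D_Omega \<mu>0 * max (1 / sin (D_theta \<mu>0)) (1 / sin (D_theta \<nu>0))"
    using ab(2) by (intro mult_left_mono) (auto simp: D0_def)
  then have "D_Omega \<mu>0 / sin D0 < K" using assms(14) by simp
  then have "D_Omega \<mu>0 < K * sin D0" using s0 by (simp add: pos_divide_less_eq)
  then have "b - a < K * sin D0" using ab(2) by simp
  then obtain D where D: "D0 < D" "pi / 2 < D" "D < pi" "b - a < K * sin D"
    using exists_arc_length[OF D0 assms(1)] by blast
  have mean: "(LINT x|\<mu>0. fst x) = pi" "(LINT x|\<nu>0. fst x) = pi" using assms(12,13) by (auto simp: pairing_def)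
  obtain \<theta>1 where \<theta>1: "AE x in \<mu>0. \<theta>1 \<le> fst x \<and> fst x \<le> \<theta>1 + D" "pi - D < \<theta>1" "\<theta>1 < pi"
    using initial_arc[OF fm(1) _ mean(1), of D] D(1) unfolding D0_def by blast
  have "D_theta \<nu>0 < D" using D(1) assms(10) by (simp add: D0_def)
  from initial_arc[OF fm(2) this mean(2)]
  obtain \<theta>2 where \<theta>2: "AE x in \<nu>0. \<theta>2 \<le> fst x \<and> fst x \<le> \<theta>2 + D" "pi - D < \<theta>2" "\<theta>2 < pi"
    by blast
  have A: "kuramoto_arc K g \<mu>0 \<mu> a b \<theta>1 D"
    by (intro kuramoto_arc.intro kuramoto_solution.intro kuramoto_arc_axioms.intro) (use assms ab D \<theta>1 mean in auto)
  have B: "kuramoto_arc K g \<nu>0 \<nu> a b \<theta>2 D"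
    by (intro kuramoto_arc.intro kuramoto_solution.intro kuramoto_arc_axioms.intro) (use assms ab' D \<theta>2 mean in auto)
  interpret A: kuramoto_arc K g \<mu>0 \<mu> a b \<theta>1 D by (rule A)
  interpret B: kuramoto_arc K g \<nu>0 \<nu> a b \<theta>2 D by (rule B)
  \<comment> \<open>The widths of both arcs tend to at most \<open>\<pi> - D\<close>; any bound strictly between this value and \<open>\<pi>/2\<close> will do.\<close>
  define Dinf where "Dinf = ((pi - D) + pi / 2) / 2"
  have Dinf: "0 < Dinf" "Dinf < pi / 2" "pi - D < Dinf" using D by (auto simp: Dinf_def)
  define \<kappa> where "\<kappa> = (K * sin D - (b - a)) / D"
  have \<kappa>: "\<kappa> > 0" using D pi_gt_zero by (simp add: \<kappa>_def)
  define e where "e = Dinf - (pi - D)"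
  have e: "e > 0" using Dinf by (simp add: e_def)
  have Dpos: "D > 0" using D pi_gt_zero by linarith
  \<comment> \<open>By \<open>x \<le> exp x\<close> the exponential term of \<open>width_decay\<close> is then at most \<open>e\<close>.\<close>
  define t0 where "t0 = D / (e * \<kappa>)"
  have t0: "t0 > 0" using Dpos e \<kappa> by (simp add: t0_def)
  have small: "(pi - D) + D * exp (- \<kappa> * t) \<le> Dinf" if "t \<ge> t0" for t
  proof -
    have x: "\<kappa> * t \<ge> D / e" using that \<kappa> e by (simp add: t0_def field_simps)
    have "D / e \<le> exp (\<kappa> * t)" using x exp_ge_add_one_self[of "\<kappa> * t"] by linarith
    then have "D \<le> e * exp (\<kappa> * t)" using e by (simp add: field_simps)
    then have "D * exp (- \<kappa> * t) \<le> e" by (simp add: exp_minus field_simps)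
    then show ?thesis by (simp add: e_def)
  qed
  have wA: "A.width t \<le> Dinf" and wB: "B.width t \<le> Dinf" if "t \<ge> t0" for t
    using A.width_decay[of t] B.width_decay[of t] small[OF that] that t0 unfolding \<kappa>_def by linarith+
  have dA: "D_theta (\<mu> t) \<le> Dinf" and dB: "D_theta (\<nu> t) \<le> Dinf" if t: "t \<ge> t0" for t
  proof -
    have t': "t \<ge> 0" using t t0 by simp
    have "D_theta (\<mu> t) \<le> A.upper t - A.lower t"
      by (rule D_theta_le[OF A.sets[OF t'] _ _ _ A.in_arc[OF t']])
        (use A.arc_inside[OF t'] A.width_pos[OF t'] in \<open>auto simp: A.width_def\<close>)
    then show "D_theta (\<mu> t) \<le> Dinf" using wA[OF t] by (simp add: A.width_def)
    have "D_theta (\<nu> t) \<le> B.upper t - B.lower t"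
      by (rule D_theta_le[OF B.sets[OF t'] _ _ _ B.in_arc[OF t']])
        (use B.arc_inside[OF t'] B.width_pos[OF t'] in \<open>auto simp: B.width_def\<close>)
    then show "D_theta (\<nu> t) \<le> Dinf" using wB[OF t] by (simp add: B.width_def)
  qed
  have "W_tilde p g (\<mu> t) (\<nu> t)
       \<le> ennreal (exp (- (2 * K * cos Dinf / pi) * (t - t0))) * W_tilde p g (\<mu> t0) (\<nu> t0)"
    if "t > t0" "1 \<le> p" for t p
    by (rule arcs_contraction[OF A B Dinf(1,2) t0 wA wB that])
  then show ?thesis using t0 Dinf dA dB by (intro exI[of _ t0] exI[of _ Dinf] conjI allI impI) auto
qed

end
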